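(* Let $q$ be an integer, $G$ a profinite group, and $A=\mathbb Q[{\bf x}([U]),{\bf y}([U]):[U]\in\mathcal O(G)]$, where the ${\bf x}([U]),{\bf y}([U])$ are indeterminates. Let $\Phi^q:A^{\mathcal O(G)}\to{\rm Gh}(G,A)$ be the (bijective) map $$\Phi^q({\bf a})([U])=\sum_{[V]\preceq[U]}\varphi_U(G/V)\,q^{(V:U)-1}\,{\bf a}([V])^{(V:U)},$$ and for $[U]\in\mathcal O(G)$ set $$\mathfrak s_{[U]}:=(\Phi^q)^{-1}(\Phi^q({\bf x})+\Phi^q({\bf y}))([U]),\qquad \mathfrak p_{[U]}:=(\Phi^q)^{-1}(\Phi^q({\bf x})\cdot\Phi^q({\bf y}))([U]).$$ Then for every open subgroup $U$ of $G$, $$\mathfrak s_{[U]},\ \mathfrak p_{[U]}\in\mathbb Z[{\bf x}([V]),{\bf y}([V]):[V]\preceq[U]].$$ Furthermore, given ${\bf a}\in A^{\mathcal O(G)}$, there exists a unique $\iota_{\bf a}\in A^{\mathcal O(G)}$ such that for all $[U]\in\mathcal O(G)$ one has $\iota_{\bf a}([U])\in\mathbb Z[{\bf a}([V]):[V]\preceq[U]]$ and $$0=\mathfrak s_{[U]}({\bf a}([V]),\iota_{\bf a}([V]):[V]\preceq[U]),$$ where the right-hand side denotes the polynomial $\mathfrak s_{[U]}$ with ${\bf a}([V])$ substituted for ${\bf x}([V])$ and $\iota_{\bf a}([V])$ for ${\bf y}([V])$.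
   Context: For a profinite group $G$, an open subgroup $U$ and a $G$-space $X$, $\varphi_U(X)$ is the cardinality of the set $X^U$ of $U$-fixed points; $G/V$ is the $G$-space of left cosets. $\mathcal O(G)$ is the set of conjugacy classes $[U]$ of open subgroups of $G$, partially ordered by $[V]\preceq[U]$ iff $U$ is contained in some $G$-conjugate of $V$; for $[V]\preceq[U]$, $(V:U):=(G:U)/(G:V)$. The ghost ring ${\rm Gh}(G,A)$ is $A^{\mathcal O(G)}$ with componentwise addition and multiplication. Convention: $q^0=1$, also for $q=0$. In the definition of $\mathfrak s_{[U]},\mathfrak p_{[U]}$, ${\bf x}$ and ${\bf y}$ are the vectors of indeterminates. For elements $a_i\in A$, $\mathbb Z[a_i]$ is the set of polynomial expressions in the $a_i$ with integer coefficients. *)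

theory Defs
  imports
    "HOL-Analysis.Analysis"
    "HOL-Algebra.Left_Coset"
    "HOL-Library.Poly_Mapping"
begin

section \<open>Profinite groups and conjugacy classes of open subgroups\<close>

locale profinite_group = group G for G (structure) +
  fixes T :: "'a topology"
  assumes topspace_eq: "topspace T = carrier G"
    and mult_continuous:
      "continuous_map (prod_topology T T) T (\<lambda>(x, y). x \<otimes> y)"
    and inv_continuous: "continuous_map T T (\<lambda>x. inv x)"
    and compact: "compact_space T"
    and Hausdorff: "Hausdorff_space T"
    and totally_disconnected:
      "\<And>x. x \<in> carrier G \<Longrightarrow> connected_component_of_set T x = {x}"

definition open_subgroup :: "('a, 'm) monoid_scheme \<Rightarrow> 'a topology \<Rightarrow> 'a set \<Rightarrow> bool"
  where "open_subgroup G T U \<longleftrightarrow> subgroup U G \<and> openin T U"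

definition conjugate :: "('a, 'm) monoid_scheme \<Rightarrow> 'a \<Rightarrow> 'a set \<Rightarrow> 'a set"
  where "conjugate G g U = (g <#\<^bsub>G\<^esub> U) #>\<^bsub>G\<^esub> inv\<^bsub>G\<^esub> g"

definition conj_class :: "('a, 'm) monoid_scheme \<Rightarrow> 'a set \<Rightarrow> 'a set set"
  where "conj_class G U = {conjugate G g U | g. g \<in> carrier G}"

definition open_classes :: "('a, 'm) monoid_scheme \<Rightarrow> 'a topology \<Rightarrow> 'a set set set"
  where "open_classes G T = {conj_class G U | U. open_subgroup G T U}"

definition class_le ::
  "('a, 'm) monoid_scheme \<Rightarrow> 'a topology \<Rightarrow> 'a set set \<Rightarrow> 'a set set \<Rightarrow> bool"
  where "class_le G T C D \<longleftrightarrow>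
    (\<exists>V U. open_subgroup G T V \<and> open_subgroup G T U \<and>
           C = conj_class G V \<and> D = conj_class G U \<and>
           (\<exists>g\<in>carrier G. U \<subseteq> conjugate G g V))"

definition down_classes ::
  "('a, 'm) monoid_scheme \<Rightarrow> 'a topology \<Rightarrow> 'a set set \<Rightarrow> 'a set set set"
  where "down_classes G T D = {C \<in> open_classes G T. class_le G T C D}"

text \<open>The numbers \<open>(V:U)\<close> and \<open>\<phi>\<^sub>U(G/V)\<close> depend only on the conjugacy classes of
  \<open>U\<close> and \<open>V\<close>, so they may be computed on an arbitrary representative of each class.\<close>

definition class_rep :: "'a set set \<Rightarrow> 'a set"
  where "class_rep C = (SOME U. U \<in> C)"

definition subgroup_index :: "('a, 'm) monoid_scheme \<Rightarrow> 'a set \<Rightarrow> nat"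
  where "subgroup_index G U = card (lcosets\<^bsub>G\<^esub> U)"

text \<open>\<open>class_index G C D\<close> is \<open>(V:U) = (G:U)/(G:V)\<close> for \<open>C = [V]\<close>, \<open>D = [U]\<close>; for
  \<open>[V] \<preceq> [U]\<close> the division is exact.\<close>

definition class_index :: "('a, 'm) monoid_scheme \<Rightarrow> 'a set set \<Rightarrow> 'a set set \<Rightarrow> nat"
  where "class_index G C D =
    subgroup_index G (class_rep D) div subgroup_index G (class_rep C)"

text \<open>\<open>num_fixed act X U\<close> is \<open>\<phi>\<^sub>U(X)\<close>, the cardinality of \<open>X\<^sup>U\<close>.\<close>

definition num_fixed :: "('a \<Rightarrow> 'x \<Rightarrow> 'x) \<Rightarrow> 'x set \<Rightarrow> 'a set \<Rightarrow> nat"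
  where "num_fixed act X U = card {x \<in> X. \<forall>u\<in>U. act u x = x}"

definition class_fixed :: "('a, 'm) monoid_scheme \<Rightarrow> 'a set set \<Rightarrow> 'a set set \<Rightarrow> nat"
  where "class_fixed G D C =
    num_fixed (\<lambda>g K. g <#\<^bsub>G\<^esub> K) (lcosets\<^bsub>G\<^esub> (class_rep C)) (class_rep D)"


section \<open>Multivariate polynomials\<close>

text \<open>A polynomial in variables from \<open>'v\<close> is a finitely supported function on monomials,
  a monomial being a finitely supported exponent function. The ring operations on
  \<^typ>\<open>('v \<Rightarrow>\<^sub>0 nat) \<Rightarrow>\<^sub>0 'c\<close> provided by the type class instances are the usual ones.\<close>

type_synonym ('v, 'c) mpoly = "('v \<Rightarrow>\<^sub>0 nat) \<Rightarrow>\<^sub>0 'c"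

definition mp_const :: "'c::zero \<Rightarrow> ('v, 'c) mpoly"
  where "mp_const c = Poly_Mapping.single 0 c"

definition mp_var :: "'v \<Rightarrow> ('v, 'c::zero_neq_one) mpoly"
  where "mp_var v = Poly_Mapping.single (Poly_Mapping.single v 1) 1"

definition mp_vars :: "('v, 'c::zero) mpoly \<Rightarrow> 'v set"
  where "mp_vars p = (\<Union>m\<in>Poly_Mapping.keys p. Poly_Mapping.keys m)"

text \<open>Substitution of \<open>f v\<close> for each variable \<open>v\<close>, with coefficients mapped by \<open>h\<close>.\<close>

definition mp_subst ::
  "('c::zero \<Rightarrow> 'r::comm_semiring_1) \<Rightarrow> ('v \<Rightarrow> 'r) \<Rightarrow> ('v, 'c) mpoly \<Rightarrow> 'r"
  where "mp_subst h f p =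
    (\<Sum>m\<in>Poly_Mapping.keys p. h (Poly_Mapping.lookup p m) *
       (\<Prod>v\<in>Poly_Mapping.keys m. f v ^ Poly_Mapping.lookup m v))"

text \<open>\<open>int_poly_exprs S\<close> is \<open>\<int>[a : a \<in> S]\<close>; the elements of \<open>S\<close> themselves serve as names
  for the variables of the integer polynomials.\<close>

definition int_poly_exprs :: "'r::comm_ring_1 set \<Rightarrow> 'r set"
  where "int_poly_exprs S =
    {mp_subst of_int (\<lambda>a. a) p | p :: ('r, int) mpoly. mp_vars p \<subseteq> S}"


section \<open>The ghost map and the polynomials \<open>\<ss>\<close> and \<open>\<pp>\<close>\<close>

datatype 'k indet = X 'k | Y 'k

text \<open>The ring \<open>A = \<rat>[x([U]), y([U]) : [U] \<in> \<O>(G)]\<close>: polynomials in indeterminates indexed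
  by arbitrary sets of sets, of which only those indexed by \<open>\<O>(G)\<close> may occur.\<close>

definition ringA :: "('a, 'm) monoid_scheme \<Rightarrow> 'a topology \<Rightarrow> ('a set set indet, rat) mpoly set"
  where "ringA G T =
    {p. mp_vars p \<subseteq> X ` open_classes G T \<union> Y ` open_classes G T}"

text \<open>The underlying set of both \<open>A\<^bsup>\<O>(G)\<^esup>\<close> and the ghost ring; functions are
  \<^const>\<open>undefined\<close> outside \<open>\<O>(G)\<close>.\<close>

definition vecA ::
  "('a, 'm) monoid_scheme \<Rightarrow> 'a topology \<Rightarrow>
   ('a set set \<Rightarrow> ('a set set indet, rat) mpoly) set"
  where "vecA G T = open_classes G T \<rightarrow>\<^sub>E ringA G T"

definition ghost_add ::
  "('a, 'm) monoid_scheme \<Rightarrow> 'a topology \<Rightarrow>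
   ('a set set \<Rightarrow> 'r::comm_ring_1) \<Rightarrow> ('a set set \<Rightarrow> 'r) \<Rightarrow> 'a set set \<Rightarrow> 'r"
  where "ghost_add G T a b = (\<lambda>D\<in>open_classes G T. a D + b D)"

definition ghost_mult ::
  "('a, 'm) monoid_scheme \<Rightarrow> 'a topology \<Rightarrow>
   ('a set set \<Rightarrow> 'r::comm_ring_1) \<Rightarrow> ('a set set \<Rightarrow> 'r) \<Rightarrow> 'a set set \<Rightarrow> 'r"
  where "ghost_mult G T a b = (\<lambda>D\<in>open_classes G T. a D * b D)"

definition Phi ::
  "('a, 'm) monoid_scheme \<Rightarrow> 'a topology \<Rightarrow> int \<Rightarrow>
   ('a set set \<Rightarrow> 'r::comm_ring_1) \<Rightarrow> 'a set set \<Rightarrow> 'r"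
  where "Phi G T q a = (\<lambda>D\<in>open_classes G T.
    \<Sum>C\<in>down_classes G T D.
      of_nat (class_fixed G D C) * of_int q ^ (class_index G C D - 1) * a C ^ class_index G C D)"

definition Phi_inv ::
  "('a, 'm) monoid_scheme \<Rightarrow> 'a topology \<Rightarrow> int \<Rightarrow>
   ('a set set \<Rightarrow> ('a set set indet, rat) mpoly) \<Rightarrow>
   'a set set \<Rightarrow> ('a set set indet, rat) mpoly"
  where "Phi_inv G T q = inv_into (vecA G T) (Phi G T q)"

definition vec_x ::
  "('a, 'm) monoid_scheme \<Rightarrow> 'a topology \<Rightarrow> 'a set set \<Rightarrow> ('a set set indet, rat) mpoly"
  where "vec_x G T = (\<lambda>C\<in>open_classes G T. mp_var (X C))"

definition vec_y ::
  "('a, 'm) monoid_scheme \<Rightarrow> 'a topology \<Rightarrow> 'a set set \<Rightarrow> ('a set set indet, rat) mpoly"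
  where "vec_y G T = (\<lambda>C\<in>open_classes G T. mp_var (Y C))"

definition s_poly ::
  "('a, 'm) monoid_scheme \<Rightarrow> 'a topology \<Rightarrow> int \<Rightarrow> 'a set set \<Rightarrow> ('a set set indet, rat) mpoly"
  where "s_poly G T q =
    Phi_inv G T q (ghost_add G T (Phi G T q (vec_x G T)) (Phi G T q (vec_y G T)))"

definition p_poly ::
  "('a, 'm) monoid_scheme \<Rightarrow> 'a topology \<Rightarrow> int \<Rightarrow> 'a set set \<Rightarrow> ('a set set indet, rat) mpoly"
  where "p_poly G T q =
    Phi_inv G T q (ghost_mult G T (Phi G T q (vec_x G T)) (Phi G T q (vec_y G T)))"

text \<open>\<open>subst_xy a b p\<close> is \<open>p\<close> with \<open>a([V])\<close> substituted for \<open>x([V])\<close> and \<open>b([V])\<close> for \<open>y([V])\<close>.\<close>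

definition subst_xy ::
  "('k \<Rightarrow> ('v, rat) mpoly) \<Rightarrow> ('k \<Rightarrow> ('v, rat) mpoly) \<Rightarrow> ('k indet, rat) mpoly \<Rightarrow> ('v, rat) mpoly"
  where "subst_xy a b p = mp_subst mp_const (case_indet a b) p"

end

theory Submission
  imports
    Defs
    "HOL-Algebra.Zassenhaus"
    "HOL-Algebra.Generated_Groups"
begin

text \<open>
  Let \<open>U\<close> be an open subgroup, \<open>Q = N(U)/U\<close>, let \<open>\<psi>\<^sub>d\<close> be the endomorphism \<open>x \<mapsto> x\<^sup>d\<close> on
  variables, and for \<open>s \<in> Q\<close> of order \<open>o(s)\<close> let \<open>U\<^sub>s\<close> be the preimage in \<open>N(U)\<close> of the subgroup
  generated by \<open>s\<close>. For \<open>q = 1\<close> every ghost vector \<open>b\<close> of the form \<open>[U] \<mapsto> \<phi>\<^sub>U(G/V) M\<^bsup>(V:U)\<^esup>\<close>, and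
  every product of two of these, satisfies Dwork's congruence: \<open>|Q|\<close> divides the sum over
  \<open>s \<in> Q\<close> of \<open>\<psi>\<^bsub>o(s)\<^esub> b([U\<^sub>s])\<close>. Indeed, modulo \<open>|Q|\<close> the polynomial \<open>M\<close> is a sum of monomials, and
  then this sum counts, with weights, the fixed points of the elements of \<open>Q\<close> on the colourings
  by these monomials of the sets of right \<open>U\<close>-cosets in the \<open>U\<close>-fixed left cosets \<open>gV\<close>; here \<open>Q\<close>
  acts freely on the right \<open>U\<close>-cosets, and Burnside's lemma applies.

  For general \<open>q\<close> one has \<open>q \<Phi>\<^sup>q(a) = \<Phi>\<^sup>1(q a)\<close>, which gives the congruence up to a factor \<open>q\<^sup>2\<close>.
  At the primes dividing \<open>q\<close> it is enough that \<open>\<phi>\<^sub>U(G/V) q\<^bsup>(V:U)-1\<^esup>\<close> is itself divisible by the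
  relevant part of \<open>|Q|\<close>. Subtracting from \<open>b = \<Phi>\<^sup>q(a)\<close> the contributions of the classes strictly
  below \<open>[U]\<close> leaves \<open>|Q| a([U])\<close> at \<open>[U]\<close> and \<open>0\<close> at the other \<open>[U\<^sub>s]\<close>, so \<open>a([U])\<close> is integral
  by induction. The inverse \<open>\<iota>\<close> is obtained from \<open>b = - \<Phi>\<^sup>q(x)\<close> by substitution.
\<close>

section \<open>Evaluation of multivariate polynomials as a ring homomorphism\<close>

section \<open>Substitution\<close>

definition mono_eval :: "('v \<Rightarrow> 'r::comm_semiring_1) \<Rightarrow> ('v \<Rightarrow>\<^sub>0 nat) \<Rightarrow> 'r"
  where "mono_eval f m = (\<Prod>v\<in>Poly_Mapping.keys m. f v ^ Poly_Mapping.lookup m v)"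

text \<open>Variables outside the support contribute \<open>f v ^ 0 = 1\<close>. The larger index
  set lets two monomials be multiplied over common variables.\<close>

lemma mono_eval_superset:
  assumes "finite A" "Poly_Mapping.keys m \<subseteq> A"
  shows "mono_eval f m = (\<Prod>v\<in>A. f v ^ Poly_Mapping.lookup m v)"
  unfolding mono_eval_def using assms
  by (intro prod.mono_neutral_left) (auto simp: in_keys_iff)

lemma mono_eval_add: "mono_eval f (m + n) = mono_eval f m * mono_eval f n"
proof -
  let ?A = "Poly_Mapping.keys m \<union> Poly_Mapping.keys n"
  have "mono_eval f (m + n) = (\<Prod>v\<in>?A. f v ^ Poly_Mapping.lookup (m + n) v)"
    by (rule mono_eval_superset) (auto dest: subsetD[OF Poly_Mapping.keys_add])
  also have "\<dots> = (\<Prod>v\<in>?A. f v ^ Poly_Mapping.lookup m v) * (\<Prod>v\<in>?A. f v ^ Poly_Mapping.lookup n v)"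
    by (simp add: lookup_add power_add prod.distrib)
  finally show ?thesis
    by (simp flip: mono_eval_superset)
qed

lemma mono_eval_zero [simp]: "mono_eval f 0 = 1"
  by (simp add: mono_eval_def)

lemma mono_eval_single [simp]: "mono_eval f (Poly_Mapping.single v n) = f v ^ n"
  by (simp add: mono_eval_superset[of "{v}"])

text \<open>Used for \<open>of_int\<close>, which evaluates the integer polynomials behind
  \<open>int_poly_exprs\<close>, and for \<open>mp_const\<close>, which underlies both
  \<open>adams\<close> and \<open>subst_xy\<close>.\<close>

locale coeff_hom =
  fixes h :: "'c::comm_ring_1 \<Rightarrow> 'r::comm_ring_1"
  assumes h_add: "h (a + b) = h a + h b"
    and h_mult: "h (a * b) = h a * h b"
    and h_one: "h 1 = 1"
begin

lemma h_zero: "h 0 = 0"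
  using h_add[of 0 0] by simp

lemma mp_subst_superset:
  assumes "finite A" "Poly_Mapping.keys p \<subseteq> A"
  shows "mp_subst h f p = (\<Sum>m\<in>A. h (Poly_Mapping.lookup p m) * mono_eval f m)"
  unfolding mp_subst_def mono_eval_def using assms
  by (intro sum.mono_neutral_left) (auto simp: in_keys_iff h_zero)

lemma mp_subst_single: "mp_subst h f (Poly_Mapping.single m c) = h c * mono_eval f m"
  by (simp add: mp_subst_superset[of "{m}"])

lemma mp_subst_zero: "mp_subst h f 0 = 0"
  by (simp add: mp_subst_def)

lemma mp_subst_add: "mp_subst h f (p + q) = mp_subst h f p + mp_subst h f q"
proof -
  let ?A = "Poly_Mapping.keys p \<union> Poly_Mapping.keys q"
  have "mp_subst h f (p + q) = (\<Sum>m\<in>?A. h (Poly_Mapping.lookup (p + q) m) * mono_eval f m)"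
    by (rule mp_subst_superset) (auto dest: subsetD[OF Poly_Mapping.keys_add])
  also have "\<dots> = (\<Sum>m\<in>?A. h (Poly_Mapping.lookup p m) * mono_eval f m)
      + (\<Sum>m\<in>?A. h (Poly_Mapping.lookup q m) * mono_eval f m)"
    by (simp add: lookup_add h_add algebra_simps sum.distrib)
  finally show ?thesis
    by (simp flip: mp_subst_superset)
qed

lemma mp_subst_sum: "mp_subst h f (\<Sum>i\<in>I. p i) = (\<Sum>i\<in>I. mp_subst h f (p i))"
  by (induction I rule: infinite_finite_induct) (auto simp: mp_subst_zero mp_subst_add)

end

lemma poly_mapping_eq_sum_single:
  "p = (\<Sum>m\<in>Poly_Mapping.keys p. Poly_Mapping.single m (Poly_Mapping.lookup p m))"
proof (rule poly_mapping_eqI)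
  fix k
  show "Poly_Mapping.lookup p k
    = Poly_Mapping.lookup (\<Sum>m\<in>Poly_Mapping.keys p. Poly_Mapping.single m (Poly_Mapping.lookup p m)) k"
    by (simp add: lookup_sum lookup_single when_def in_keys_iff)
qed

context coeff_hom
begin

text \<open>Both factors are expanded into single terms; by additivity only products of two single
  terms remain, and there the exponents add.\<close>

lemma mp_subst_mult: "mp_subst h f (p * q) = mp_subst h f p * mp_subst h f q"
proof -
  let ?t = "\<lambda>p m. Poly_Mapping.single m (Poly_Mapping.lookup p m)"
  have single: "mp_subst h f (?t p m * ?t q n) = mp_subst h f (?t p m) * mp_subst h f (?t q n)" for m n
    by (simp add: mult_single mp_subst_single h_mult mono_eval_add mult_ac)
  have "mp_subst h f (p * q)
      = mp_subst h f ((\<Sum>m\<in>Poly_Mapping.keys p. ?t p m) * (\<Sum>n\<in>Poly_Mapping.keys q. ?t q n))"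
    using poly_mapping_eq_sum_single by metis
  also have "\<dots> = mp_subst h f (\<Sum>m\<in>Poly_Mapping.keys p. ?t p m) * mp_subst h f (\<Sum>n\<in>Poly_Mapping.keys q. ?t q n)"
    unfolding sum_product mp_subst_sum single ..
  finally show ?thesis
    using poly_mapping_eq_sum_single by metis
qed

lemma mp_subst_one: "mp_subst h f 1 = 1"
  unfolding single_one[symmetric] mp_subst_single by (simp add: h_one)

lemma mp_subst_var: "mp_subst h f (mp_var v) = f v"
  by (simp add: mp_var_def mp_subst_single h_one)

lemma mp_subst_power: "mp_subst h f (p ^ n) = mp_subst h f p ^ n"
  by (induction n) (auto simp: mp_subst_one mp_subst_mult)

lemma mp_subst_uminus: "mp_subst h f (- p) = - mp_subst h f p"
  using mp_subst_add[of f p "- p"] by (simp add: mp_subst_zero eq_neg_iff_add_eq_0 add.commute)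

lemma mp_subst_diff: "mp_subst h f (p - q) = mp_subst h f p - mp_subst h f q"
  using mp_subst_add[of f p "- q"] by (simp add: mp_subst_uminus)

lemma mp_subst_of_nat: "mp_subst h f (of_nat n) = of_nat n"
  by (induction n) (auto simp: mp_subst_zero mp_subst_one mp_subst_add)

lemma mp_subst_of_int: "mp_subst h f (of_int n) = of_int n"
  by (cases n) (auto simp: mp_subst_of_nat mp_subst_uminus mp_subst_one mp_subst_diff)

lemmas mp_subst_hom = mp_subst_zero mp_subst_one mp_subst_add mp_subst_mult mp_subst_power
  mp_subst_uminus mp_subst_diff mp_subst_of_nat mp_subst_of_int mp_subst_var mp_subst_sum

end

interpretation of_int_hom: coeff_hom of_int
  by unfold_locales auto

interpretation mp_const_hom: coeff_hom "mp_const :: rat \<Rightarrow> ('v, rat) mpoly"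
  by unfold_locales (auto simp: mp_const_def single_add mult_single)

section \<open>Variables\<close>

lemma mp_vars_zero [simp]: "mp_vars 0 = {}"
  by (simp add: mp_vars_def)

lemma mp_vars_one [simp]: "mp_vars (1 :: ('v, 'c::comm_ring_1) mpoly) = {}"
  by (simp add: mp_vars_def)

lemma mp_vars_const [simp]: "mp_vars (mp_const c) = {}"
  by (simp add: mp_vars_def mp_const_def)

lemma mp_vars_var [simp]: "mp_vars (mp_var v :: ('v, 'c::comm_ring_1) mpoly) = {v}"
  by (simp add: mp_vars_def mp_var_def)

lemma mp_vars_add: "mp_vars (p + q) \<subseteq> mp_vars p \<union> mp_vars q"
  unfolding mp_vars_def using Poly_Mapping.keys_add[of p q] by auto

lemma mp_vars_mult: "mp_vars (p * q) \<subseteq> mp_vars p \<union> mp_vars (q :: ('v, 'c::comm_ring_1) mpoly)"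
proof
  fix v assume "v \<in> mp_vars (p * q)"
  then obtain m where "m \<in> Poly_Mapping.keys (p * q)" "v \<in> Poly_Mapping.keys m"
    by (auto simp: mp_vars_def)
  then obtain a b where "a \<in> Poly_Mapping.keys p" "b \<in> Poly_Mapping.keys q" "m = a + b"
    using Poly_Mapping.keys_mult[of p q] by auto
  with \<open>v \<in> Poly_Mapping.keys m\<close> show "v \<in> mp_vars p \<union> mp_vars q"
    using Poly_Mapping.keys_add[of a b] by (auto simp: mp_vars_def)
qed

lemma of_nat_eq_mp_const: "of_nat n = mp_const (of_nat n)"
  by (simp add: mp_const_def)

lemma of_int_eq_mp_const: "of_int n = mp_const (of_int n)"
  by (simp add: mp_const_def)

lemma mp_vars_of_int [simp]: "mp_vars (of_int n) = {}"
  by (simp only: of_int_eq_mp_const mp_vars_const)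

text \<open>Over the rationals \<open>n\<close> is invertible as a constant polynomial. Serves to
  divide by the diagonal entries of the ghost map.\<close>

lemma mpoly_cancel_of_nat:
  fixes p q :: "('v, rat) mpoly"
  assumes "of_nat n * p = of_nat n * q" "n \<noteq> 0"
  shows "p = q"
proof -
  have "mp_const (1 / of_nat n) * (of_nat n :: ('v, rat) mpoly) = 1"
    using \<open>n \<noteq> 0\<close> by (simp add: of_nat_eq_mp_const flip: mp_const_hom.h_mult mp_const_hom.h_one)
  then have "p = mp_const (1 / of_nat n) * (of_nat n * p)" "q = mp_const (1 / of_nat n) * (of_nat n * q)"
    by (simp_all flip: mult.assoc)
  with assms show ?thesis by metis
qed

section \<open>The subring generated by a set, and congruences inside it\<close>

section \<open>Integer polynomial expressions\<close>

lemma int_poly_exprs_of_int [simp, intro]: "of_int c \<in> int_poly_exprs S"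
  unfolding int_poly_exprs_def
  by (rule CollectI, rule exI[of _ "of_int c"]) (simp add: of_int_hom.mp_subst_hom)

lemma int_poly_exprs_zero [simp, intro]: "0 \<in> int_poly_exprs S"
  using int_poly_exprs_of_int[of 0 S] by simp

lemma int_poly_exprs_one [simp, intro]: "1 \<in> int_poly_exprs S"
  using int_poly_exprs_of_int[of 1 S] by simp

lemma int_poly_exprs_of_nat [simp, intro]: "of_nat c \<in> int_poly_exprs S"
  using int_poly_exprs_of_int[of "int c" S] by simp

lemma int_poly_exprs_base [intro]: "s \<in> S \<Longrightarrow> s \<in> int_poly_exprs S"
  unfolding int_poly_exprs_def
  by (rule CollectI, rule exI[of _ "mp_var s"]) (simp add: of_int_hom.mp_subst_hom)

lemma int_poly_exprs_add [intro]:
  assumes "a \<in> int_poly_exprs S" "b \<in> int_poly_exprs S"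
  shows "a + b \<in> int_poly_exprs S"
proof -
  obtain p q where "a = mp_subst of_int (\<lambda>a. a) p" "b = mp_subst of_int (\<lambda>a. a) q"
      "mp_vars p \<subseteq> S" "mp_vars q \<subseteq> S"
    using assms by (auto simp: int_poly_exprs_def)
  then show ?thesis
    using mp_vars_add[of p q] unfolding int_poly_exprs_def
    by (intro CollectI exI[of _ "p + q"]) (auto simp: of_int_hom.mp_subst_hom)
qed

lemma int_poly_exprs_mult [intro]:
  assumes "a \<in> int_poly_exprs S" "b \<in> int_poly_exprs S"
  shows "a * b \<in> int_poly_exprs S"
proof -
  obtain p q where "a = mp_subst of_int (\<lambda>a. a) p" "b = mp_subst of_int (\<lambda>a. a) q"
      "mp_vars p \<subseteq> S" "mp_vars q \<subseteq> S"
    using assms by (auto simp: int_poly_exprs_def)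
  then show ?thesis
    using mp_vars_mult[of p q] unfolding int_poly_exprs_def
    by (intro CollectI exI[of _ "p * q"]) (auto simp: of_int_hom.mp_subst_hom)
qed

lemma int_poly_exprs_uminus [intro]: "a \<in> int_poly_exprs S \<Longrightarrow> - a \<in> int_poly_exprs S"
  using int_poly_exprs_mult[OF int_poly_exprs_of_int[of "-1"]] by fastforce

lemma int_poly_exprs_power [intro]: "a \<in> int_poly_exprs S \<Longrightarrow> a ^ n \<in> int_poly_exprs S"
  by (induction n) auto

lemma int_poly_exprs_sum [intro]:
  "(\<And>i. i \<in> I \<Longrightarrow> a i \<in> int_poly_exprs S) \<Longrightarrow> (\<Sum>i\<in>I. a i) \<in> int_poly_exprs S"
  by (induction I rule: infinite_finite_induct) auto

lemma int_poly_exprs_prod [intro]: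
  "(\<And>i. i \<in> I \<Longrightarrow> a i \<in> int_poly_exprs S) \<Longrightarrow> (\<Prod>i\<in>I. a i) \<in> int_poly_exprs S"
  by (induction I rule: infinite_finite_induct) auto

text \<open>An evaluated integer polynomial is a sum of products of integers and powers of elements
  of \<open>S\<close>, so a property inherited along sums and products reaches it.\<close>

lemma int_poly_exprs_induct [consumes 1, case_names of_int base add mult]:
  assumes "a \<in> int_poly_exprs S"
    and of_int: "\<And>c. P (of_int c)" and base: "\<And>s. s \<in> S \<Longrightarrow> P s"
    and add: "\<And>a b. a \<in> int_poly_exprs S \<Longrightarrow> b \<in> int_poly_exprs S \<Longrightarrow> P a \<Longrightarrow> P b \<Longrightarrow> P (a + b)"
    and mult: "\<And>a b. a \<in> int_poly_exprs S \<Longrightarrow> b \<in> int_poly_exprs S \<Longrightarrow> P a \<Longrightarrow> P b \<Longrightarrow> P (a * b)"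
  shows "P a"
proof -
  \<comment> \<open>\<open>Q\<close> adds membership to \<open>P\<close>, since the cases
    \<open>add\<close> and \<open>mult\<close> offer membership as an assumption.\<close>
  define Q where "Q a \<longleftrightarrow> a \<in> int_poly_exprs S \<and> P a" for a
  have one: "Q 1" and zero: "Q 0"
    using of_int[of 1] of_int[of 0] by (auto simp: Q_def)
  have add': "Q (a + b)" and mult': "Q (a * b)" if "Q a" "Q b" for a b
    using that add mult by (auto simp: Q_def)
  have pow: "Q (a ^ n)" if "Q a" for a n
    using that by (induction n) (auto simp: one mult')
  have sum: "Q (\<Sum>i\<in>I. f i)" if "\<And>i. i \<in> I \<Longrightarrow> Q (f i)" for I :: "('a \<Rightarrow>\<^sub>0 nat) set" and f
    using that by (induction I rule: infinite_finite_induct) (auto simp: zero add')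
  have prod: "Q (\<Prod>i\<in>I. f i)" if "\<And>i. i \<in> I \<Longrightarrow> Q (f i)" for I :: "'a set" and f
    using that by (induction I rule: infinite_finite_induct) (auto simp: one mult')
  obtain p where p: "a = mp_subst of_int (\<lambda>a. a) p" "mp_vars p \<subseteq> S"
    using assms(1) by (auto simp: int_poly_exprs_def)
  have "Q a"
    unfolding p mp_subst_def
  proof (intro sum mult' prod pow)
    show "Q (of_int (Poly_Mapping.lookup p m))" for m
      by (auto simp: Q_def of_int)
    show "Q v" if "m \<in> Poly_Mapping.keys p" "v \<in> Poly_Mapping.keys m" for m v
      using that p(2) by (force simp: Q_def mp_vars_def intro: base)
  qed
  then show ?thesis by (simp add: Q_def)
qed

lemma int_poly_exprs_mono: "S \<subseteq> S' \<Longrightarrow> int_poly_exprs S \<subseteq> int_poly_exprs S'"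
  by (auto simp: int_poly_exprs_def)

text \<open>Carries the integrality of a universal polynomial over to the vectors substituted into
  it.\<close>

lemma (in coeff_hom) mp_subst_int_poly_exprs:
  "a \<in> int_poly_exprs S \<Longrightarrow> mp_subst h f a \<in> int_poly_exprs (mp_subst h f ` S)"
  by (induction a rule: int_poly_exprs_induct) (auto simp: mp_subst_hom)

text \<open>With rational coefficients every element is a multiple of a nonzero \<open>n\<close>;
  the congruence has content because the quotient \<open>k\<close> must lie in the integral
  subring.\<close>

definition cong_in :: "'r::comm_ring_1 set \<Rightarrow> nat \<Rightarrow> 'r \<Rightarrow> 'r \<Rightarrow> bool"
  where "cong_in S n a b \<longleftrightarrow> (\<exists>k\<in>int_poly_exprs S. a = b + of_nat n * k)"

lemma cong_in_refl [simp, intro]: "cong_in S n a a"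
  unfolding cong_in_def by (rule bexI[of _ 0]) auto

lemma cong_in_trans:
  assumes "cong_in S n a b" "cong_in S n b c"
  shows "cong_in S n a c"
proof -
  obtain k l where "k \<in> int_poly_exprs S" "l \<in> int_poly_exprs S" "a = b + of_nat n * k" "b = c + of_nat n * l"
    using assms by (auto simp: cong_in_def)
  then show ?thesis
    unfolding cong_in_def by (intro bexI[of _ "k + l"]) (auto simp: algebra_simps)
qed

lemma cong_in_add:
  assumes "cong_in S n a b" "cong_in S n c d"
  shows "cong_in S n (a + c) (b + d)"
proof -
  obtain k l where "k \<in> int_poly_exprs S" "l \<in> int_poly_exprs S" "a = b + of_nat n * k" "c = d + of_nat n * l"
    using assms by (auto simp: cong_in_def)
  then show ?thesis
    unfolding cong_in_def by (intro bexI[of _ "k + l"]) (auto simp: algebra_simps)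
qed

text \<open>The quotient for the product is \<open>b * l + d * k + n * k * l\<close>; its
  integrality rests on that of \<open>b\<close> and \<open>d\<close>.\<close>

lemma cong_in_mult:
  assumes "cong_in S n a b" "cong_in S n c d" and R: "b \<in> int_poly_exprs S" "d \<in> int_poly_exprs S"
  shows "cong_in S n (a * c) (b * d)"
proof -
  obtain k l where kl: "k \<in> int_poly_exprs S" "l \<in> int_poly_exprs S" "a = b + of_nat n * k" "c = d + of_nat n * l"
    using assms by (auto simp: cong_in_def)
  show ?thesis
    unfolding cong_in_def
  proof
    show "a * c = b * d + of_nat n * (b * l + d * k + of_nat n * k * l)"
      using kl by (auto simp: algebra_simps)
    show "b * l + d * k + of_nat n * k * l \<in> int_poly_exprs S"
      using kl R by (auto intro!: int_poly_exprs_add int_poly_exprs_mult)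
  qed
qed

lemma cong_in_power:
  assumes "cong_in S n a b" "b \<in> int_poly_exprs S"
  shows "cong_in S n (a ^ e) (b ^ e)"
  by (induction e) (auto intro: cong_in_mult assms)

lemma cong_in_sum:
  "(\<And>i. i \<in> I \<Longrightarrow> cong_in S n (a i) (b i)) \<Longrightarrow> cong_in S n (\<Sum>i\<in>I. a i) (\<Sum>i\<in>I. b i)"
  by (induction I rule: infinite_finite_induct) (auto intro: cong_in_add)

section \<open>Adams operations and sums of powers\<close>

section \<open>Frobenius lifts\<close>

text \<open>The Adams operation of degree \<open>d\<close>. On integral polynomials and for prime
  \<open>d\<close> it lifts the \<open>d\<close>-th power map modulo \<open>d\<close>; here
  \<open>d\<close> runs over the orders of elements of a finite group.\<close>

definition adams :: "nat \<Rightarrow> ('v, rat) mpoly \<Rightarrow> ('v, rat) mpoly"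
  where "adams d = mp_subst mp_const (\<lambda>v. mp_var v ^ d)"

lemmas adams_hom =
  mp_const_hom.mp_subst_hom[where f = "\<lambda>v. mp_var v ^ d" for d, folded adams_def]

lemma adams_1:
  "a \<in> int_poly_exprs (mp_var ` W) \<Longrightarrow> adams 1 a = a"
  by (induction a rule: int_poly_exprs_induct) (auto simp: adams_hom)

text \<open>Modulo \<open>n\<close>, every integral polynomial is a sum of monomials with coefficient \<open>1\<close>, and on
  these the operation \<open>adams d\<close> is the \<open>d\<close>-th power.\<close>

lemma adams_power_sums:
  assumes "a \<in> int_poly_exprs (mp_var ` W)" "n > 0"
  shows "\<exists>ms. set ms \<subseteq> int_poly_exprs (mp_var ` W) \<and>
    (\<forall>d. cong_in (mp_var ` W) n (adams d a) (\<Sum>m\<leftarrow>ms. m ^ d))"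
  using assms(1)
proof (induction a rule: int_poly_exprs_induct)
  case (of_int c)
  \<comment> \<open>The residue is nonnegative, hence a sum of copies of the monomial 1, whose
    powers do not depend on \<open>d\<close>.\<close>
  have "(of_int c :: ('b, rat) mpoly) = of_int (c mod int n) + of_int (int n * (c div int n))"
    unfolding of_int_add[symmetric] by simp
  also have "\<dots> = of_nat (nat (c mod int n)) + of_nat n * of_int (c div int n)"
    using \<open>n > 0\<close> by simp
  finally have "(of_int c :: ('b, rat) mpoly) = of_nat (nat (c mod int n)) + of_nat n * of_int (c div int n)" .
  then show ?case
    by (intro exI[of _ "replicate (nat (c mod int n)) 1"])
      (auto simp: adams_hom sum_list_replicate cong_in_def)
next
  case (base s)
  then show ?case by (intro exI[of _ "[s]"]) (auto simp: adams_hom)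
next
  case (add a b)
  then obtain ms ns where "set ms \<subseteq> int_poly_exprs (mp_var ` W)" "set ns \<subseteq> int_poly_exprs (mp_var ` W)"
    "\<And>d. cong_in (mp_var ` W) n (adams d a) (\<Sum>m\<leftarrow>ms. m ^ d)"
    "\<And>d. cong_in (mp_var ` W) n (adams d b) (\<Sum>m\<leftarrow>ns. m ^ d)"
    by blast
  then show ?case
    by (intro exI[of _ "ms @ ns"]) (auto simp: adams_hom intro: cong_in_add)
next
  case (mult a b)
  then obtain ms ns where *: "set ms \<subseteq> int_poly_exprs (mp_var ` W)" "set ns \<subseteq> int_poly_exprs (mp_var ` W)"
    "\<And>d. cong_in (mp_var ` W) n (adams d a) (\<Sum>m\<leftarrow>ms. m ^ d)"
    "\<And>d. cong_in (mp_var ` W) n (adams d b) (\<Sum>m\<leftarrow>ns. m ^ d)"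
    by blast
  have R: "(\<Sum>m\<leftarrow>ks. m ^ d) \<in> int_poly_exprs (mp_var ` W)"
    if "set ks \<subseteq> int_poly_exprs (mp_var ` W)" for ks d
    using that by (induction ks) auto
  \<comment> \<open>A product of two power sums is the power sum over all pairwise products, with
    one list for every \<open>d\<close>.\<close>
  have eq: "(\<Sum>m\<leftarrow>ms. m ^ d) * (\<Sum>m\<leftarrow>ns. m ^ d) = (\<Sum>m\<leftarrow>concat (map (\<lambda>m. map ((*) m) ns) ms). m ^ d)" for d
    by (induction ms) (auto simp: algebra_simps sum_list_const_mult o_def power_mult_distrib)
  show ?case
    using * by (intro exI[of _ "concat (map (\<lambda>m. map ((*) m) ns) ms)"])
      (auto simp: adams_hom R simp flip: eq intro!: cong_in_mult)
qed

section \<open>A divisibility\<close>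

text \<open>\<open>r\<close> collects the part of \<open>d\<close> prime to \<open>q\<close>. The
  rest is peeled off one gcd at a time: if \<open>d = g * e\<close> with
  \<open>g = gcd d q > 1\<close>, one extra factor \<open>q\<close> absorbs \<open>g\<close>, and
  \<open>e \<le> d - 1\<close> leaves room for it.\<close>

lemma coprime_factor_power_dvd:
  fixes q :: int and d :: nat
  assumes "d > 0"
  shows "\<exists>r. coprime r q \<and> int d dvd r * q ^ (d - 1)"
  using assms
proof (induction d rule: less_induct)
  case (less d)
  show ?case
  proof (cases "coprime (int d) q")
    case True
    then show ?thesis by (intro exI[of _ "int d"]) auto
  next
    case False
    define g where "g = nat (gcd (int d) q)"
    have g: "int g = gcd (int d) q" by (simp add: g_def)
    have "g \<noteq> 0" using less.prems g by (metis gcd_eq_0_iff of_nat_0 of_nat_eq_0_iff not_gr_zero)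
    moreover have "g \<noteq> 1"
    proof
      assume "g = 1"
      with g have "gcd (int d) q = 1" by simp
      with False show False by (simp add: coprime_iff_gcd_eq_1)
    qed
    ultimately have "g > 1" by simp
    have "int g dvd int d" "int g dvd q" using g by auto
    then obtain e where e: "d = g * e" by (auto elim: dvdE)
    with less.prems \<open>g > 1\<close> have "e > 0" "e < d" by auto
    with less.IH obtain r where r: "coprime r q" "int e dvd r * q ^ (e - 1)" by blast
    have "int d dvd q * (r * q ^ (e - 1))"
      using r(2) \<open>int g dvd q\<close> by (auto simp: e intro: mult_dvd_mono)
    also have "q * (r * q ^ (e - 1)) = r * q ^ e"
      using \<open>e > 0\<close> by (cases e) auto
    also have "\<dots> dvd r * q ^ (d - 1)"
      using \<open>e < d\<close> by (intro mult_dvd_mono le_imp_power_dvd) auto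
    finally show ?thesis using r(1) by blast
  qed
qed

section \<open>Burnside's lemma with weights, and invariant colourings\<close>

section \<open>Counting with finite group actions\<close>

locale finite_action = group Q for Q :: "('q, 'm) monoid_scheme" (structure) +
  fixes E :: "'e set" and act :: "'q \<Rightarrow> 'e \<Rightarrow> 'e"
  assumes finite_carrier: "finite (carrier Q)"
    and finite_space: "finite E"
    and act_closed: "s \<in> carrier Q \<Longrightarrow> x \<in> E \<Longrightarrow> act s x \<in> E"
    and act_one: "x \<in> E \<Longrightarrow> act \<one> x = x"
    and act_mult: "s \<in> carrier Q \<Longrightarrow> t \<in> carrier Q \<Longrightarrow> x \<in> E \<Longrightarrow> act (s \<otimes> t) x = act s (act t x)"
begin

lemma act_inv_act: "s \<in> carrier Q \<Longrightarrow> x \<in> E \<Longrightarrow> act (inv s) (act s x) = x"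
  using act_mult[of "inv s" s x] act_one[of x] by simp

lemma act_act_inv: "s \<in> carrier Q \<Longrightarrow> x \<in> E \<Longrightarrow> act s (act (inv s) x) = x"
  using act_mult[of s "inv s" x] act_one[of x] by simp

lemma act_inj: "s \<in> carrier Q \<Longrightarrow> inj_on (act s) E"
  by (metis act_inv_act inj_onI)

text \<open>Orbit and stabiliser: for \<open>y = act h x\<close>, right multiplication by
  \<open>h\<close> maps the stabiliser of \<open>y\<close> onto the fibre over \<open>y\<close> of
  the orbit map, and the fibres partition the group.\<close>

lemma orbit_fixed_count:
  assumes x: "x \<in> E"
  shows "(\<Sum>y\<in>(\<lambda>g. act g x) ` carrier Q. card {s \<in> carrier Q. act s y = y}) = card (carrier Q)"
proof -
  let ?O = "(\<lambda>g. act g x) ` carrier Q"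
  have "card {s \<in> carrier Q. act s y = y} = card {g \<in> carrier Q. act g x = y}" if "y \<in> ?O" for y
  proof -
    from that obtain h where h: "h \<in> carrier Q" "y = act h x" by auto
    have "bij_betw (\<lambda>s. s \<otimes> h) {s \<in> carrier Q. act s y = y} {g \<in> carrier Q. act g x = y}"
      using h x
      by (intro bij_betw_byWitness[where f' = "\<lambda>g. g \<otimes> inv h"])
        (auto simp: m_assoc act_mult act_inv_act act_closed act_act_inv)
    then show ?thesis by (rule bij_betw_same_card)
  qed
  then have "(\<Sum>y\<in>?O. card {s \<in> carrier Q. act s y = y}) = (\<Sum>y\<in>?O. card {g \<in> carrier Q. act g x = y})"
    by simp
  also have "\<dots> = card (carrier Q)"
    using sum.image_gen[OF finite_carrier, of "\<lambda>_. 1 :: nat" "\<lambda>g. act g x"] by simp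
  finally show ?thesis .
qed

text \<open>Each orbit contributes the group order times the weight of one representative, and
  \<open>T\<close> is the set of representatives. Exhibiting \<open>T\<close> keeps the quotient an
  explicit sum of weights, so that its integrality can be checked.\<close>

lemma weighted_burnside:
  fixes w :: "'e \<Rightarrow> 'r::comm_semiring_1"
  assumes w: "\<And>s x. s \<in> carrier Q \<Longrightarrow> x \<in> E \<Longrightarrow> w (act s x) = w x"
  shows "\<exists>T\<subseteq>E. (\<Sum>s\<in>carrier Q. \<Sum>x\<in>{x \<in> E. act s x = x}. w x)
    = of_nat (card (carrier Q)) * (\<Sum>x\<in>T. w x)"
proof -
  \<comment> \<open>Generalised to invariant subsets, so that removing one orbit leaves a smaller
    instance.\<close>
  have "\<exists>T\<subseteq>A. (\<Sum>s\<in>carrier Q. \<Sum>x\<in>{x \<in> A. act s x = x}. w x)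
      = of_nat (card (carrier Q)) * (\<Sum>x\<in>T. w x)"
    if "A \<subseteq> E" "\<And>s x. s \<in> carrier Q \<Longrightarrow> x \<in> A \<Longrightarrow> act s x \<in> A" for A
    using that
  proof (induction "card A" arbitrary: A rule: less_induct)
    case less
    have finA: "finite A" using less.prems finite_space finite_subset by blast
    show ?case
    proof (cases "A = {}")
      case True
      then show ?thesis by (intro exI[of _ "{}"]) auto
    next
      case False
      then obtain x where x: "x \<in> A" "x \<in> E" using less.prems by auto
      define O' where "O' = (\<lambda>g. act g x) ` carrier Q"
      have "x \<in> O'"
        unfolding O'_def using act_one[OF x(2)] one_closed by (metis image_eqI)
      have "O' \<subseteq> A" using less.prems x by (auto simp: O'_def)
      have finO: "finite O'" using \<open>O' \<subseteq> A\<close> finA finite_subset by blast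
      have inv: "act s y \<in> A - O'" if s: "s \<in> carrier Q" and y: "y \<in> A - O'" for s y
      proof -
        have "act s y \<notin> O'"
        proof
          assume "act s y \<in> O'"
          then obtain g where g: "g \<in> carrier Q" "act s y = act g x" by (auto simp: O'_def)
          then have "y = act (inv s \<otimes> g) x"
            using s y x less.prems act_inv_act[of s y] act_mult[of "inv s" g x] by auto
          then show False using s y g by (auto simp: O'_def)
        qed
        then show ?thesis using less.prems s y by auto
      qed
      have "card (A - O') < card A"
        using finA x(1) \<open>x \<in> O'\<close> by (intro psubset_card_mono) auto
      then obtain T where T: "T \<subseteq> A - O'"
        "(\<Sum>s\<in>carrier Q. \<Sum>x\<in>{x \<in> A - O'. act s x = x}. w x) = of_nat (card (carrier Q)) * (\<Sum>x\<in>T. w x)"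
        using less.hyps[of "A - O'"] less.prems inv by auto
      have "(\<Sum>s\<in>carrier Q. \<Sum>y\<in>{y \<in> O'. act s y = y}. w y) = (\<Sum>y\<in>O'. \<Sum>s\<in>{s \<in> carrier Q. act s y = y}. w y)"
        by (rule sum.swap_restrict[OF finite_carrier finO])
      also have "\<dots> = (\<Sum>y\<in>O'. of_nat (card {s \<in> carrier Q. act s y = y}) * w x)"
        using x by (intro sum.cong) (auto simp: O'_def w)
      also have "\<dots> = of_nat (card (carrier Q)) * w x"
        unfolding sum_distrib_right[symmetric] of_nat_sum[symmetric]
        using orbit_fixed_count[OF x(2)] by (simp add: O'_def)
      finally have orb: "(\<Sum>s\<in>carrier Q. \<Sum>y\<in>{y \<in> O'. act s y = y}. w y) = of_nat (card (carrier Q)) * w x" .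
      have split: "(\<Sum>x\<in>{x \<in> A. act s x = x}. w x)
          = (\<Sum>x\<in>{x \<in> O'. act s x = x}. w x) + (\<Sum>x\<in>{x \<in> A - O'. act s x = x}. w x)" for s
        using finA \<open>O' \<subseteq> A\<close> finO by (subst sum.union_disjoint[symmetric]) (auto intro!: sum.cong)
      have "x \<notin> T" "finite T" using T \<open>x \<in> O'\<close> finA finite_subset by auto
      then show ?thesis
        using T x by (intro exI[of _ "insert x T"]) (auto simp: split sum.distrib orb distrib_left)
    qed
  qed
  then show ?thesis using act_closed by blast
qed

text \<open>An \<open>H\<close>-invariant colouring is a colouring of the \<open>H\<close>-orbits.
  By freeness each orbit has \<open>card H\<close> points, so a colour \<open>j\<close> on it weighs
  \<open>m j ^ card H\<close>, and there are \<open>card P div card H\<close> orbits to colour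
  independently.\<close>

lemma invariant_colourings:
  fixes m :: "'j \<Rightarrow> 'r::comm_semiring_1"
  assumes free: "\<And>s x. s \<in> carrier Q \<Longrightarrow> x \<in> E \<Longrightarrow> act s x = x \<Longrightarrow> s = \<one>"
    and H: "subgroup H Q" and P: "P \<subseteq> E" and inv: "\<And>s x. s \<in> H \<Longrightarrow> x \<in> P \<Longrightarrow> act s x \<in> P"
    and J: "finite J"
  shows "(\<Sum>f\<in>{f \<in> P \<rightarrow>\<^sub>E J. \<forall>s\<in>H. \<forall>x\<in>P. f (act s x) = f x}. \<Prod>x\<in>P. m (f x))
      = (\<Sum>j\<in>J. m j ^ card H) ^ (card P div card H)" (is ?sum)
    and "card H dvd card P" (is ?dvd)
proof -
  interpret H: subgroup H Q by (rule H)
  define orb where "orb x = (\<lambda>s. act s x) ` H" for x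
  have finP: "finite P" using P finite_space finite_subset by blast
  have finH: "finite H" using H.subset finite_carrier finite_subset by blast
  have "card H > 0" using finH H.one_closed by (metis card_gt_0_iff empty_iff)
  have self: "x \<in> orb x" if "x \<in> P" for x
    unfolding orb_def using act_one[of x] H.one_closed that P by (metis image_eqI subsetD)
  have orb_sub: "orb x \<subseteq> P" if "x \<in> P" for x
    using that inv by (auto simp: orb_def)
  have orb_eq: "orb y = orb x" if "x \<in> P" "y \<in> orb x" for x y
  proof -
    from that obtain t where t: "t \<in> H" "y = act t x" by (auto simp: orb_def)
    have "x \<in> E" using that P by auto
    have "act s y = act (s \<otimes> t) x" "act s x = act (s \<otimes> inv t) y" if "s \<in> H" for s
      using that t \<open>x \<in> E\<close> H.subset
      by (auto simp: act_mult act_inv_act subset_iff act_closed)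
    then have "act s y \<in> orb x" "act s x \<in> orb y" if "s \<in> H" for s
      using that t(1) unfolding orb_def by (metis H.m_closed H.m_inv_closed image_eqI)+
    then show ?thesis by (auto simp: orb_def)
  qed
  have card_orb: "card (orb x) = card H" if "x \<in> P" for x
    unfolding orb_def
  proof (rule card_image, rule inj_onI)
    fix s t assume st: "s \<in> H" "t \<in> H" "act s x = act t x"
    have "x \<in> E" using that P by auto
    have "act (inv t \<otimes> s) x = x"
      using st \<open>x \<in> E\<close> H.subset by (auto simp: act_mult act_inv_act subset_iff)
    then have "inv t \<otimes> s = \<one>" using free[of "inv t \<otimes> s" x] st \<open>x \<in> E\<close> H.subset by auto
    then show "s = t" using st H.subset
      by (metis H.mem_carrier inv_closed inv_equality inv_inv)
  qed
  define \<O> where "\<O> = orb ` P"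
  have fib: "{x \<in> P. orb x = orb y} = orb y" if "y \<in> P" for y
    using that orb_eq orb_sub self by blast
  have "card P = (\<Sum>p\<in>\<O>. card {x \<in> P. orb x = p})"
    using sum.image_gen[OF finP, of "\<lambda>_. 1 :: nat" orb] by (simp add: \<O>_def)
  also have "\<dots> = card \<O> * card H"
  proof -
    have "card {x \<in> P. orb x = p} = card H" if "p \<in> \<O>" for p
      using that fib card_orb by (auto simp: \<O>_def)
    then show ?thesis by simp
  qed
  finally have cardP: "card P = card \<O> * card H" .
  then show ?dvd by simp
  have fin\<O>: "finite \<O>" by (simp add: \<O>_def finP)
  \<comment> \<open>\<open>pick\<close> selects a point of each orbit; an invariant colouring is
    determined by its values at these points.\<close>
  define pick where "pick p = (SOME x. x \<in> P \<and> orb x = p)" for p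
  have pick: "pick p \<in> P" "orb (pick p) = p" if "p \<in> \<O>" for p
    using someI_ex[of "\<lambda>x. x \<in> P \<and> orb x = p"] that by (auto simp: pick_def \<O>_def)
  have const: "f x = f y"
    if "\<forall>s\<in>H. \<forall>x\<in>P. f (act s x) = f x" "x \<in> P" "y \<in> P" "orb x = orb y" for f :: "'e \<Rightarrow> 'j" and x y
  proof -
    have "x \<in> orb y" using self[OF that(2)] that by simp
    then show ?thesis using that by (auto simp: orb_def)
  qed
  have orb_act: "orb (act s x) = orb x" if "s \<in> H" "x \<in> P" for s x
    using that by (intro orb_eq) (auto simp: orb_def)
  have "(\<Sum>f\<in>{f \<in> P \<rightarrow>\<^sub>E J. \<forall>s\<in>H. \<forall>x\<in>P. f (act s x) = f x}. \<Prod>x\<in>P. m (f x))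
      = (\<Sum>g\<in>\<O> \<rightarrow>\<^sub>E J. \<Prod>p\<in>\<O>. m (g p) ^ card H)"
  proof (rule sum.reindex_bij_witness[where i = "\<lambda>g. \<lambda>x\<in>P. g (orb x)" and j = "\<lambda>f. \<lambda>p\<in>\<O>. f (pick p)"])
    fix f assume f: "f \<in> {f \<in> P \<rightarrow>\<^sub>E J. \<forall>s\<in>H. \<forall>x\<in>P. f (act s x) = f x}"
    have f_pick: "f (pick (orb x)) = f x" if "x \<in> P" for x
      using that f pick[of "orb x"] by (intro const) (auto simp: \<O>_def)
    show "(\<lambda>x\<in>P. (\<lambda>p\<in>\<O>. f (pick p)) (orb x)) = f"
    proof
      show "(\<lambda>x\<in>P. (\<lambda>p\<in>\<O>. f (pick p)) (orb x)) x = f x" for x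
        using f PiE_arb[of f P "\<lambda>_. J" x] by (cases "x \<in> P") (auto simp: f_pick \<O>_def)
    qed
    show "(\<lambda>p\<in>\<O>. f (pick p)) \<in> \<O> \<rightarrow>\<^sub>E J"
      using f pick by auto
    have "(\<Prod>x\<in>P. m (f x)) = (\<Prod>p\<in>\<O>. \<Prod>x\<in>{x \<in> P. orb x = p}. m (f x))"
      unfolding \<O>_def by (rule prod.image_gen[OF finP])
    also have "\<dots> = (\<Prod>p\<in>\<O>. m ((\<lambda>p\<in>\<O>. f (pick p)) p) ^ card H)"
    proof (rule prod.cong[OF refl])
      fix p assume p: "p \<in> \<O>"
      have "(\<Prod>x\<in>{x \<in> P. orb x = p}. m (f x)) = (\<Prod>x\<in>{x \<in> P. orb x = p}. m (f (pick p)))"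
        using f_pick by (intro prod.cong) auto
      also have "\<dots> = m (f (pick p)) ^ card H"
        using fib[of "pick p"] pick[OF p] card_orb[of "pick p"] by simp
      finally show "(\<Prod>x\<in>{x \<in> P. orb x = p}. m (f x)) = m ((\<lambda>p\<in>\<O>. f (pick p)) p) ^ card H"
        using p by simp
    qed
    finally show "(\<Prod>p\<in>\<O>. m ((\<lambda>p\<in>\<O>. f (pick p)) p) ^ card H) = (\<Prod>x\<in>P. m (f x))" ..
  next
    fix g assume g: "g \<in> \<O> \<rightarrow>\<^sub>E J"
    show "(\<lambda>p\<in>\<O>. (\<lambda>x\<in>P. g (orb x)) (pick p)) = g"
    proof
      show "(\<lambda>p\<in>\<O>. (\<lambda>x\<in>P. g (orb x)) (pick p)) p = g p" for p
        using PiE_arb[OF g, of p] by (cases "p \<in> \<O>") (auto simp: pick)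
    qed
    show "(\<lambda>x\<in>P. g (orb x)) \<in> {f \<in> P \<rightarrow>\<^sub>E J. \<forall>s\<in>H. \<forall>x\<in>P. f (act s x) = f x}"
      using g inv orb_act by (auto simp: \<O>_def)
  qed
  also have "\<dots> = (\<Prod>p\<in>\<O>. \<Sum>j\<in>J. m j ^ card H)"
    using prod_sum_PiE[OF fin\<O>, of "\<lambda>_. J" "\<lambda>_ j. m j ^ card H"] J by simp
  also have "\<dots> = (\<Sum>j\<in>J. m j ^ card H) ^ (card P div card H)"
    using cardP \<open>card H > 0\<close> by simp
  finally show ?sum .
qed

end

section \<open>Product actions, and free actions with an equivariant family of blocks\<close>

lemma finite_action_Times:
  assumes "finite_action Q E act" "finite_action Q F act'"
  shows "finite_action Q (E \<times> F) (\<lambda>s (x, y). (act s x, act' s y))"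
proof -
  interpret E: finite_action Q E act by fact
  interpret F: finite_action Q F act' by fact
  show ?thesis
    by unfold_locales
      (auto simp: E.finite_carrier E.finite_space F.finite_space E.act_closed F.act_closed
        E.act_one F.act_one E.act_mult F.act_mult)
qed

text \<open>Abstracts the situation at an open subgroup \<open>U\<close>: \<open>Q\<close> is its
  Weyl group, \<open>Z\<close> the right cosets of \<open>U\<close>, \<open>L\<close> the
  \<open>U\<close>-fixed left cosets of \<open>V\<close>, and \<open>B K\<close> the right cosets of
  \<open>U\<close> inside \<open>K\<close>, which are (V:U) in number.\<close>

locale block_action = finite_action Q Z act + L: finite_action Q L actL
  for Q :: "('q, 'm) monoid_scheme" (structure) and Z :: "'z set" and act and L :: "'x set" and actL +
  fixes B :: "'x \<Rightarrow> 'z set" and e :: nat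
  assumes free: "\<And>s z. s \<in> carrier Q \<Longrightarrow> z \<in> Z \<Longrightarrow> act s z = z \<Longrightarrow> s = \<one>"
    and block_subset: "K \<in> L \<Longrightarrow> B K \<subseteq> Z"
    and card_block: "K \<in> L \<Longrightarrow> card (B K) = e"
    and block_act: "s \<in> carrier Q \<Longrightarrow> K \<in> L \<Longrightarrow> B (actL s K) = act s ` B K"
begin

lemma finite_block: "K \<in> L \<Longrightarrow> finite (B K)"
  using block_subset finite_space finite_subset by blast

text \<open>\<open>Q\<close> acts freely on the pairs of a block and a point of it, and there are
  \<open>e * card L\<close> of them. This is the divisibility used at the primes dividing
  \<open>q\<close>.\<close>

lemma card_dvd_block_points: "card (carrier Q) dvd e * card L"
proof -
  define E where "E = Sigma L B"
  define actE where "actE s = (\<lambda>(K, z). (actL s K, act s z))" for s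
  interpret E: finite_action Q E actE
    by unfold_locales
      (use block_subset in \<open>auto simp: E_def actE_def finite_carrier L.finite_space finite_block
        L.act_closed block_act L.act_one L.act_mult act_one act_mult subset_iff\<close>)
  obtain T where T: "T \<subseteq> E" "(\<Sum>s\<in>carrier Q. \<Sum>x\<in>{x \<in> E. actE s x = x}. 1) = of_nat (card (carrier Q)) * (\<Sum>x\<in>T. 1 :: nat)"
    using E.weighted_burnside[of "\<lambda>_. 1 :: nat"] by auto
  have "(\<Sum>s\<in>carrier Q. \<Sum>x\<in>{x \<in> E. actE s x = x}. 1 :: nat) = (\<Sum>s\<in>carrier Q. if s = \<one> then card E else 0)"
  proof (rule sum.cong[OF refl])
    fix s assume s: "s \<in> carrier Q"
    have "{x \<in> E. actE s x = x} = (if s = \<one> then E else {})"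
      using free[OF s] block_subset E.act_one by (auto simp: E_def actE_def)
    then show "(\<Sum>x\<in>{x \<in> E. actE s x = x}. 1 :: nat) = (if s = \<one> then card E else 0)"
      by simp
  qed
  also have "\<dots> = card E" by (simp add: finite_carrier)
  also have "\<dots> = e * card L"
    by (simp add: E_def L.finite_space finite_block card_block)
  finally show ?thesis using T by auto
qed

text \<open>A colouring is transported by precomposition with the inverse. The restriction keeps it
  extensional on the moved block, so that equality of pairs is equality on the block.\<close>

definition act_colouring :: "'q \<Rightarrow> 'x \<times> ('z \<Rightarrow> 'j) \<Rightarrow> 'x \<times> ('z \<Rightarrow> 'j)"
  where "act_colouring s = (\<lambda>(K, f). (actL s K, \<lambda>z\<in>B (actL s K). f (act (inv s) z)))"

lemma inv_act_block: "s \<in> carrier Q \<Longrightarrow> K \<in> L \<Longrightarrow> z \<in> B (actL s K) \<Longrightarrow> act (inv s) z \<in> B K"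
  using block_subset[of K] by (auto simp: block_act act_inv_act subset_iff)

lemma finite_action_colourings:
  assumes "finite J"
  shows "finite_action Q (SIGMA K:L. B K \<rightarrow>\<^sub>E J) act_colouring"
proof (unfold_locales, goal_cases)
  case 1
  then show ?case by (rule finite_carrier)
next
  case 2
  then show ?case
    using assms by (intro finite_SigmaI L.finite_space finite_PiE finite_block) auto
next
  case (3 s x)
  then show ?case by (auto simp: act_colouring_def L.act_closed dest: inv_act_block)
next
  case (4 x)
  then obtain K f where x: "x = (K, f)" "K \<in> L" "f \<in> B K \<rightarrow>\<^sub>E J" by (rule SigmaE)
  have "(\<lambda>z\<in>B K. f (act \<one> z)) = f"
  proof
    fix z
    show "(\<lambda>z\<in>B K. f (act \<one> z)) z = f z"
    proof (cases "z \<in> B K")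
      case True
      with block_subset[OF x(2)] have "z \<in> Z" by blast
      then show ?thesis using True by (simp add: act_one)
    next
      case False
      then show ?thesis using PiE_arb[OF x(3)] by simp
    qed
  qed
  then show ?case using x by (simp add: act_colouring_def L.act_one)
next
  case (5 s t x)
  obtain K f where x: "x = (K, f)" "K \<in> L" "f \<in> B K \<rightarrow>\<^sub>E J" using 5(3) by (rule SigmaE)
  have "f (act (inv (s \<otimes> t)) z) = (\<lambda>z\<in>B (actL t K). f (act (inv t) z)) (act (inv s) z)"
    if z: "z \<in> B (actL s (actL t K))" for z
  proof -
    have K: "actL t K \<in> L" "actL s (actL t K) \<in> L" using 5 x by (auto simp: L.act_closed)
    have "z \<in> Z" using z block_subset[OF K(2)] by blast
    then have "act (inv (s \<otimes> t)) z = act (inv t) (act (inv s) z)"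
      using 5 by (simp add: inv_mult_group act_mult)
    then show ?thesis
      using inv_act_block[OF 5(1) K(1) z] by simp
  qed
  then have "(\<lambda>z\<in>B (actL s (actL t K)). f (act (inv (s \<otimes> t)) z))
      = (\<lambda>z\<in>B (actL s (actL t K)). (\<lambda>z\<in>B (actL t K). f (act (inv t) z)) (act (inv s) z))"
    by (intro restrict_ext)
  then show ?case
    using 5 x(1,2) by (simp add: act_colouring_def L.act_mult)
qed

text \<open>\<open>act s\<close> is a bijection between the two blocks and matches the factors, so
  the weight is constant on orbits.\<close>

lemma weight_act_colouring:
  fixes m :: "'j \<Rightarrow> 'r::comm_semiring_1"
  assumes "s \<in> carrier Q" "K \<in> L"
  shows "(\<Prod>z\<in>B (actL s K). m (f (act (inv s) z))) = (\<Prod>z\<in>B K. m (f z))"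
proof -
  have "inj_on (act s) (B K)"
    using act_inj[of s] block_subset[of K] assms inj_on_subset by blast
  then show ?thesis
    using assms block_subset[of K]
    by (auto simp: block_act prod.reindex act_inv_act subset_iff intro!: prod.cong)
qed

lemma generate_act_fixed:
  assumes "t \<in> generate Q {s}" "s \<in> carrier Q" "K \<in> L" "actL s K = K"
  shows "t \<in> carrier Q \<and> actL t K = K"
  using assms
proof (induction t)
  case one
  then show ?case by (simp add: L.act_one)
next
  case (incl h)
  then show ?case by simp
next
  case (inv h)
  then show ?case using L.act_inv_act[of s K] by auto
next
  case (eng h1 h2)
  then show ?case by (auto simp: L.act_mult)
qed

text \<open>The condition for \<open>s\<close> spreads to the cyclic subgroup generated by
  \<open>s\<close>, the form in which \<open>invariant_colourings\<close> applies.\<close>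

lemma act_colouring_fixed_iff:
  assumes s: "s \<in> carrier Q" and K: "K \<in> L" and f: "f \<in> B K \<rightarrow>\<^sub>E J"
  shows "act_colouring s (K, f) = (K, f) \<longleftrightarrow>
    actL s K = K \<and> (\<forall>t\<in>generate Q {s}. \<forall>z\<in>B K. f (act t z) = f z)"
proof
  assume "act_colouring s (K, f) = (K, f)"
  then have sK: "actL s K = K" and fs: "(\<lambda>z\<in>B K. f (act (inv s) z)) = f"
    by (auto simp: act_colouring_def)
  have "f (act t z) = f z" if "t \<in> generate Q {s}" "z \<in> B K" for t z
    using that
  proof (induction t arbitrary: z)
    case one
    then show ?case using block_subset[OF K] by (simp add: act_one subset_iff)
  next
    case (incl h)
    then have "act s z \<in> B K" "act (inv s) (act s z) = z"
      using block_act[OF s K] sK K s block_subset by (auto intro: act_inv_act)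
    then show ?case using incl fun_cong[OF fs, of "act s z"] by auto
  next
    case (inv h)
    then show ?case using fun_cong[OF fs, of z] by auto
  next
    case (eng h1 h2)
    then have "h1 \<in> carrier Q" "h2 \<in> carrier Q" "actL h2 K = K"
      using generate_act_fixed[OF _ s K sK] by auto
    moreover from this have "act h2 z \<in> B K" using eng block_act[of h2 K] K by auto
    moreover have "z \<in> Z" using eng K block_subset by auto
    ultimately show ?case using eng by (simp add: act_mult)
  qed
  with sK show "actL s K = K \<and> (\<forall>t\<in>generate Q {s}. \<forall>z\<in>B K. f (act t z) = f z)" by simp
next
  assume "actL s K = K \<and> (\<forall>t\<in>generate Q {s}. \<forall>z\<in>B K. f (act t z) = f z)"
  moreover have "inv s \<in> generate Q {s}" by (rule generate.inv) simp
  ultimately show "act_colouring s (K, f) = (K, f)"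
  proof -
    assume *: "actL s K = K \<and> (\<forall>t\<in>generate Q {s}. \<forall>z\<in>B K. f (act t z) = f z)"
      and inv: "inv s \<in> generate Q {s}"
    have "(\<lambda>z\<in>B K. f (act (inv s) z)) z = f z" for z
      using * inv PiE_arb[OF f, of z] by (cases "z \<in> B K") auto
    with * show ?thesis by (auto simp: act_colouring_def)
  qed
qed

text \<open>The cyclic subgroup generated by \<open>s\<close> preserves the block and acts freely on
  its \<open>e\<close> points.\<close>

lemma fixed_block_dvd:
  assumes s: "s \<in> carrier Q" and K: "K \<in> L" "actL s K = K"
  shows "card (generate Q {s}) dvd e"
proof -
  have "card (generate Q {s}) dvd card (B K)"
  proof (rule invariant_colourings(2)[where J = "{}"])
    show "subgroup (generate Q {s}) Q" using s by (intro generate_is_subgroup) auto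
    show "B K \<subseteq> Z" by (rule block_subset[OF K(1)])
    show "act t z \<in> B K" if "t \<in> generate Q {s}" "z \<in> B K" for t z
      using generate_act_fixed[OF that(1) s K] that(2) block_act[of t K] K by auto
  qed (auto intro: free)
  then show ?thesis using card_block[OF K(1)] by simp
qed

text \<open>Fixed pairs are grouped by their block; every fixed block contributes the same sum,
  computed by \<open>invariant_colourings\<close>.\<close>

lemma fixed_colourings_sum:
  fixes m :: "'j \<Rightarrow> 'r::comm_semiring_1"
  assumes s: "s \<in> carrier Q" and J: "finite J"
  shows "(\<Sum>p\<in>{p \<in> SIGMA K:L. B K \<rightarrow>\<^sub>E J. act_colouring s p = p}. case p of (K, f) \<Rightarrow> \<Prod>z\<in>B K. m (f z))
    = of_nat (card {K \<in> L. actL s K = K})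
      * (\<Sum>j\<in>J. m j ^ card (generate Q {s})) ^ (e div card (generate Q {s}))"
proof -
  let ?F = "\<lambda>K. {f \<in> B K \<rightarrow>\<^sub>E J. \<forall>t\<in>generate Q {s}. \<forall>z\<in>B K. f (act t z) = f z}"
  let ?c = "(\<Sum>j\<in>J. m j ^ card (generate Q {s})) ^ (e div card (generate Q {s}))"
  have eq: "{p \<in> SIGMA K:L. B K \<rightarrow>\<^sub>E J. act_colouring s p = p} = Sigma {K \<in> L. actL s K = K} ?F"
    using act_colouring_fixed_iff[OF s] by auto
  have fin: "finite (?F K)" if "K \<in> L" for K
    using J finite_block[OF that] by (intro finite_subset[OF _ finite_PiE[of "B K" "\<lambda>_. J"]]) auto
  have "(\<Sum>p\<in>Sigma {K \<in> L. actL s K = K} ?F. case p of (K, f) \<Rightarrow> \<Prod>z\<in>B K. m (f z))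
      = (\<Sum>K\<in>{K \<in> L. actL s K = K}. \<Sum>f\<in>?F K. \<Prod>z\<in>B K. m (f z))"
    using L.finite_space fin by (intro sum.Sigma[symmetric]) auto
  also have "\<dots> = (\<Sum>K\<in>{K \<in> L. actL s K = K}. ?c)"
  proof (rule sum.cong[OF refl])
    fix K assume "K \<in> {K \<in> L. actL s K = K}"
    then have K: "K \<in> L" "actL s K = K" by auto
    have "(\<Sum>f\<in>?F K. \<Prod>z\<in>B K. m (f z))
        = (\<Sum>j\<in>J. m j ^ card (generate Q {s})) ^ (card (B K) div card (generate Q {s}))"
    proof (rule invariant_colourings(1))
      show "subgroup (generate Q {s}) Q" using s by (intro generate_is_subgroup) auto
      show "B K \<subseteq> Z" by (rule block_subset[OF K(1)])
      show "act t z \<in> B K" if "t \<in> generate Q {s}" "z \<in> B K" for t z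
        using generate_act_fixed[OF that(1) s K] that(2) block_act[of t K] K by auto
    qed (auto intro: free J)
    then show "(\<Sum>f\<in>?F K. \<Prod>z\<in>B K. m (f z)) = ?c" using card_block[OF K(1)] by simp
  qed
  finally show ?thesis by (simp add: eq)
qed

end

text \<open>The total weight of the \<open>s\<close>-fixed colourings of the \<open>s\<close>-fixed blocks, each of the \<open>e\<close> points of
  a block receiving a colour \<open>j\<close> of weight \<open>m j\<close>.\<close>

definition colour_char ::
  "('q, 'm) monoid_scheme \<Rightarrow> 'x set \<Rightarrow> ('q \<Rightarrow> 'x \<Rightarrow> 'x) \<Rightarrow> nat \<Rightarrow> ('j \<Rightarrow> 'r::comm_semiring_1) \<Rightarrow> 'j set \<Rightarrow> 'q \<Rightarrow> 'r"
  where "colour_char Q L actL e m J s = of_nat (card {K \<in> L. actL s K = K})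
      * (\<Sum>j\<in>J. m j ^ card (generate Q {s})) ^ (e div card (generate Q {s}))"

text \<open>Burnside's lemma on the coloured blocks: the quotient by the group order is a sum of
  weights, each a product of integral elements.\<close>

lemma colour_char_sum:
  fixes m :: "'j \<Rightarrow> 'r::comm_ring_1"
  assumes "block_action Q Z act L actL B e" and J: "finite J"
    and m: "\<And>j. j \<in> J \<Longrightarrow> m j \<in> int_poly_exprs S"
  shows "cong_in S (card (carrier Q)) (\<Sum>s\<in>carrier Q. colour_char Q L actL e m J s) 0"
proof -
  interpret block_action Q Z act L actL B e by fact
  let ?E = "SIGMA K:L. B K \<rightarrow>\<^sub>E J" and ?w = "\<lambda>(K, f). \<Prod>z\<in>B K. m (f z)"
  interpret E: finite_action Q ?E act_colouring
    by (rule finite_action_colourings[OF J])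
  have "\<exists>T\<subseteq>?E. (\<Sum>s\<in>carrier Q. \<Sum>x\<in>{x \<in> ?E. act_colouring s x = x}. ?w x)
      = of_nat (card (carrier Q)) * (\<Sum>x\<in>T. ?w x)"
  proof (rule E.weighted_burnside)
    fix s x assume "s \<in> carrier Q" "x \<in> ?E"
    then show "?w (act_colouring s x) = ?w x"
      using weight_act_colouring[of s "fst x" m "snd x"] by (auto simp: act_colouring_def)
  qed
  then obtain T where T: "T \<subseteq> ?E" "(\<Sum>s\<in>carrier Q. colour_char Q L actL e m J s)
      = of_nat (card (carrier Q)) * (\<Sum>x\<in>T. ?w x)"
    using J by (auto simp: fixed_colourings_sum colour_char_def)
  have "(\<Sum>x\<in>T. ?w x) \<in> int_poly_exprs S"
    using T(1) m by (intro int_poly_exprs_sum) (auto intro!: int_poly_exprs_prod)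
  with T(2) show ?thesis by (auto simp: cong_in_def)
qed

text \<open>A product of two such characters is the character of the product action, to which
  Burnside's lemma applies again.\<close>

lemma colour_char_mult_sum:
  fixes m :: "'j \<Rightarrow> 'r::comm_ring_1" and m' :: "'k \<Rightarrow> 'r"
  assumes "block_action Q Z act L actL B e" "block_action Q Z' act' L' actL' B' e'"
    and J: "finite J" "finite J'"
    and m: "\<And>j. j \<in> J \<Longrightarrow> m j \<in> int_poly_exprs S" "\<And>j. j \<in> J' \<Longrightarrow> m' j \<in> int_poly_exprs S"
  shows "cong_in S (card (carrier Q))
    (\<Sum>s\<in>carrier Q. colour_char Q L actL e m J s * colour_char Q L' actL' e' m' J' s) 0"
proof -
  interpret I: block_action Q Z act L actL B e by fact
  interpret I': block_action Q Z' act' L' actL' B' e' by fact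
  let ?E = "SIGMA K:L. B K \<rightarrow>\<^sub>E J" and ?w = "\<lambda>(K, f). \<Prod>z\<in>B K. m (f z)"
  let ?E' = "SIGMA K:L'. B' K \<rightarrow>\<^sub>E J'" and ?w' = "\<lambda>(K, f). \<Prod>z\<in>B' K. m' (f z)"
  let ?a = "\<lambda>s (x, y). (I.act_colouring s x, I'.act_colouring s y)"
  interpret E: finite_action Q "?E \<times> ?E'" ?a
    by (intro finite_action_Times I.finite_action_colourings I'.finite_action_colourings J)
  have "\<exists>T\<subseteq>?E \<times> ?E'. (\<Sum>s\<in>carrier Q. \<Sum>x\<in>{x \<in> ?E \<times> ?E'. ?a s x = x}. ?w (fst x) * ?w' (snd x))
      = of_nat (card (carrier Q)) * (\<Sum>x\<in>T. ?w (fst x) * ?w' (snd x))"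
  proof (rule E.weighted_burnside)
    fix s x assume s: "s \<in> carrier Q" and x: "x \<in> ?E \<times> ?E'"
    have "?w (I.act_colouring s (fst x)) = ?w (fst x)"
      using s x I.weight_act_colouring[of s "fst (fst x)" m "snd (fst x)"] by (auto simp: I.act_colouring_def)
    moreover have "?w' (I'.act_colouring s (snd x)) = ?w' (snd x)"
      using s x I'.weight_act_colouring[of s "fst (snd x)" m' "snd (snd x)"] by (auto simp: I'.act_colouring_def)
    ultimately show "?w (fst (?a s x)) * ?w' (snd (?a s x)) = ?w (fst x) * ?w' (snd x)"
      by (simp add: case_prod_beta)
  qed
  then obtain T where T: "T \<subseteq> ?E \<times> ?E'"
    "(\<Sum>s\<in>carrier Q. \<Sum>x\<in>{x \<in> ?E \<times> ?E'. ?a s x = x}. ?w (fst x) * ?w' (snd x))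
      = of_nat (card (carrier Q)) * (\<Sum>x\<in>T. ?w (fst x) * ?w' (snd x))"
    by blast
  have "(\<Sum>x\<in>{x \<in> ?E \<times> ?E'. ?a s x = x}. ?w (fst x) * ?w' (snd x))
      = colour_char Q L actL e m J s * colour_char Q L' actL' e' m' J' s" if s: "s \<in> carrier Q" for s
  proof -
    \<comment> \<open>A pair is fixed exactly when both components are, so the two weighted sums
      multiply.\<close>
    have "{x \<in> ?E \<times> ?E'. ?a s x = x}
        = {x \<in> ?E. I.act_colouring s x = x} \<times> {x \<in> ?E'. I'.act_colouring s x = x}"
      by auto
    then show ?thesis
      using s J unfolding colour_char_def
      by (simp only: I.fixed_colourings_sum[symmetric] I'.fixed_colourings_sum[symmetric]
          sum_product sum.cartesian_product) (auto intro!: sum.cong)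
  qed
  moreover have "(\<Sum>x\<in>T. ?w (fst x) * ?w' (snd x)) \<in> int_poly_exprs S"
  proof (rule int_poly_exprs_sum)
    fix x assume "x \<in> T"
    with T(1) have "x \<in> ?E \<times> ?E'" by blast
    then show "?w (fst x) * ?w' (snd x) \<in> int_poly_exprs S"
      by (auto intro!: int_poly_exprs_prod int_poly_exprs_mult m dest: PiE_mem)
  qed
  ultimately show ?thesis using T(2) by (auto simp: cong_in_def)
qed

section \<open>Indices, and fixed points on coset spaces\<close>

section \<open>Cosets and conjugates\<close>

context group
begin

lemma mem_rcoset_iff:
  "subgroup U G \<Longrightarrow> x \<in> carrier G \<Longrightarrow> y \<in> U #> x \<longleftrightarrow> y \<in> carrier G \<and> y \<otimes> inv x \<in> U"
  using subgroup.rcos_module[of U G x y] subgroup.elemrcos_carrier[of U G x y] is_group by blast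

lemma mem_lcoset_iff:
  "subgroup U G \<Longrightarrow> x \<in> carrier G \<Longrightarrow> y \<in> x <# U \<longleftrightarrow> y \<in> carrier G \<and> inv x \<otimes> y \<in> U"
  using subgroup.lcos_module_rev[of U G x y] subgroup.lcos_module_imp[of U G x y]
    subgroup.elemlcos_carrier[of U G x y] is_group by blast

lemma inv_cancel_left:
  assumes "g \<in> carrier G" "u \<in> carrier G"
  shows "inv g \<otimes> (g \<otimes> u) = u" "g \<otimes> (inv g \<otimes> u) = u"
  using assms by (simp_all flip: m_assoc)

lemma conjugate_subset_carrier: "g \<in> carrier G \<Longrightarrow> U \<subseteq> carrier G \<Longrightarrow> conjugate G g U \<subseteq> carrier G"
  by (auto simp: conjugate_def l_coset_def r_coset_def)

lemma mem_conjugate_iff: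
  assumes "g \<in> carrier G" "U \<subseteq> carrier G"
  shows "y \<in> conjugate G g U \<longleftrightarrow> y \<in> carrier G \<and> inv g \<otimes> y \<otimes> g \<in> U"
proof
  assume "y \<in> conjugate G g U"
  then obtain u where "u \<in> U" "y = g \<otimes> u \<otimes> inv g"
    by (auto simp: conjugate_def l_coset_def r_coset_def)
  moreover from this assms have "u \<in> carrier G" by auto
  ultimately show "y \<in> carrier G \<and> inv g \<otimes> y \<otimes> g \<in> U"
    using assms by (simp add: m_assoc inv_cancel_left)
next
  assume y: "y \<in> carrier G \<and> inv g \<otimes> y \<otimes> g \<in> U"
  then have "y = g \<otimes> (inv g \<otimes> y \<otimes> g) \<otimes> inv g"
    using assms by (simp add: m_assoc inv_cancel_left)
  with y show "y \<in> conjugate G g U"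
    unfolding conjugate_def l_coset_def r_coset_def by blast
qed

lemma subgroup_conjugate:
  assumes "subgroup U G" "g \<in> carrier G"
  shows "subgroup (conjugate G g U) G"
proof -
  interpret U: subgroup U G by fact
  note mem = mem_conjugate_iff[OF assms(2) U.subset]
  show ?thesis
  proof
    fix x y assume xy: "x \<in> conjugate G g U" "y \<in> conjugate G g U"
    then have "(inv g \<otimes> x \<otimes> g) \<otimes> (inv g \<otimes> y \<otimes> g) \<in> U" using mem by blast
    also have "(inv g \<otimes> x \<otimes> g) \<otimes> (inv g \<otimes> y \<otimes> g) = inv g \<otimes> (x \<otimes> y) \<otimes> g"
      using xy assms(2) by (simp add: mem m_assoc inv_cancel_left)
    finally show "x \<otimes> y \<in> conjugate G g U" using xy mem by auto
  next
    fix x assume x: "x \<in> conjugate G g U"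
    then have "inv (inv g \<otimes> x \<otimes> g) \<in> U" using mem by blast
    also have "inv (inv g \<otimes> x \<otimes> g) = inv g \<otimes> inv x \<otimes> g"
      using x assms(2) by (simp add: mem m_assoc inv_mult_group)
    finally show "inv x \<in> conjugate G g U" using x mem by auto
  next
    show "conjugate G g U \<subseteq> carrier G" "\<one> \<in> conjugate G g U"
      using mem assms(2) by auto
  qed
qed

lemma conjugate_conjugate:
  assumes "g \<in> carrier G" "h \<in> carrier G" "U \<subseteq> carrier G"
  shows "conjugate G g (conjugate G h U) = conjugate G (g \<otimes> h) U"
  using assms by (auto simp: mem_conjugate_iff conjugate_subset_carrier inv_mult_group m_assoc)

lemma conjugate_one: "U \<subseteq> carrier G \<Longrightarrow> conjugate G \<one> U = U"
  by (rule Set.set_eqI) (use mem_conjugate_iff[of \<one> U] in auto)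

text \<open>Turns a left coset into a right coset of a conjugate, so that counts of right cosets
  apply to it.\<close>

lemma conjugate_eq_lcoset_rcoset:
  assumes "g \<in> carrier G" "U \<subseteq> carrier G"
  shows "conjugate G g U #> g = g <# U"
  using assms by (simp add: conjugate_def l_coset_subset_G coset_mult_assoc)

lemma rcoset_translate_bij:
  assumes "subgroup U G" "A \<subseteq> carrier G" "x \<in> carrier G"
  shows "bij_betw (\<lambda>z. z #> x) {z \<in> rcosets U. z \<subseteq> A} {z \<in> rcosets U. z \<subseteq> A #> x}"
proof -
  have tr: "z #> y \<in> rcosets U \<and> z #> y \<subseteq> A #> y" if "z \<in> rcosets U" "z \<subseteq> A" "y \<in> carrier G" for z y A
  proof
    show "z #> y \<in> rcosets U"
      using that assms(1)[THEN subgroup.subset] by (auto simp: RCOSETS_def coset_mult_assoc)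
    show "z #> y \<subseteq> A #> y" using that(2) by (auto simp: r_coset_def)
  qed
  have sub: "z \<subseteq> carrier G" if "z \<in> rcosets U" for z
    using rcosets_subset_PowG[OF assms(1)] that by auto
  show ?thesis
  proof (rule bij_betw_byWitness[where f' = "\<lambda>z. z #> inv x"])
    show "(\<lambda>z. z #> inv x) ` {z \<in> rcosets U. z \<subseteq> A #> x} \<subseteq> {z \<in> rcosets U. z \<subseteq> A}"
      using tr[of _ "A #> x" "inv x"] assms by (auto simp: coset_mult_assoc)
    show "(\<lambda>z. z #> x) ` {z \<in> rcosets U. z \<subseteq> A} \<subseteq> {z \<in> rcosets U. z \<subseteq> A #> x}"
      using tr assms(3) by blast
    show "\<forall>z\<in>{z \<in> rcosets U. z \<subseteq> A}. z #> x #> inv x = z"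
      using assms(3) sub by (simp add: coset_mult_assoc)
    show "\<forall>z\<in>{z \<in> rcosets U. z \<subseteq> A #> x}. z #> inv x #> x = z"
      using assms(3) sub by (simp add: coset_mult_assoc)
  qed
qed

lemma rcoset_subset_iff:
  assumes "subgroup H G" "subgroup K G" "H \<subseteq> K" "x \<in> carrier G" "y \<in> carrier G"
  shows "H #> x \<subseteq> K #> y \<longleftrightarrow> K #> x = K #> y"
proof
  assume "H #> x \<subseteq> K #> y"
  then have "x \<in> K #> y" using rcos_self assms by blast
  then show "K #> x = K #> y" using repr_independence assms by metis
next
  assume "K #> x = K #> y"
  moreover have "H #> x \<subseteq> K #> x" using assms(3) by (auto simp: r_coset_def)
  ultimately show "H #> x \<subseteq> K #> y" by simp
qed

text \<open>The product with \<open>K\<close> thus maps a right coset of \<open>H\<close> to the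
  right coset of \<open>K\<close> around it, with no choice of representative.\<close>

lemma set_mult_rcoset:
  assumes "subgroup H G" "subgroup K G" "H \<subseteq> K" "x \<in> carrier G"
  shows "K <#> (H #> x) = K #> x"
proof -
  have "K <#> H = K"
    using assms(1-3) by (meson set_mult_subgroup_idem subgroup_incl subgroup.subset subgroup_mult_id)
  then show ?thesis using assms by (simp add: setmult_rcos_assoc subgroup.subset)
qed

lemma rcosets_image:
  assumes "subgroup H G" "subgroup K G" "H \<subseteq> K"
  shows "(\<lambda>z. K <#> z) ` (rcosets H) = rcosets K"
proof -
  have "(\<lambda>z. K <#> z) ` (rcosets H) = (\<lambda>x. K <#> (H #> x)) ` carrier G"
    by (auto simp: RCOSETS_def)
  also have "\<dots> = (\<lambda>x. K #> x) ` carrier G"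
    using assms by (simp add: set_mult_rcoset cong: image_cong)
  also have "\<dots> = rcosets K" by (auto simp: RCOSETS_def)
  finally show ?thesis .
qed

text \<open>All fibres of \<open>z -> K <#> z\<close> are translates of the set of right cosets of
  \<open>H\<close> inside \<open>K\<close>. The factor (K:H) is kept in this form because blocks are
  such sets.\<close>

lemma card_rcosets_mult:
  assumes H: "subgroup H G" and K: "subgroup K G" and "H \<subseteq> K" and fin: "finite (rcosets H)"
  shows "card (rcosets H) = card {z \<in> rcosets H. z \<subseteq> K} * card (rcosets K)"
proof -
  have "card (rcosets H) = (\<Sum>c\<in>rcosets K. card {z \<in> rcosets H. K <#> z = c})"
    using sum.image_gen[OF fin, of "\<lambda>_. 1 :: nat" "\<lambda>z. K <#> z"] rcosets_image[OF assms(1-3)] by simp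
  also have "\<dots> = (\<Sum>c\<in>rcosets K. card {z \<in> rcosets H. z \<subseteq> K})"
  proof (rule sum.cong[OF refl])
    fix c assume "c \<in> rcosets K"
    then obtain y where y: "y \<in> carrier G" "c = K #> y" by (auto simp: RCOSETS_def)
    have "{z \<in> rcosets H. K <#> z = c} = {z \<in> rcosets H. z \<subseteq> K #> y}"
    proof (rule Collect_cong, rule conj_cong[OF refl])
      fix z assume "z \<in> rcosets H"
      then obtain x where "x \<in> carrier G" "z = H #> x" by (auto simp: RCOSETS_def)
      then show "K <#> z = c \<longleftrightarrow> z \<subseteq> K #> y"
        using y assms by (simp add: set_mult_rcoset rcoset_subset_iff)
    qed
    then show "card {z \<in> rcosets H. K <#> z = c} = card {z \<in> rcosets H. z \<subseteq> K}"
      using bij_betw_same_card[OF rcoset_translate_bij[OF H subgroup.subset[OF K] y(1)]] by simp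
  qed
  finally show ?thesis by simp
qed

text \<open>Inversion exchanges the two kinds of cosets. The index is defined with left cosets,
  while blocks consist of right cosets.\<close>

lemma card_lcosets_eq_rcosets:
  assumes "subgroup U G"
  shows "card (lcosets U) = card (rcosets U)"
proof -
  have inv_coset: "m_inv G ` (x <# U) = U #> inv x" "m_inv G ` (U #> x) = inv x <# U" if "x \<in> carrier G" for x
  proof -
    have U: "inv u \<in> U" "u \<in> carrier G" "inv (inv u) = u" if "u \<in> U" for u
      using that assms by (auto simp: subgroup.m_inv_closed subgroup.mem_carrier)
    have "m_inv G ` (x <# U) = (\<lambda>u. inv u \<otimes> inv x) ` U"
      using U that by (auto simp: l_coset_def inv_mult_group image_UN)
    also have "\<dots> = (\<lambda>u. u \<otimes> inv x) ` (m_inv G ` U)" by (simp add: image_image)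
    also have "m_inv G ` U = U" using U by force
    finally show "m_inv G ` (x <# U) = U #> inv x" by (auto simp: r_coset_def)
    have "m_inv G ` (U #> x) = (\<lambda>u. inv x \<otimes> inv u) ` U"
      using U that by (auto simp: r_coset_def inv_mult_group image_UN)
    also have "\<dots> = (\<lambda>u. inv x \<otimes> u) ` (m_inv G ` U)" by (simp add: image_image)
    also have "m_inv G ` U = U" using U by force
    finally show "m_inv G ` (U #> x) = inv x <# U" by (auto simp: l_coset_def)
  qed
  have "bij_betw (image (m_inv G)) (lcosets U) (rcosets U)"
  proof (rule bij_betw_byWitness[where f' = "image (m_inv G)"])
    show "image (m_inv G) ` (lcosets U) \<subseteq> rcosets U"
    proof clarify
      fix z assume "z \<in> lcosets U"
      then obtain x where "x \<in> carrier G" "z = x <# U" by (auto simp: LCOSETS_def)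
      then show "m_inv G ` z \<in> rcosets U"
        using rcosetsI[of U "inv x"] subgroup.subset[OF assms] by (simp add: inv_coset)
    qed
    show "image (m_inv G) ` (rcosets U) \<subseteq> lcosets U"
    proof clarify
      fix z assume "z \<in> rcosets U"
      then obtain x where "x \<in> carrier G" "z = U #> x" by (auto simp: RCOSETS_def)
      then show "m_inv G ` z \<in> lcosets U"
        using inv_closed[of x] by (auto simp: inv_coset LCOSETS_def)
    qed
  qed (auto simp: LCOSETS_def RCOSETS_def inv_coset)
  then show ?thesis by (rule bij_betw_same_card)
qed

text \<open>Left multiplication by \<open>g\<close> sends the coset of \<open>x\<close> under
  \<open>U\<close> to the coset of \<open>g \<otimes> x\<close> under the conjugate.\<close>

lemma card_rcosets_conjugate:
  assumes U: "subgroup U G" and g: "g \<in> carrier G"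
  shows "card (rcosets (conjugate G g U)) = card (rcosets U)"
proof -
  note [simp] = subgroup.subset[OF U]
  have eq: "g <# (U #> x) = conjugate G g U #> (g \<otimes> x)" if "x \<in> carrier G" for x
    using that g by (simp add: coset_assoc conjugate_eq_lcoset_rcoset[symmetric] coset_mult_assoc
        conjugate_subset_carrier)
  have eq': "inv g <# (conjugate G g U #> x) = U #> (inv g \<otimes> x)" if "x \<in> carrier G" for x
  proof -
    have "conjugate G g U #> x = g <# (U #> (inv g \<otimes> x))"
      using eq[of "inv g \<otimes> x"] that g by (simp add: inv_cancel_left)
    then show ?thesis using that g by (simp add: lcos_m_assoc lcos_mult_one r_coset_subset_G)
  qed
  have "bij_betw (\<lambda>z. g <# z) (rcosets U) (rcosets (conjugate G g U))"
  proof (rule bij_betw_byWitness[where f' = "\<lambda>z. inv g <# z"])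
    show "(\<lambda>z. g <# z) ` (rcosets U) \<subseteq> rcosets (conjugate G g U)"
    proof clarify
      fix z assume "z \<in> rcosets U"
      then obtain x where "x \<in> carrier G" "z = U #> x" by (auto simp: RCOSETS_def)
      then show "g <# z \<in> rcosets (conjugate G g U)"
        using g rcosetsI[of "conjugate G g U" "g \<otimes> x"] by (simp add: eq conjugate_subset_carrier)
    qed
    show "(\<lambda>z. inv g <# z) ` (rcosets (conjugate G g U)) \<subseteq> rcosets U"
      proof clarify
      fix z assume "z \<in> rcosets (conjugate G g U)"
      then obtain x where "x \<in> carrier G" "z = conjugate G g U #> x" by (auto simp: RCOSETS_def)
      then show "inv g <# z \<in> rcosets U"
        using g rcosetsI[of U "inv g \<otimes> x"] by (simp add: eq')
    qed
    show "\<forall>z\<in>rcosets U. inv g <# (g <# z) = z"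
      using g by (auto simp: RCOSETS_def eq eq' inv_cancel_left)
    show "\<forall>z\<in>rcosets (conjugate G g U). g <# (inv g <# z) = z"
      using g by (auto simp: RCOSETS_def eq eq' inv_cancel_left)
  qed
  then show ?thesis by (rule bij_betw_same_card[symmetric])
qed

definition fixed_cosets :: "'a set \<Rightarrow> 'a set \<Rightarrow> 'a set set"
  where "fixed_cosets V W = {K \<in> lcosets V. \<forall>w\<in>W. w <# K = K}"

lemma num_fixed_eq: "num_fixed (\<lambda>g K. g <# K) (lcosets V) W = card (fixed_cosets V W)"
  by (simp add: num_fixed_def fixed_cosets_def)

lemma lcoset_fixed_iff:
  assumes V: "subgroup V G" and W: "subgroup W G" and x: "x \<in> carrier G"
  shows "(\<forall>w\<in>W. w <# (x <# V) = x <# V) \<longleftrightarrow> W \<subseteq> conjugate G x V"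
proof -
  have "w <# (x <# V) = x <# V \<longleftrightarrow> w \<in> conjugate G x V" if "w \<in> W" for w
  proof -
    have w: "w \<in> carrier G" using W that by (auto simp: subgroup.mem_carrier)
    have "w <# (x <# V) = x <# V \<longleftrightarrow> (w \<otimes> x) <# V = x <# V"
      using w x V by (simp add: lcos_m_assoc subgroup.subset)
    also have "\<dots> \<longleftrightarrow> w \<otimes> x \<in> x <# V"
      using w x V l_repr_independence lcos_self by (metis m_closed)
    also have "\<dots> \<longleftrightarrow> w \<in> conjugate G x V"
      using w x V by (simp add: mem_lcoset_iff mem_conjugate_iff subgroup.subset m_assoc)
    finally show ?thesis .
  qed
  then show ?thesis by auto
qed

lemma fixed_cosets_eq:
  assumes "subgroup V G" "subgroup W G"
  shows "fixed_cosets V W = {x <# V | x. x \<in> carrier G \<and> W \<subseteq> conjugate G x V}"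
  using lcoset_fixed_iff[OF assms] by (auto simp: fixed_cosets_def LCOSETS_def)

text \<open>Expresses fixedness by a single set product, the operation through which the Weyl group
  acts.\<close>

lemma fixed_cosets_iff_set_mult:
  assumes V: "subgroup V G" and W: "subgroup W G"
  shows "K \<in> fixed_cosets V W \<longleftrightarrow> K \<in> lcosets V \<and> W <#> K = K"
proof -
  have "(\<forall>w\<in>W. w <# K = K) \<longleftrightarrow> W <#> K = K" if K: "K \<in> lcosets V"
  proof
    assume "\<forall>w\<in>W. w <# K = K"
    moreover have "W <#> K = (\<Union>w\<in>W. w <# K)" by (simp add: set_mult_def l_coset_def)
    ultimately show "W <#> K = K" using subgroup.one_closed[OF W] by auto
  next
    assume eq: "W <#> K = K"
    have Kc: "K \<subseteq> carrier G" using K lcosets_subset_PowG[OF V] by auto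
    have sub: "w <# K \<subseteq> K" if "w \<in> W" for w
      using that eq by (auto simp: set_mult_def l_coset_def)
    have "K \<subseteq> w <# K" if "w \<in> W" for w
    proof -
      have "w \<in> carrier G" "inv w \<in> W" using that W by (auto simp: subgroup.mem_carrier subgroup.m_inv_closed)
      then have "w <# (inv w <# K) = K" using Kc by (simp add: lcos_m_assoc lcos_mult_one)
      moreover have "w <# (inv w <# K) \<subseteq> w <# K"
        using sub[OF \<open>inv w \<in> W\<close>] by (auto simp: l_coset_def)
      ultimately show ?thesis by simp
    qed
    with sub show "\<forall>w\<in>W. w <# K = K" by blast
  qed
  then show ?thesis by (auto simp: fixed_cosets_def)
qed

text \<open>Left multiplication by \<open>g\<close> exchanges the two fixed sets. Hence the count
  depends only on the conjugacy class of \<open>W\<close>.\<close>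

lemma card_fixed_cosets_conjugate:
  assumes V: "subgroup V G" and W: "subgroup W G" and g: "g \<in> carrier G"
  shows "card (fixed_cosets V (conjugate G g W)) = card (fixed_cosets V W)"
proof -
  have Vs: "V \<subseteq> carrier G" and Ws: "W \<subseteq> carrier G" using V W by (auto simp: subgroup.subset)
  have tr: "h <# K \<in> fixed_cosets V (conjugate G h W)"
    if K: "K \<in> fixed_cosets V W" and W: "subgroup W G" and h: "h \<in> carrier G" for h K W
  proof -
    obtain x where x: "x \<in> carrier G" "K = x <# V" "W \<subseteq> conjugate G x V"
      using K fixed_cosets_eq[OF V W] by auto
    have "conjugate G h W \<subseteq> conjugate G h (conjugate G x V)"
      using x(3) by (auto simp: conjugate_def l_coset_def r_coset_def)
    then have "conjugate G h W \<subseteq> conjugate G (h \<otimes> x) V"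
      using x h Vs by (simp add: conjugate_conjugate)
    moreover have "h <# K = (h \<otimes> x) <# V" using x h Vs by (simp add: lcos_m_assoc)
    ultimately show ?thesis
      using x h fixed_cosets_eq[OF V subgroup_conjugate[OF W h]] by auto
  qed
  have sub: "K \<subseteq> carrier G" if "K \<in> fixed_cosets V W" for K W
    using that lcosets_subset_PowG[OF V] by (auto simp: fixed_cosets_def)
  have "bij_betw (\<lambda>K. g <# K) (fixed_cosets V W) (fixed_cosets V (conjugate G g W))"
  proof (rule bij_betw_byWitness[where f' = "\<lambda>K. inv g <# K"])
    show "(\<lambda>K. inv g <# K) ` fixed_cosets V (conjugate G g W) \<subseteq> fixed_cosets V W"
      using tr[of _ "conjugate G g W" "inv g"] g Ws subgroup_conjugate[OF W g]
      by (simp add: conjugate_conjugate conjugate_one image_subset_iff)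
    show "(\<lambda>K. g <# K) ` fixed_cosets V W \<subseteq> fixed_cosets V (conjugate G g W)"
      using tr[OF _ W g] by blast
    show "\<forall>K\<in>fixed_cosets V W. inv g <# (g <# K) = K"
      using sub[of _ W] g by (simp add: lcos_m_assoc lcos_mult_one)
    show "\<forall>K\<in>fixed_cosets V (conjugate G g W). g <# (inv g <# K) = K"
      using sub[of _ "conjugate G g W"] g by (simp add: lcos_m_assoc lcos_mult_one)
  qed
  then show ?thesis by (rule bij_betw_same_card[symmetric])
qed

text \<open>A \<open>U\<close>-fixed coset of \<open>x\<close> is a right coset of the conjugate of
  \<open>V\<close> by \<open>x\<close>, which contains \<open>U\<close>; so both contain equally
  many right cosets of \<open>U\<close>.\<close>

lemma card_blocks:
  assumes V: "subgroup V G" and U: "subgroup U G" and fin: "finite (rcosets U)"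
    and K: "K \<in> fixed_cosets V U"
  shows "card (rcosets U) = card {z \<in> rcosets U. z \<subseteq> K} * card (rcosets V)"
proof -
  obtain x where x: "x \<in> carrier G" "K = x <# V" "U \<subseteq> conjugate G x V"
    using K fixed_cosets_eq[OF V U] by auto
  have "card {z \<in> rcosets U. z \<subseteq> K} = card {z \<in> rcosets U. z \<subseteq> conjugate G x V}"
    using bij_betw_same_card[OF rcoset_translate_bij[OF U, of "conjugate G x V" x]] x
      conjugate_eq_lcoset_rcoset[of x V] subgroup.subset[OF V] by (simp add: conjugate_subset_carrier)
  then show ?thesis
    using card_rcosets_mult[OF U subgroup_conjugate[OF V x(1)] x(3) fin] card_rcosets_conjugate[OF V x(1)]
    by simp
qed

text \<open>A fixed coset is a union of right cosets of \<open>U\<close>, and there are finitely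
  many such unions.\<close>

lemma finite_fixed_cosets:
  assumes V: "subgroup V G" and U: "subgroup U G" and fin: "finite (rcosets U)"
  shows "finite (fixed_cosets V U)"
proof (rule finite_subset)
  show "fixed_cosets V U \<subseteq> Union ` Pow (rcosets U)"
  proof
    fix K assume K: "K \<in> fixed_cosets V U"
    then have eq: "U <#> K = K" and "K \<subseteq> carrier G"
      using fixed_cosets_iff_set_mult[OF V U] lcosets_subset_PowG[OF V] by auto
    have "K = \<Union> ((\<lambda>x. U #> x) ` K)"
    proof -
      have "U <#> K = \<Union> ((\<lambda>x. U #> x) ` K)" by (auto simp: set_mult_def r_coset_def)
      then show ?thesis using eq by simp
    qed
    moreover have "(\<lambda>x. U #> x) ` K \<in> Pow (rcosets U)"
      using \<open>K \<subseteq> carrier G\<close> by (auto simp: RCOSETS_def)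
    ultimately show "K \<in> Union ` Pow (rcosets U)" by blast
  qed
qed (use fin in simp)

section \<open>The group N(U)/U and the subgroups between \<open>U\<close> and its
  normalizer\<close>

section \<open>The Weyl group\<close>

text \<open>Its elements are cosets themselves, so it acts by set product on right cosets of
  \<open>U\<close> and on \<open>U\<close>-fixed left cosets, with no choice of
  representatives.\<close>

definition weyl_group :: "'a set \<Rightarrow> 'a set monoid"
  where "weyl_group U = (G\<lparr>carrier := normalizer G U\<rparr>) Mod U"

lemma mem_normalizer_iff:
  assumes "subgroup U G"
  shows "g \<in> normalizer G U \<longleftrightarrow> g \<in> carrier G \<and> conjugate G g U = U"
  using subgroup.subset[OF assms] by (auto simp: normalizer_def stabilizer_def conjugate_def)

lemma normalizer_lcoset_eq_rcoset:
  assumes "subgroup U G" "g \<in> normalizer G U"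
  shows "g <# U = U #> g"
  using assms conjugate_eq_lcoset_rcoset[of g U] mem_normalizer_iff[OF assms(1)] subgroup.subset[OF assms(1)]
  by auto

context
  fixes U
  assumes U: "subgroup U G" and fin: "finite (rcosets U)"
begin

lemma U_carrier: "U \<subseteq> carrier G" using U by (rule subgroup.subset)

interpretation N: normal U "G\<lparr>carrier := normalizer G U\<rparr>"
  by (rule subgroup_in_normalizer[OF U])

lemma normalizer_subgroup: "subgroup (normalizer G U) G"
  by (rule normalizer_imp_subgroup[OF U_carrier])

lemma weyl_is_group: "group (weyl_group U)"
  unfolding weyl_group_def by (rule N.factorgroup_is_group)

lemma weyl_carrier: "carrier (weyl_group U) = (\<lambda>s. U #> s) ` normalizer G U"
  by (simp add: weyl_group_def carrier_FactGroup)

lemma weyl_one: "\<one>\<^bsub>weyl_group U\<^esub> = U"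
  by (simp add: weyl_group_def)

lemma weyl_mult: "C \<otimes>\<^bsub>weyl_group U\<^esub> D = C <#> D"
  by (simp add: weyl_group_def)

lemma weyl_carrier_subset: "carrier (weyl_group U) \<subseteq> rcosets U"
  using subgroup.subset[OF normalizer_subgroup] by (auto simp: weyl_carrier RCOSETS_def)

lemma finite_weyl: "finite (carrier (weyl_group U))"
  using weyl_carrier_subset fin finite_subset by blast

lemma weyl_act_rcoset:
  assumes "s \<in> normalizer G U" "x \<in> carrier G"
  shows "(U #> s) <#> (U #> x) = U #> (s \<otimes> x)"
proof -
  have s: "s \<in> carrier G" using assms(1) subgroup.mem_carrier[OF normalizer_subgroup] by auto
  have "(U #> s) <#> (U #> x) = U <#> ((s <# U) #> x)"
    using s assms U_carrier by (simp add: rcos_assoc_lcos r_coset_subset_G coset_assoc)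
  also have "\<dots> = U <#> (U #> (s \<otimes> x))"
    using s assms U_carrier by (simp add: normalizer_lcoset_eq_rcoset[OF U] coset_mult_assoc)
  also have "\<dots> = U #> (s \<otimes> x)"
    using s assms U by (intro set_mult_rcoset) auto
  finally show ?thesis .
qed

text \<open>\<open>s\<close> normalises \<open>U\<close>, and \<open>K\<close> absorbs
  \<open>U\<close> from the left.\<close>

lemma weyl_act_lcoset:
  assumes "subgroup V G" "K \<in> fixed_cosets V U" "s \<in> normalizer G U"
  shows "(U #> s) <#> K = s <# K"
proof -
  have s: "s \<in> carrier G" using assms(3) subgroup.mem_carrier[OF normalizer_subgroup] by auto
  have K: "U <#> K = K" "K \<subseteq> carrier G"
    using assms fixed_cosets_iff_set_mult[OF assms(1) U] lcosets_subset_PowG[OF assms(1)] by auto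
  have "(U #> s) <#> K = (s <# U) <#> K" using normalizer_lcoset_eq_rcoset[OF U assms(3)] by simp
  also have "\<dots> = s <# (U <#> K)" using s K U_carrier by (simp add: setmult_lcos_assoc)
  finally show ?thesis using K by simp
qed

lemma weyl_act_fixed_cosets:
  assumes V: "subgroup V G" and K: "K \<in> fixed_cosets V U" and s: "s \<in> normalizer G U"
  shows "s <# K \<in> fixed_cosets V U"
proof -
  have sc: "s \<in> carrier G" "conjugate G s U = U" using s mem_normalizer_iff[OF U] by auto
  obtain x where x: "x \<in> carrier G" "K = x <# V" "U \<subseteq> conjugate G x V"
    using K fixed_cosets_eq[OF V U] by auto
  have "conjugate G s U \<subseteq> conjugate G s (conjugate G x V)"
    using x(3) by (auto simp: conjugate_def l_coset_def r_coset_def)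
  then have "U \<subseteq> conjugate G (s \<otimes> x) V"
    using sc x V by (simp add: conjugate_conjugate subgroup.subset)
  moreover have "s <# K = (s \<otimes> x) <# V"
    using sc x V by (simp add: lcos_m_assoc subgroup.subset)
  ultimately show ?thesis using sc x fixed_cosets_eq[OF V U] by auto
qed

text \<open>Freeness holds because equality of the cosets of \<open>s \<otimes> x\<close> and
  \<open>x\<close> puts \<open>s\<close> into \<open>U\<close>; block sizes come from
  \<open>card_blocks\<close>; cosets inside \<open>K\<close> go to cosets inside
  \<open>s <# K\<close>, and the coset of \<open>inv s\<close> brings them back.\<close>

lemma weyl_block_action:
  assumes V: "subgroup V G"
  shows "block_action (weyl_group U) (rcosets U) (\<lambda>C z. C <#> z) (fixed_cosets V U) (\<lambda>C K. C <#> K)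
    (\<lambda>K. {z \<in> rcosets U. z \<subseteq> K}) (card (rcosets U) div card (rcosets V))"
proof -
  interpret W: group "weyl_group U" by (rule weyl_is_group)
  have Nc: "s \<in> carrier G" if "s \<in> normalizer G U" for s
    using that subgroup.mem_carrier[OF normalizer_subgroup] by auto
  have Cc: "C \<subseteq> carrier G" if "C \<in> carrier (weyl_group U)" for C
    using that weyl_carrier_subset rcosets_subset_PowG[OF U] by auto
  have Kc: "K \<subseteq> carrier G" if "K \<in> fixed_cosets V U" for K
    using that lcosets_subset_PowG[OF V] by (auto simp: fixed_cosets_def)
  have zc: "z \<subseteq> carrier G" if "z \<in> rcosets U" for z
    using that rcosets_subset_PowG[OF U] by auto
  show ?thesis
  \<comment> \<open>Goals 1 to 5 concern the right cosets of \<open>U\<close>, 6 to 9 the fixed left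
    cosets, 10 is freeness, and 11 to 13 concern the blocks.\<close>
  proof (unfold_locales, goal_cases)
    case 1 show ?case by (rule finite_weyl)
  next
    case 2 show ?case by (rule fin)
  next
    case (3 C z)
    then show ?case using Nc by (auto simp: weyl_carrier RCOSETS_def weyl_act_rcoset)
  next
    case (4 z)
    then show ?case by (auto simp: weyl_one RCOSETS_def set_mult_rcoset[OF U U])
  next
    case (5 C D z)
    then show ?case using Cc zc by (simp add: weyl_mult set_mult_assoc)
  next
    case 6 show ?case by (rule finite_fixed_cosets[OF V U fin])
  next
    case (7 C K)
    then show ?case using weyl_act_fixed_cosets[OF V] by (auto simp: weyl_carrier weyl_act_lcoset[OF V])
  next
    case (8 K)
    then show ?case by (auto simp: weyl_one fixed_cosets_iff_set_mult[OF V U])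
  next
    case (9 C D K)
    then show ?case using Cc Kc by (simp add: weyl_mult set_mult_assoc)
  next
    case (10 C z)
    then obtain s x where sx: "s \<in> normalizer G U" "C = U #> s" "x \<in> carrier G" "z = U #> x"
      by (auto simp: weyl_carrier RCOSETS_def)
    then have "U #> (s \<otimes> x) = U #> x" using 10 by (simp add: weyl_act_rcoset)
    then have "s \<otimes> x \<in> U #> x" using rcos_self[OF _ U, of "s \<otimes> x"] sx Nc by auto
    then have "s \<in> U" using sx Nc by (simp add: mem_rcoset_iff[OF U] m_assoc)
    then show ?case using sx coset_join2[OF _ U] Nc by (simp add: weyl_one)
  next
    case (11 K)
    then show ?case by auto
  next
    case (12 K)
    \<comment> \<open>\<open>card\<close> is 0 on infinite sets, so positivity must be derived
      before dividing; the positive index of \<open>U\<close> gives it.\<close>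
    have "card (rcosets V) > 0"
    proof (rule ccontr)
      assume "\<not> card (rcosets V) > 0"
      then have "card (rcosets U) = 0" using card_blocks[OF V U fin 12] by simp
      then show False using fin subgroup.subgroup_in_rcosets[OF U is_group] by auto
    qed
    then show ?case using card_blocks[OF V U fin 12] by simp
  next
    case (13 C K)
    then obtain s where s: "s \<in> normalizer G U" "C = U #> s" "s \<in> carrier G"
      using Nc by (auto simp: weyl_carrier)
    have "inv s \<in> normalizer G U" using s subgroup.m_inv_closed[OF normalizer_subgroup] by auto
    have CK: "C <#> K = s <# K" using 13 s weyl_act_lcoset[OF V] by auto
    have cz: "(U #> t) <#> z \<in> rcosets U \<and> (U #> t) <#> z \<subseteq> t <# L"
      if "z \<in> rcosets U" "z \<subseteq> L" "L \<in> fixed_cosets V U" "t \<in> normalizer G U" for t z L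
    proof -
      have "(U #> t) <#> z \<subseteq> (U #> t) <#> L" using that(2) by (intro mono_set_mult) auto
      then have "(U #> t) <#> z \<subseteq> t <# L" using weyl_act_lcoset[OF V] that by auto
      moreover have "(U #> t) <#> z \<in> rcosets U"
        using that Nc[OF that(4)] by (auto simp: RCOSETS_def weyl_act_rcoset)
      ultimately show ?thesis by simp
    qed
    have cancel: "(U #> s) <#> ((U #> inv s) <#> z) = z" if "z \<in> rcosets U" for z
      using that s \<open>inv s \<in> normalizer G U\<close>
      by (auto simp: RCOSETS_def weyl_act_rcoset m_assoc[symmetric])
    have sK: "s <# K \<in> fixed_cosets V U" using weyl_act_fixed_cosets[OF V 13(2) s(1)] .
    have "inv s <# (s <# K) = K" using s Kc[OF 13(2)] by (simp add: lcos_m_assoc lcos_mult_one)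
    show ?case
    proof (intro Set.set_eqI iffI)
      fix z assume "z \<in> {z \<in> rcosets U. z \<subseteq> C <#> K}"
      then have z: "z \<in> rcosets U" "z \<subseteq> s <# K" by (auto simp: CK)
      have "(U #> inv s) <#> z \<in> {z \<in> rcosets U. z \<subseteq> K}"
        using cz[OF z sK \<open>inv s \<in> normalizer G U\<close>] \<open>inv s <# (s <# K) = K\<close> by simp
      then show "z \<in> (\<lambda>z. C <#> z) ` {z \<in> rcosets U. z \<subseteq> K}"
        using cancel[OF z(1)] s by (metis image_eqI)
    next
      fix z assume "z \<in> (\<lambda>z. C <#> z) ` {z \<in> rcosets U. z \<subseteq> K}"
      then show "z \<in> {z \<in> rcosets U. z \<subseteq> C <#> K}"
        using cz[OF _ _ 13(2) s(1)] s(2) CK by auto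
    qed
  qed
qed

text \<open>The subgroup called \<open>U\<^sub>s\<close> in the overview: the preimage of the cyclic
  group generated by \<open>C\<close>, formed as the union of its elements.\<close>

definition adjoin :: "'a set \<Rightarrow> 'a set"
  where "adjoin C = \<Union>(generate (weyl_group U) {C})"

context
  fixes C assumes C: "C \<in> carrier (weyl_group U)"
begin

lemma generate_weyl_subgroup: "subgroup (generate (weyl_group U) {C}) (weyl_group U)"
  using C by (intro group.generate_is_subgroup weyl_is_group) auto

lemma subgroup_adjoin: "subgroup (adjoin C) G"
proof -
  have "subgroup (adjoin C) (G\<lparr>carrier := normalizer G U\<rparr>)"
    unfolding adjoin_def
    using N.factgroup_subgroup_union_subgroup generate_weyl_subgroup by (simp add: weyl_group_def)
  then show ?thesis using normalizer_subgroup incl_subgroup by blast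
qed

lemma subset_adjoin: "U \<subseteq> adjoin C"
  using generate.one[of "weyl_group U" "{C}"] by (auto simp: adjoin_def weyl_one)

lemma adjoin_generator: "C \<subseteq> adjoin C"
  using generate.incl[of C "{C}" "weyl_group U"] by (auto simp: adjoin_def)

text \<open>Cosets are disjoint, so a coset inside the union is one of its members. Hence the index
  of \<open>U\<close> in \<open>adjoin C\<close> is the order of \<open>C\<close>.\<close>

lemma rcosets_in_adjoin: "{z \<in> rcosets U. z \<subseteq> adjoin C} = generate (weyl_group U) {C}"
proof -
  have gen: "generate (weyl_group U) {C} \<subseteq> rcosets U"
    using subgroup.subset[OF generate_weyl_subgroup] weyl_carrier_subset by auto
  have "z \<in> generate (weyl_group U) {C}" if z: "z \<in> rcosets U" "z \<subseteq> adjoin C" for z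
  proof -
    obtain x where "x \<in> z" using subgroup.rcosets_non_empty[OF U z(1)] by auto
    then obtain D where D: "D \<in> generate (weyl_group U) {C}" "x \<in> D" using z by (auto simp: adjoin_def)
    then have "D = z" using rcos_disjoint[OF U] gen z(1) \<open>x \<in> z\<close> by (auto simp: pairwise_def disjnt_def)
    then show ?thesis using D by simp
  qed
  then show ?thesis using gen by (auto simp: adjoin_def)
qed

lemma card_rcosets_adjoin:
  "card (rcosets U) = card (generate (weyl_group U) {C}) * card (rcosets (adjoin C))"
  using card_rcosets_mult[OF U subgroup_adjoin subset_adjoin fin] rcosets_in_adjoin by simp

text \<open>\<open>adjoin C\<close> is generated by \<open>U\<close> and \<open>C\<close>. This
  makes a ghost component at \<open>adjoin C\<close> a fixed-point count of the one element
  \<open>C\<close> on the \<open>U\<close>-fixed cosets.\<close>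

lemma fixed_cosets_adjoin:
  assumes V: "subgroup V G"
  shows "fixed_cosets V (adjoin C) = {K \<in> fixed_cosets V U. C <#> K = K}"
proof -
  interpret B: block_action "weyl_group U" "rcosets U" "\<lambda>C z. C <#> z" "fixed_cosets V U" "\<lambda>C K. C <#> K"
    "\<lambda>K. {z \<in> rcosets U. z \<subseteq> K}" "card (rcosets U) div card (rcosets V)"
    by (rule weyl_block_action[OF V])
  obtain s where s: "s \<in> normalizer G U" "C = U #> s" using C by (auto simp: weyl_carrier)
  show ?thesis
  proof (intro Set.set_eqI iffI)
    fix K assume K: "K \<in> fixed_cosets V (adjoin C)"
    then have KU: "K \<in> fixed_cosets V U" using subset_adjoin by (auto simp: fixed_cosets_def)
    have "s \<in> adjoin C"
      using adjoin_generator s rcos_self[OF _ U] subgroup.mem_carrier[OF normalizer_subgroup] by blast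
    then have "s <# K = K" using K by (auto simp: fixed_cosets_def)
    then show "K \<in> {K \<in> fixed_cosets V U. C <#> K = K}"
      using KU s weyl_act_lcoset[OF V KU] by auto
  next
    fix K assume "K \<in> {K \<in> fixed_cosets V U. C <#> K = K}"
    then have K: "K \<in> fixed_cosets V U" "C <#> K = K" by auto
    have "adjoin C <#> K = (\<Union>D\<in>generate (weyl_group U) {C}. D <#> K)"
      by (auto simp: adjoin_def set_mult_def)
    also have "\<dots> = K"
      using B.generate_act_fixed[OF _ C K] generate.one[of "weyl_group U" "{C}"] by auto
    finally show "K \<in> fixed_cosets V (adjoin C)"
      using K fixed_cosets_iff_set_mult[OF V] U subgroup_adjoin by auto
  qed
qed

end

lemma adjoin_one: "adjoin U = U"
proof -
  interpret W: group "weyl_group U" by (rule weyl_is_group)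
  have "generate (weyl_group U) {\<one>\<^bsub>weyl_group U\<^esub>} = {\<one>\<^bsub>weyl_group U\<^esub>}"
    by (rule W.generate_one)
  then show ?thesis by (simp add: adjoin_def weyl_one)
qed

lemma card_generate_gt_1:
  assumes "C \<in> carrier (weyl_group U)" "C \<noteq> U"
  shows "card (generate (weyl_group U) {C}) > 1"
proof -
  have "{C, U} \<subseteq> generate (weyl_group U) {C}"
    using generate.one[of "weyl_group U" "{C}"] generate.incl[of C "{C}" "weyl_group U"]
    by (auto simp: weyl_one)
  moreover have "finite (generate (weyl_group U) {C})"
    using subgroup.subset[OF generate_weyl_subgroup[OF assms(1)]] finite_weyl finite_subset by blast
  ultimately have "card {C, U} \<le> card (generate (weyl_group U) {C})" by (rule card_mono[rotated])
  then show ?thesis using assms(2) by simp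
qed

text \<open>A proper inclusion would put two right cosets of \<open>U\<close> into \<open>W\<close>
  and so at least double the index.\<close>

lemma eq_of_card_rcosets_eq:
  assumes W: "subgroup W G" and "U \<subseteq> W" and "card (rcosets U) = card (rcosets W)"
  shows "U = W"
proof (rule ccontr)
  assume "U \<noteq> W"
  then obtain w where w: "w \<in> W" "w \<notin> U" using assms(2) by auto
  have wc: "w \<in> carrier G" using w W by (auto simp: subgroup.mem_carrier)
  have "card (rcosets U) > 0"
    using fin subgroup.subgroup_in_rcosets[OF U is_group] by (auto simp: card_gt_0_iff)
  have "{U, U #> w} \<subseteq> {z \<in> rcosets U. z \<subseteq> W}"
    using w wc assms(2) subgroup.subgroup_in_rcosets[OF U is_group] rcosetsI[OF U_carrier wc]
      subgroup.m_closed[OF W] by (auto simp: r_coset_def)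
  then have "card {U, U #> w} \<le> card {z \<in> rcosets U. z \<subseteq> W}"
    using fin by (intro card_mono) auto
  moreover have "U \<noteq> U #> w" using rcos_self[OF wc U] w by auto
  ultimately have "card {z \<in> rcosets U. z \<subseteq> W} \<ge> 2" by simp
  then show False
    using card_rcosets_mult[OF U W assms(2) fin] assms(3) \<open>card (rcosets U) > 0\<close> by simp
qed

text \<open>If \<open>U\<close> fixes the coset of \<open>x\<close>, it lies in its conjugate by
  \<open>x\<close>; equal indices force equality, so \<open>x\<close> normalises \<open>U\<close>.
  This identifies the diagonal entry of the ghost map with the modulus of the congruences.\<close>

lemma card_weyl_group: "card (carrier (weyl_group U)) = card (fixed_cosets U U)"
proof -
  have "fixed_cosets U U = (\<lambda>s. U #> s) ` normalizer G U"
  proof (intro Set.set_eqI iffI)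
    fix K assume "K \<in> fixed_cosets U U"
    then obtain x where x: "x \<in> carrier G" "K = x <# U" "U \<subseteq> conjugate G x U"
      using fixed_cosets_eq[OF U U] by auto
    have "U = conjugate G x U"
      using x subgroup_conjugate[OF U] card_rcosets_conjugate[OF U] by (intro eq_of_card_rcosets_eq) auto
    then have "x \<in> normalizer G U" using x mem_normalizer_iff[OF U] by auto
    then show "K \<in> (\<lambda>s. U #> s) ` normalizer G U"
      using x normalizer_lcoset_eq_rcoset[OF U] by auto
  next
    fix K assume "K \<in> (\<lambda>s. U #> s) ` normalizer G U"
    then obtain s where s: "s \<in> normalizer G U" "K = s <# U"
      using normalizer_lcoset_eq_rcoset[OF U] by auto
    then show "K \<in> fixed_cosets U U"
      using mem_normalizer_iff[OF U] fixed_cosets_eq[OF U U] by auto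
  qed
  then show ?thesis by (simp add: weyl_carrier)
qed

end

end

section \<open>Consequences of compactness, and the poset of classes\<close>

section \<open>Classes of open subgroups\<close>

context profinite_group
begin

lemma subgroup_open: "open_subgroup G T U \<Longrightarrow> subgroup U G"
  by (simp add: open_subgroup_def)

lemma continuous_map_translations:
  assumes g: "g \<in> carrier G"
  shows "continuous_map T T (\<lambda>x. g \<otimes> x)" "continuous_map T T (\<lambda>x. x \<otimes> g)"
proof -
  have "continuous_map T (prod_topology T T) (\<lambda>x. (g, x))" "continuous_map T (prod_topology T T) (\<lambda>x. (x, g))"
    using g by (auto simp: continuous_map_pairwise o_def topspace_eq)
  from this[THEN continuous_map_compose, OF mult_continuous]
  show "continuous_map T T (\<lambda>x. g \<otimes> x)" "continuous_map T T (\<lambda>x. x \<otimes> g)"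
    by (simp_all add: o_def)
qed

lemma open_rcoset:
  assumes U: "open_subgroup G T U" and x: "x \<in> carrier G"
  shows "openin T (U #> x)"
proof -
  have "U #> x = {y \<in> topspace T. y \<otimes> inv x \<in> U}"
    using mem_rcoset_iff[OF subgroup_open[OF U] x] by (auto simp: topspace_eq)
  then show ?thesis
    using openin_continuous_map_preimage[OF continuous_map_translations(2)[of "inv x"], of U] U x
    by (simp add: open_subgroup_def)
qed

lemma open_subgroup_conjugate:
  assumes U: "open_subgroup G T U" and g: "g \<in> carrier G"
  shows "open_subgroup G T (conjugate G g U)"
proof -
  have "continuous_map T T (\<lambda>x. inv g \<otimes> x \<otimes> g)"
    using continuous_map_compose[OF continuous_map_translations(1)[of "inv g"] continuous_map_translations(2)[OF g]] g
    by (simp add: o_def)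
  moreover have "conjugate G g U = {y \<in> topspace T. inv g \<otimes> y \<otimes> g \<in> U}"
    using mem_conjugate_iff[OF g subgroup.subset[OF subgroup_open[OF U]]] by (auto simp: topspace_eq)
  ultimately show ?thesis
    using openin_continuous_map_preimage[of T T "\<lambda>x. inv g \<otimes> x \<otimes> g" U] U
      subgroup_conjugate[OF subgroup_open[OF U] g]
    by (simp add: open_subgroup_def)
qed

text \<open>It is a union of open cosets. Needed for \<open>adjoin\<close>, whose class has to be a
  class of open subgroups.\<close>

lemma open_subgroup_superset:
  assumes U: "open_subgroup G T U" and W: "subgroup W G" and "U \<subseteq> W"
  shows "open_subgroup G T W"
proof -
  have "W = (\<Union>w\<in>W. U #> w)"
  proof
    show "W \<subseteq> (\<Union>w\<in>W. U #> w)"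
      using rcos_self[OF _ subgroup_open[OF U]] subgroup.mem_carrier[OF W] by blast
    show "(\<Union>w\<in>W. U #> w) \<subseteq> W"
      using assms(3) subgroup.m_closed[OF W] by (auto simp: r_coset_def)
  qed
  moreover have "openin T (\<Union>w\<in>W. U #> w)"
    using open_rcoset[OF U] subgroup.mem_carrier[OF W] by (intro openin_Union) auto
  ultimately show ?thesis using W by (simp add: open_subgroup_def)
qed

text \<open>The cosets cover a compact space by disjoint nonempty open sets, so a finite subcover
  omits none of them.\<close>

lemma finite_rcosets_open:
  assumes U: "open_subgroup G T U"
  shows "finite (rcosets U)"
proof -
  note U' = subgroup_open[OF U]
  have op: "\<forall>z\<in>rcosets U. openin T z" using open_rcoset[OF U] by (auto simp: RCOSETS_def)
  have un: "\<Union> (rcosets U) = topspace T" using rcosets_part_G[OF U'] by (simp add: topspace_eq)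
  obtain \<F> where F: "finite \<F>" "\<F> \<subseteq> rcosets U" "\<Union>\<F> = topspace T"
    using mp[OF spec[OF compact[unfolded compact_space], of "rcosets U"] conjI[OF op un]] by (elim exE conjE)
  have "rcosets U \<subseteq> \<F>"
  proof
    fix z assume z: "z \<in> rcosets U"
    then obtain x where x: "x \<in> z" using subgroup.rcosets_non_empty[OF U' z] by blast
    then have "x \<in> \<Union>\<F>" using z F(3) un by blast
    then obtain z' where z': "z' \<in> \<F>" "x \<in> z'" by auto
    then have "z' = z" using rcos_disjoint[OF U'] z x F(2) by (auto simp: pairwise_def disjnt_def)
    then show "z \<in> \<F>" using z' by simp
  qed
  then show ?thesis using F(1) finite_subset by blast
qed

lemma index_pos: "open_subgroup G T U \<Longrightarrow> card (rcosets U) > 0"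
  using finite_rcosets_open subgroup.subgroup_in_rcosets[OF subgroup_open is_group]
  by (auto simp: card_gt_0_iff)

lemma conj_class_self: "open_subgroup G T U \<Longrightarrow> U \<in> conj_class G U"
  using conjugate_one[of U] subgroup.subset[OF subgroup_open] one_closed
  unfolding conj_class_def by fastforce

lemma conj_class_conjugate:
  assumes U: "open_subgroup G T U" and g: "g \<in> carrier G"
  shows "conj_class G (conjugate G g U) = conj_class G U"
proof -
  have Us: "U \<subseteq> carrier G" using subgroup.subset[OF subgroup_open[OF U]] .
  show ?thesis
  proof (intro Set.set_eqI iffI)
    fix A assume "A \<in> conj_class G (conjugate G g U)"
    then obtain h where "h \<in> carrier G" "A = conjugate G h (conjugate G g U)" by (auto simp: conj_class_def)
    then have "A = conjugate G (h \<otimes> g) U" "h \<otimes> g \<in> carrier G" using g Us by (auto simp: conjugate_conjugate)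
    then show "A \<in> conj_class G U" by (auto simp: conj_class_def)
  next
    fix A assume "A \<in> conj_class G U"
    then obtain h where "h \<in> carrier G" "A = conjugate G h U" by (auto simp: conj_class_def)
    then have "A = conjugate G (h \<otimes> inv g) (conjugate G g U)" "h \<otimes> inv g \<in> carrier G"
      using g Us by (auto simp: conjugate_conjugate m_assoc)
    then show "A \<in> conj_class G (conjugate G g U)" by (auto simp: conj_class_def)
  qed
qed

lemma class_rep_conj_class:
  assumes U: "open_subgroup G T U"
  obtains g where "g \<in> carrier G" "class_rep (conj_class G U) = conjugate G g U"
proof -
  have "class_rep (conj_class G U) \<in> conj_class G U"
    unfolding class_rep_def using conj_class_self[OF U] by (rule someI)
  then show ?thesis using that by (auto simp: conj_class_def)
qed

lemma
  assumes "D \<in> open_classes G T"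
  shows open_class_rep: "open_subgroup G T (class_rep D)"
    and conj_class_rep: "conj_class G (class_rep D) = D"
proof -
  obtain U where U: "open_subgroup G T U" "D = conj_class G U" using assms by (auto simp: open_classes_def)
  obtain g where "g \<in> carrier G" "class_rep D = conjugate G g U"
    using class_rep_conj_class[OF U(1)] U(2) by auto
  then show "open_subgroup G T (class_rep D)" "conj_class G (class_rep D) = D"
    using U open_subgroup_conjugate conj_class_conjugate by auto
qed

lemma conj_class_open: "open_subgroup G T U \<Longrightarrow> conj_class G U \<in> open_classes G T"
  by (auto simp: open_classes_def)

text \<open>\<open>class_rep\<close> may pick a proper conjugate of \<open>W\<close>, with the same
  count. Needed for classes given by a concrete subgroup such as \<open>adjoin U C\<close>.\<close>

lemma class_fixed_conj_class:
  assumes C: "C \<in> open_classes G T" and W: "open_subgroup G T W"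
  shows "class_fixed G (conj_class G W) C = card (fixed_cosets (class_rep C) W)"
proof -
  obtain g where "g \<in> carrier G" "class_rep (conj_class G W) = conjugate G g W"
    using class_rep_conj_class[OF W] by auto
  then show ?thesis
    using card_fixed_cosets_conjugate[OF subgroup_open[OF open_class_rep[OF C]] subgroup_open[OF W]]
    by (simp add: class_fixed_def num_fixed_eq)
qed

lemma class_index_conj_class:
  assumes C: "C \<in> open_classes G T" and W: "open_subgroup G T W"
  shows "class_index G C (conj_class G W) = card (rcosets W) div card (rcosets (class_rep C))"
proof -
  obtain g where "g \<in> carrier G" "class_rep (conj_class G W) = conjugate G g W"
    using class_rep_conj_class[OF W] by auto
  then show ?thesis
    using card_rcosets_conjugate[OF subgroup_open[OF W]] subgroup_conjugate subgroup_open[OF W]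
      subgroup_open[OF open_class_rep[OF C]]
    by (simp add: class_index_def subgroup_index_def card_lcosets_eq_rcosets)
qed

lemma finite_fixed:
  "open_subgroup G T V \<Longrightarrow> open_subgroup G T W \<Longrightarrow> finite (fixed_cosets V W)"
  by (intro finite_fixed_cosets finite_rcosets_open subgroup_open)

lemma fixed_cosets_nonempty_iff:
  assumes "open_subgroup G T V" "open_subgroup G T W"
  shows "fixed_cosets V W \<noteq> {} \<longleftrightarrow> (\<exists>x\<in>carrier G. W \<subseteq> conjugate G x V)"
  using fixed_cosets_eq[of V W] assms subgroup_open by auto

text \<open>The order on classes is the support of the table of marks. Conjugation invariance of the
  counts removes the dependence on representatives.\<close>

lemma class_le_conj_class:
  assumes V: "open_subgroup G T V" and W: "open_subgroup G T W"
  shows "class_le G T (conj_class G V) (conj_class G W) \<longleftrightarrow> fixed_cosets V W \<noteq> {}"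
proof
  assume "class_le G T (conj_class G V) (conj_class G W)"
  then obtain V' W' g where *: "open_subgroup G T V'" "open_subgroup G T W'"
    "conj_class G V = conj_class G V'" "conj_class G W = conj_class G W'" "g \<in> carrier G" "W' \<subseteq> conjugate G g V'"
    by (auto simp: class_le_def)
  obtain h k where hk: "h \<in> carrier G" "V' = conjugate G h V" "k \<in> carrier G" "W' = conjugate G k W"
  proof -
    have "V' \<in> conj_class G V" "W' \<in> conj_class G W"
      using conj_class_self[OF *(1)] conj_class_self[OF *(2)] by (simp_all only: *(3,4))
    then show ?thesis using that by (auto simp only: conj_class_def mem_Collect_eq)
  qed
  have "W' \<subseteq> conjugate G (g \<otimes> h) V"
    using * hk subgroup.subset[OF subgroup_open[OF V]] by (simp add: conjugate_conjugate)
  then have "fixed_cosets V W' \<noteq> {}"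
    using fixed_cosets_nonempty_iff[OF V *(2)] hk *(5) by blast
  then have "card (fixed_cosets V W') > 0" using finite_fixed[OF V *(2)] by (simp add: card_gt_0_iff)
  then show "fixed_cosets V W \<noteq> {}"
    using card_fixed_cosets_conjugate[OF subgroup_open[OF V] subgroup_open[OF W] hk(3)] hk(4) by auto
next
  assume "fixed_cosets V W \<noteq> {}"
  then show "class_le G T (conj_class G V) (conj_class G W)"
    using fixed_cosets_nonempty_iff[OF V W] V W unfolding class_le_def by blast
qed

lemma down_classes_conj_class:
  assumes W: "open_subgroup G T W"
  shows "down_classes G T (conj_class G W) = {C \<in> open_classes G T. fixed_cosets (class_rep C) W \<noteq> {}}"
  using class_le_conj_class[OF open_class_rep W] conj_class_rep unfolding down_classes_def by auto

lemma down_classes_eq: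
  "D \<in> open_classes G T \<Longrightarrow>
    down_classes G T D = {C \<in> open_classes G T. fixed_cosets (class_rep C) (class_rep D) \<noteq> {}}"
  using down_classes_conj_class[OF open_class_rep] conj_class_rep by simp

text \<open>A lower class has a member containing the representative of \<open>D\<close>, and that
  member is a union of finitely many available cosets.\<close>

lemma finite_down_classes:
  assumes D: "D \<in> open_classes G T"
  shows "finite (down_classes G T D)"
proof (rule finite_subset)
  let ?U = "class_rep D"
  note U = open_class_rep[OF D]
  show "down_classes G T D \<subseteq> conj_class G ` Union ` Pow (rcosets ?U)"
  proof
    fix C assume "C \<in> down_classes G T D"
    then have C: "C \<in> open_classes G T" "fixed_cosets (class_rep C) ?U \<noteq> {}"
      using down_classes_eq[OF D] by auto
    then obtain x where x: "x \<in> carrier G" "?U \<subseteq> conjugate G x (class_rep C)"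
      using fixed_cosets_nonempty_iff[OF open_class_rep U] by auto
    let ?V = "conjugate G x (class_rep C)"
    have V: "subgroup ?V G" using subgroup_conjugate[OF subgroup_open[OF open_class_rep[OF C(1)]] x(1)] .
    have "?V = \<Union> ((\<lambda>v. ?U #> v) ` ?V)"
      using rcos_self[OF _ subgroup_open[OF U]] subgroup.mem_carrier[OF V] subgroup.m_closed[OF V] x(2)
      by (auto simp: r_coset_def)
    moreover have "(\<lambda>v. ?U #> v) ` ?V \<in> Pow (rcosets ?U)"
      using subgroup.mem_carrier[OF V] by (auto simp: RCOSETS_def)
    ultimately have "?V \<in> Union ` Pow (rcosets ?U)" by (rule image_eqI)
    moreover have eq: "conj_class G ?V = C"
      using conj_class_conjugate[OF open_class_rep[OF C(1)] x(1)] conj_class_rep[OF C(1)] by simp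
    ultimately show "C \<in> conj_class G ` Union ` Pow (rcosets ?U)"
      by (metis imageI)
  qed
  show "finite (conj_class G ` Union ` Pow (rcosets ?U))"
    using finite_rcosets_open[OF U] by simp
qed

text \<open>The index in \<open>G\<close>. It strictly increases along the order and is the measure
  of all inductions over classes.\<close>

definition ind :: "'a set set \<Rightarrow> nat"
  where "ind D = card (rcosets (class_rep D))"

lemma ind_pos: "D \<in> open_classes G T \<Longrightarrow> ind D > 0"
  unfolding ind_def by (intro index_pos open_class_rep)

lemma class_index_eq:
  "C \<in> open_classes G T \<Longrightarrow> D \<in> open_classes G T \<Longrightarrow> class_index G C D = ind D div ind C"
  using class_index_conj_class[of C "class_rep D"] open_class_rep[of D] conj_class_rep[of D] by (simp add: ind_def)

lemma ind_down:
  assumes D: "D \<in> open_classes G T" and C: "C \<in> down_classes G T D"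
  shows "ind D = class_index G C D * ind C" "class_index G C D > 0"
proof -
  have CO: "C \<in> open_classes G T" and "fixed_cosets (class_rep C) (class_rep D) \<noteq> {}"
    using C unfolding down_classes_eq[OF D] by auto
  then obtain K where "K \<in> fixed_cosets (class_rep C) (class_rep D)" by auto
  then have "ind D = card {z \<in> rcosets (class_rep D). z \<subseteq> K} * ind C"
    unfolding ind_def
    by (intro card_blocks subgroup_open open_class_rep finite_rcosets_open CO D)
  then show "ind D = class_index G C D * ind C" "class_index G C D > 0"
    using class_index_eq[OF CO D] ind_pos[OF CO] ind_pos[OF D] by auto
qed

text \<open>With equal indices, the inclusion of the representative of \<open>D\<close> in a
  conjugate of that of \<open>C\<close> would be an equality.\<close>

lemma ind_less:
  assumes D: "D \<in> open_classes G T" and C: "C \<in> down_classes G T D" and "C \<noteq> D"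
  shows "ind C < ind D"
proof (rule ccontr)
  assume "\<not> ind C < ind D"
  moreover have "class_index G C D * ind C \<ge> 1 * ind C"
    using ind_down(2)[OF D C] by (intro mult_right_mono) auto
  ultimately have eq: "ind D = ind C" using ind_down[OF D C] by linarith
  have CO: "C \<in> open_classes G T" "fixed_cosets (class_rep C) (class_rep D) \<noteq> {}"
    using C unfolding down_classes_eq[OF D] by auto
  then obtain x where x: "x \<in> carrier G" "class_rep D \<subseteq> conjugate G x (class_rep C)"
    using fixed_cosets_nonempty_iff[OF open_class_rep open_class_rep] D by auto
  have "class_rep D = conjugate G x (class_rep C)"
    using x eq card_rcosets_conjugate[OF subgroup_open[OF open_class_rep[OF CO(1)]] x(1)]
    by (intro eq_of_card_rcosets_eq subgroup_open open_class_rep[OF D] finite_rcosets_open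
        open_subgroup_conjugate[OF open_class_rep[OF CO(1)] x(1)]) (auto simp: ind_def)
  then have "conj_class G (class_rep D) = conj_class G (conjugate G x (class_rep C))"
    by (rule arg_cong)
  also have "\<dots> = conj_class G (class_rep C)"
    by (rule conj_class_conjugate[OF open_class_rep[OF CO(1)] x(1)])
  finally have "D = C" unfolding conj_class_rep[OF D] conj_class_rep[OF CO(1)] .
  with \<open>C \<noteq> D\<close> show False by simp
qed

lemma down_classes_subset: "down_classes G T D \<subseteq> open_classes G T"
  by (auto simp: down_classes_def)

lemma down_classes_self: "D \<in> open_classes G T \<Longrightarrow> D \<in> down_classes G T D"
  using fixed_cosets_nonempty_iff[OF open_class_rep open_class_rep, of D D]
    conjugate_one[OF subgroup.subset[OF subgroup_open[OF open_class_rep[of D]]]]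
  by (auto simp: down_classes_eq intro!: bexI[of _ \<one>])

lemma down_classes_trans:
  assumes E: "E \<in> open_classes G T" and D: "D \<in> down_classes G T E" and C: "C \<in> down_classes G T D"
  shows "C \<in> down_classes G T E"
proof -
  have DO: "D \<in> open_classes G T" and CO: "C \<in> open_classes G T"
    using D C by (auto simp: down_classes_def)
  obtain x where x: "x \<in> carrier G" "class_rep E \<subseteq> conjugate G x (class_rep D)"
    using D fixed_cosets_nonempty_iff[OF open_class_rep[OF DO] open_class_rep[OF E]] down_classes_eq[OF E] by auto
  obtain y where y: "y \<in> carrier G" "class_rep D \<subseteq> conjugate G y (class_rep C)"
    using C fixed_cosets_nonempty_iff[OF open_class_rep[OF CO] open_class_rep[OF DO]] down_classes_eq[OF DO] by auto
  have "conjugate G x (class_rep D) \<subseteq> conjugate G x (conjugate G y (class_rep C))"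
    using y(2) by (auto simp: conjugate_def l_coset_def r_coset_def)
  then have "class_rep E \<subseteq> conjugate G (x \<otimes> y) (class_rep C)"
    using x y subgroup.subset[OF subgroup_open[OF open_class_rep[OF CO]]] by (simp add: conjugate_conjugate)
  then show ?thesis
    using x(1) y(1) CO fixed_cosets_nonempty_iff[OF open_class_rep[OF CO] open_class_rep[OF E]] down_classes_eq[OF E]
    by blast
qed

lemma down_classes_mono:
  "E \<in> open_classes G T \<Longrightarrow> D \<in> down_classes G T E \<Longrightarrow> down_classes G T D \<subseteq> down_classes G T E"
  using down_classes_trans by blast

lemma class_fixed_eq_0:
  assumes "C \<in> open_classes G T" "D \<in> open_classes G T" "C \<notin> down_classes G T D"
  shows "class_fixed G D C = 0"
  using assms class_fixed_conj_class[of C "class_rep D"] open_class_rep[of D] conj_class_rep[of D] down_classes_eq[of D]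
  by auto

lemma class_fixed_self:
  assumes D: "D \<in> open_classes G T"
  shows "class_fixed G D D = card (carrier (weyl_group (class_rep D)))"
  using class_fixed_conj_class[OF D open_class_rep[OF D]] conj_class_rep[OF D]
    card_weyl_group[OF subgroup_open finite_rcosets_open] open_class_rep[OF D] by simp

lemma class_fixed_self_pos:
  assumes D: "D \<in> open_classes G T"
  shows "class_fixed G D D > 0"
proof -
  note U = subgroup_open[OF open_class_rep[OF D]] finite_rcosets_open[OF open_class_rep[OF D]]
  interpret Q: group "weyl_group (class_rep D)" by (rule weyl_is_group[OF U])
  show ?thesis
    using Q.one_closed finite_weyl[OF U] by (auto simp: class_fixed_self[OF D] card_gt_0_iff)
qed

section \<open>The ghost map as a triangular system\<close>

section \<open>The ghost map\<close>

text \<open>One summand of \<open>Phi\<close>, read as a ghost vector in \<open>D\<close> for a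
  fixed class \<open>C\<close>. The congruences are proved for these vectors and their products,
  then summed.\<close>

definition theta :: "int \<Rightarrow> 'a set set \<Rightarrow> 'r::comm_ring_1 \<Rightarrow> 'a set set \<Rightarrow> 'r"
  where "theta q C M D = of_nat (class_fixed G D C) * of_int q ^ (class_index G C D - 1) * M ^ class_index G C D"

lemma Phi_eq: "D \<in> open_classes G T \<Longrightarrow> Phi G T q a D = (\<Sum>C\<in>down_classes G T D. theta q C (a C) D)"
  by (simp add: Phi_def theta_def)

text \<open>Terms outside the smaller down-set have no fixed points and vanish. So all components
  below \<open>E\<close> are sums over one index set.\<close>

lemma Phi_eq_superset:
  assumes E: "E \<in> open_classes G T" and D: "D \<in> down_classes G T E"
  shows "Phi G T q a D = (\<Sum>C\<in>down_classes G T E. theta q C (a C) D)"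
proof -
  have DO: "D \<in> open_classes G T" using D by (auto simp: down_classes_def)
  have "theta q C (a C) D = 0" if "C \<in> down_classes G T E - down_classes G T D" for C
    using class_fixed_eq_0[of C D] that DO by (auto simp: theta_def down_classes_def)
  then show ?thesis
    unfolding Phi_eq[OF DO]
    using finite_down_classes[OF E] down_classes_mono[OF E D] by (intro sum.mono_neutral_left) auto
qed

text \<open>The exponent (U:U) is 1 and the power of \<open>q\<close> is \<open>q ^ 0 = 1\<close>,
  also for \<open>q = 0\<close>; the diagonal is linear.\<close>

lemma theta_self:
  assumes "D \<in> open_classes G T"
  shows "theta q D M D = of_nat (class_fixed G D D) * M"
  using class_index_eq[OF assms assms] ind_pos[OF assms] by (simp add: theta_def)

lemma theta_zero: "D \<in> open_classes G T \<Longrightarrow> C \<in> down_classes G T D \<Longrightarrow> theta q C 0 D = 0"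
  using ind_down(2)[of D C] by (simp add: theta_def zero_power)

lemma Phi_split:
  assumes D: "D \<in> open_classes G T"
  shows "Phi G T q a D = of_nat (class_fixed G D D) * a D
    + (\<Sum>C\<in>down_classes G T D - {D}. theta q C (a C) D)"
  using sum.remove[OF finite_down_classes[OF D] down_classes_self[OF D], of "\<lambda>C. theta q C (a C) D"]
  by (simp add: Phi_eq[OF D] theta_self[OF D])

text \<open>The system is triangular along \<open>ind\<close> with nonzero diagonal. Equality is
  asked on classes only, so that it applies to functions that are not extensional.\<close>

lemma Phi_inject:
  fixes a b :: "'a set set \<Rightarrow> ('v, rat) mpoly"
  assumes eq: "\<And>D. D \<in> open_classes G T \<Longrightarrow> Phi G T q a D = Phi G T q b D"
    and D: "D \<in> open_classes G T"
  shows "a D = b D"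
  using D
proof (induction "ind D" arbitrary: D rule: less_induct)
  case less
  have "(\<Sum>C\<in>down_classes G T D - {D}. theta q C (a C) D) = (\<Sum>C\<in>down_classes G T D - {D}. theta q C (b C) D)"
  proof (rule sum.cong[OF refl])
    fix C assume "C \<in> down_classes G T D - {D}"
    then have "a C = b C"
      using less.hyps[OF ind_less[OF less.prems]] down_classes_subset by blast
    then show "theta q C (a C) D = theta q C (b C) D" by simp
  qed
  then have "of_nat (class_fixed G D D) * a D = of_nat (class_fixed G D D) * b D"
    using eq[OF less.prems] by (simp add: Phi_split[OF less.prems])
  then show ?case
    by (rule mpoly_cancel_of_nat) (use class_fixed_self_pos[OF less.prems] in simp)
qed

end

section \<open>Closure of the polynomial ring A, and bijectivity of the ghost map over it\<close>

section \<open>The ring of coefficients\<close>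

lemma ringA_zero: "0 \<in> ringA G T"
  and ringA_one: "1 \<in> ringA G T"
  and ringA_const: "mp_const c \<in> ringA G T"
  and ringA_of_int: "of_int n \<in> ringA G T"
  by (simp_all add: ringA_def)

lemma ringA_of_nat: "of_nat n \<in> ringA G T"
  using ringA_of_int[of "int n"] by simp

lemma ringA_add: "p \<in> ringA G T \<Longrightarrow> r \<in> ringA G T \<Longrightarrow> p + r \<in> ringA G T"
  using mp_vars_add[of p r] by (auto simp: ringA_def)

lemma ringA_mult: "p \<in> ringA G T \<Longrightarrow> r \<in> ringA G T \<Longrightarrow> p * r \<in> ringA G T"
  using mp_vars_mult[of p r] by (auto simp: ringA_def)

lemma ringA_uminus: "p \<in> ringA G T \<Longrightarrow> - p \<in> ringA G T"
  using ringA_mult[OF ringA_of_int[of "- 1"], of p] by simp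

lemma ringA_diff: "p \<in> ringA G T \<Longrightarrow> r \<in> ringA G T \<Longrightarrow> p - r \<in> ringA G T"
  using ringA_add[of p G T "- r"] by (simp add: ringA_uminus)

lemma ringA_power: "p \<in> ringA G T \<Longrightarrow> p ^ n \<in> ringA G T"
  by (induction n) (auto simp: ringA_one ringA_mult)

lemma ringA_sum: "(\<And>i. i \<in> I \<Longrightarrow> p i \<in> ringA G T) \<Longrightarrow> (\<Sum>i\<in>I. p i) \<in> ringA G T"
  by (induction I rule: infinite_finite_induct) (auto simp: ringA_zero ringA_add)

lemma int_poly_exprs_ringA: "a \<in> int_poly_exprs S \<Longrightarrow> S \<subseteq> ringA G T \<Longrightarrow> a \<in> ringA G T"
  by (induction a rule: int_poly_exprs_induct) (auto simp: ringA_of_int ringA_add ringA_mult)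

context profinite_group
begin

lemma theta_ringA: "M \<in> ringA G T \<Longrightarrow> theta q C M D \<in> ringA G T"
  unfolding theta_def by (intro ringA_mult ringA_of_nat ringA_power ringA_of_int)

lemma Phi_surj:
  assumes b: "b \<in> vecA G T"
  shows "\<exists>a\<in>vecA G T. Phi G T q a = b"
proof -
  let ?O = "open_classes G T"
  define F where "F a D = mp_const (1 / of_nat (class_fixed G D D)) *
    (b D - (\<Sum>C\<in>down_classes G T D - {D}. theta q C (a C) D))" for a D
  \<comment> \<open>The triangular system is solved along \<open>ind\<close>: \<open>F a D\<close>
    consults \<open>a\<close> only strictly below \<open>D\<close>, so the cut in the recursion
    equation changes nothing.\<close>
  define a where "a = wfrec (Wellfounded.measure ind) F"
  have aF: "a D = F a D" if D: "D \<in> ?O" for D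
  proof -
    have "a D = F (cut a (Wellfounded.measure ind) D) D"
      unfolding a_def by (rule wfrec) simp
    also have "\<dots> = F a D"
      unfolding F_def using ind_less[OF D] by (auto intro!: sum.cong simp: cut_apply)
    finally show ?thesis .
  qed
  have Phi_a: "Phi G T q a D = b D" if D: "D \<in> ?O" for D
  proof -
    have "(of_nat (class_fixed G D D) :: ('a set set indet, rat) mpoly)
        * mp_const (1 / of_nat (class_fixed G D D)) = 1"
      using class_fixed_self_pos[OF D] by (simp add: of_nat_eq_mp_const flip: mp_const_hom.h_mult mp_const_hom.h_one)
    then have "of_nat (class_fixed G D D) * a D = b D - (\<Sum>C\<in>down_classes G T D - {D}. theta q C (a C) D)"
      unfolding aF[OF D] F_def by (simp flip: mult.assoc)
    then show ?thesis by (simp add: Phi_split[OF D])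
  qed
  have aA: "a D \<in> ringA G T" if "D \<in> ?O" for D
    using that
  proof (induction "ind D" arbitrary: D rule: less_induct)
    case less
    then have "a C \<in> ringA G T" if "C \<in> down_classes G T D - {D}" for C
      using that ind_less[OF less.prems] down_classes_subset by blast
    moreover have "b D \<in> ringA G T" using b less.prems by (auto simp: vecA_def)
    ultimately show ?case
      unfolding aF[OF less.prems] F_def
      by (intro ringA_mult ringA_const ringA_diff ringA_sum theta_ringA)
  qed
  \<comment> \<open>\<open>vecA\<close> consists of extensional functions; restricting
    \<open>a\<close> leaves its ghost components unchanged.\<close>
  have Phi_cong: "Phi G T q (restrict a ?O) = Phi G T q a"
    unfolding Phi_def using down_classes_subset by (intro restrict_ext sum.cong) auto
  show ?thesis
  proof
    show "restrict a ?O \<in> vecA G T" using aA by (auto simp: vecA_def)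
    show "Phi G T q (restrict a ?O) = b"
      unfolding Phi_cong
    proof
      fix D show "Phi G T q a D = b D"
        using Phi_a b by (cases "D \<in> ?O") (auto simp: Phi_def vecA_def PiE_def extensional_def)
    qed
  qed
qed

lemma Phi_vecA: "a \<in> vecA G T \<Longrightarrow> Phi G T q a \<in> vecA G T"
  unfolding vecA_def
proof (rule PiE_I)
  fix D assume a: "a \<in> open_classes G T \<rightarrow>\<^sub>E ringA G T" and D: "D \<in> open_classes G T"
  then show "Phi G T q a D \<in> ringA G T"
    using down_classes_subset[of D] by (auto simp: Phi_eq intro!: ringA_sum theta_ringA)
qed (simp add: Phi_def)

lemma bij_betw_Phi: "bij_betw (Phi G T q) (vecA G T) (vecA G T)"
  unfolding bij_betw_def
proof
  show "inj_on (Phi G T q) (vecA G T)"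
  proof (rule inj_onI)
    fix a b assume ab: "a \<in> vecA G T" "b \<in> vecA G T" "Phi G T q a = Phi G T q b"
    show "a = b"
      using ab Phi_inject[of q a b] unfolding vecA_def by (intro PiE_ext[of a _ _ b]) auto
  qed
  show "Phi G T q ` vecA G T = vecA G T"
  proof
    show "Phi G T q ` vecA G T \<subseteq> vecA G T" using Phi_vecA[of _ q] by (rule image_subsetI)
    show "vecA G T \<subseteq> Phi G T q ` vecA G T"
    proof
      fix b assume "b \<in> vecA G T"
      from Phi_surj[OF this, of q] obtain a where "a \<in> vecA G T" "Phi G T q a = b" by (elim bexE)
      then show "b \<in> Phi G T q ` vecA G T" by (intro image_eqI[of b _ a]) simp_all
    qed
  qed
qed

lemma Phi_Phi_inv: "b \<in> vecA G T \<Longrightarrow> Phi G T q (Phi_inv G T q b) = b"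
  unfolding Phi_inv_def by (rule bij_betw_inv_into_right[OF bij_betw_Phi])

end

section \<open>Congruences for ghost vectors, and integrality as their consequence\<close>

section \<open>Dwork congruences\<close>

context profinite_group
begin

text \<open>The factor \<open>q\<^sup>2\<close> turns \<open>q\<close>-deformed terms, and products of two of them, into undeformed
  ones. It loses the primes dividing \<open>q\<close>, for which the first congruence makes up.\<close>

definition ghost_cong :: "int \<Rightarrow> 'v set \<Rightarrow> ('a set set \<Rightarrow> ('v, rat) mpoly) \<Rightarrow> 'a set set \<Rightarrow> bool"
  where "ghost_cong q W b D \<longleftrightarrow> (let U = class_rep D; Q = weyl_group U; n = card (carrier Q) in
    b D \<in> int_poly_exprs (mp_var ` W) \<and>
    (\<exists>r. coprime r q \<and> cong_in (mp_var ` W) n (of_int r * b D) 0) \<and>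
    cong_in (mp_var ` W) n (\<Sum>C\<in>carrier Q.
      adams (card (generate Q {C})) (of_int (q\<^sup>2) * b (conj_class G (adjoin U C)))) 0)"

context
  fixes D U Q n and q :: int
  assumes D: "D \<in> open_classes G T"
  defines "U \<equiv> class_rep D" and "Q \<equiv> weyl_group U" and "n \<equiv> card (carrier Q)"
begin

lemma rep_U: "open_subgroup G T U" "subgroup U G" "finite (rcosets U)"
  using open_class_rep[OF D] subgroup_open finite_rcosets_open by (auto simp: U_def)

lemma n_pos: "n > 0"
  using class_fixed_self_pos[OF D] class_fixed_self[OF D] by (simp add: n_def Q_def U_def)

lemma open_adjoin: "C \<in> carrier Q \<Longrightarrow> open_subgroup G T (adjoin U C)"
  using open_subgroup_superset[OF rep_U(1) subgroup_adjoin[OF rep_U(2,3)] subset_adjoin[OF rep_U(2,3)]]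
  by (simp add: Q_def)

lemma adjoin_down: 
  assumes C: "C \<in> carrier Q"
  shows "conj_class G (adjoin U C) \<in> down_classes G T D"
proof -
  let ?W = "adjoin U C"
  have "class_le G T (conj_class G ?W) (conj_class G U)"
    using class_le_conj_class[OF open_adjoin[OF C] rep_U(1)] fixed_cosets_nonempty_iff[OF open_adjoin[OF C] rep_U(1)]
      subset_adjoin[OF rep_U(2,3), of C] C conjugate_one[OF subgroup.subset[OF subgroup_open[OF open_adjoin[OF C]]]]
    by (auto simp: Q_def intro!: bexI[of _ \<one>])
  then show ?thesis
    using conj_class_open[OF open_adjoin[OF C]] conj_class_rep[OF D] by (simp add: down_classes_def U_def)
qed

lemma adjoin_unit: "conj_class G (adjoin U U) = D"
  using adjoin_one[OF rep_U(2,3)] conj_class_rep[OF D] by (simp add: U_def)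

lemma unit_in_weyl: "U \<in> carrier Q"
  using monoid.one_closed[OF group.is_monoid[OF weyl_is_group[OF rep_U(2,3)]]]
  by (simp add: Q_def weyl_one[OF rep_U(2,3)])

lemma ind_adjoin:
  assumes C: "C \<in> carrier Q"
  shows "ind D = card (generate Q {C}) * card (rcosets (adjoin U C))"
  using card_rcosets_adjoin[OF rep_U(2,3)] C by (simp add: ind_def Q_def U_def)

text \<open>The index of \<open>adjoin U C\<close> is strictly smaller than \<open>ind D\<close>.
  Hence the term of \<open>D\<close> itself vanishes at all components except the one of the unit
  coset.\<close>

lemma adjoin_not_down:
  assumes C: "C \<in> carrier Q" "C \<noteq> U"
  shows "D \<notin> down_classes G T (conj_class G (adjoin U C))"
proof
  let ?E = "conj_class G (adjoin U C)"
  note E = conj_class_open[OF open_adjoin[OF C(1)]]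
  assume down: "D \<in> down_classes G T ?E"
  have "1 * ind D \<le> class_index G D ?E * ind D"
    using ind_down(2)[OF E down] by (intro mult_right_mono) simp_all
  then have "ind D \<le> ind ?E" using ind_down(1)[OF E down] by simp
  moreover have "ind ?E = card (rcosets (adjoin U C))"
  proof -
    obtain g where "g \<in> carrier G" "class_rep ?E = conjugate G g (adjoin U C)"
      using class_rep_conj_class[OF open_adjoin[OF C(1)]] by auto
    then show ?thesis
      using card_rcosets_conjugate[OF subgroup_open[OF open_adjoin[OF C(1)]]] by (simp add: ind_def)
  qed
  moreover have "1 * card (rcosets (adjoin U C)) < ind D"
    unfolding ind_adjoin[OF C(1)]
    using card_generate_gt_1[OF rep_U(2,3)] C index_pos[OF open_adjoin[OF C(1)]]
    by (intro mult_strict_right_mono) (auto simp: Q_def)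
  ultimately show False by simp
qed

context
  fixes V K e
  assumes K: "K \<in> open_classes G T"
  defines "V \<equiv> class_rep K" and "e \<equiv> card (rcosets U) div card (rcosets V)"
begin

lemma rep_V: "open_subgroup G T V" "subgroup V G"
  using open_class_rep[OF K] subgroup_open by (auto simp: V_def)

lemma block_action_rep: "block_action Q (rcosets U) (\<lambda>C z. C <#> z) (fixed_cosets V U) (\<lambda>C K. C <#> K)
    (\<lambda>K. {z \<in> rcosets U. z \<subseteq> K}) e"
  unfolding Q_def e_def by (rule weyl_block_action[OF rep_U(2,3) rep_V(2)])

text \<open>The extra \<open>q\<close> completes \<open>q ^ (k - 1) * M ^ k\<close> to
  \<open>(q * M) ^ k\<close>, with \<open>k\<close> the order of \<open>C\<close> divided into
  \<open>e\<close>.\<close>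

lemma theta_adjoin:
  assumes C: "C \<in> carrier Q"
  shows "of_int q * theta q K M (conj_class G (adjoin U C))
    = of_nat (card {L \<in> fixed_cosets V U. C <#> L = L}) * (of_int q * M) ^ (e div card (generate Q {C}))"
proof -
  let ?W = "adjoin U C" and ?o = "card (generate Q {C})"
  interpret B: block_action Q "rcosets U" "\<lambda>C z. C <#> z" "fixed_cosets V U" "\<lambda>C K. C <#> K"
    "\<lambda>K. {z \<in> rcosets U. z \<subseteq> K}" e
    by (rule block_action_rep)
  have fixed: "fixed_cosets V ?W = {L \<in> fixed_cosets V U. C <#> L = L}"
    using fixed_cosets_adjoin[OF rep_U(2,3) _ rep_V(2)] C by (simp add: Q_def)
  have cf: "class_fixed G (conj_class G ?W) K = card {L \<in> fixed_cosets V U. C <#> L = L}"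
    using class_fixed_conj_class[OF K open_adjoin[OF C]] fixed by (simp add: V_def)
  show ?thesis
  \<comment> \<open>Without fixed cosets both sides are 0. Otherwise the order of \<open>C\<close>
    divides \<open>e\<close> and the exponent is positive, so the predecessor in the power of
    \<open>q\<close> is genuine.\<close>
  proof (cases "{L \<in> fixed_cosets V U. C <#> L = L} = {}")
    case True
    then have c0: "card {L \<in> fixed_cosets V U. C <#> L = L} = 0" by (simp only: card.empty)
    show ?thesis unfolding theta_def cf c0 by simp
  next
    case False
    then obtain L where L: "L \<in> fixed_cosets V U" "C <#> L = L" by auto
    have o: "?o dvd e" by (rule B.fixed_block_dvd[OF C L])
    have "card (rcosets U) = e * card (rcosets V)"
      using card_blocks[OF rep_V(2) rep_U(2,3) L(1)] B.card_block[OF L(1)] by simp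
    moreover have UW: "card (rcosets U) = ?o * card (rcosets ?W)"
      using card_rcosets_adjoin[OF rep_U(2,3)] C by (simp add: Q_def)
    moreover have "card (rcosets U) > 0" using index_pos[OF rep_U(1)] .
    ultimately have pos: "?o > 0" "e > 0" "card (rcosets V) > 0" by (auto intro: Nat.gr0I)
    have "card (rcosets ?W) = (e div ?o) * card (rcosets V)"
    proof -
      have "?o * card (rcosets ?W) = ?o * ((e div ?o) * card (rcosets V))"
        using o UW \<open>card (rcosets U) = e * card (rcosets V)\<close> by (simp flip: mult.assoc)
      then show ?thesis using pos by simp
    qed
    then have ci: "class_index G K (conj_class G ?W) = e div ?o"
      using class_index_conj_class[OF K open_adjoin[OF C]] pos by (simp add: V_def)
    have "e div ?o > 0" using o pos by (auto elim!: dvdE)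
    then obtain m where "e div ?o = Suc m" using gr0_implies_Suc by blast
    then show ?thesis
      by (simp add: theta_def cf ci power_mult_distrib mult_ac)
  qed
qed

text \<open>\<open>adams\<close> commutes with powers, and modulo \<open>n\<close> it turns
  \<open>q * M\<close> into a sum of powers \<open>m j ^ o\<close>, where \<open>o\<close> is the
  order of \<open>C\<close>. The power \<open>e div o\<close> of this sum is the weight of the
  invariant colourings of a block.\<close>

lemma theta_colour_char:
  fixes W :: "'v set"
  assumes M: "M \<in> int_poly_exprs (mp_var ` W)"
  shows "\<exists>(m :: nat \<Rightarrow> ('v, rat) mpoly) J. finite J \<and> (\<forall>j\<in>J. m j \<in> int_poly_exprs (mp_var ` W)) \<and>
    (\<forall>C\<in>carrier Q. cong_in (mp_var ` W) n
      (adams (card (generate Q {C})) (of_int q * theta q K M (conj_class G (adjoin U C))))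
      (colour_char Q (fixed_cosets V U) (\<lambda>C K. C <#> K) e m J C))"
proof -
  let ?S = "mp_var ` W :: ('v, rat) mpoly set"
  have qM: "of_int q * M \<in> int_poly_exprs ?S" using M by auto
  obtain ms where ms: "set ms \<subseteq> int_poly_exprs ?S"
    "\<And>d. cong_in ?S n (adams d (of_int q * M)) (\<Sum>m\<leftarrow>ms. m ^ d)"
    using adams_power_sums[OF qM n_pos] by blast
  show ?thesis
  proof (intro exI conjI ballI)
    \<comment> \<open>The colours are positions in the list \<open>ms\<close>, since entries may
      repeat.\<close>
    show "finite {..<length ms}" by simp
    show R: "ms ! j \<in> int_poly_exprs ?S" if "j \<in> {..<length ms}" for j
      using that ms(1) by auto
    fix C assume C: "C \<in> carrier Q"
    let ?o = "card (generate Q {C})"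
    have "(\<Sum>m\<leftarrow>ms. m ^ ?o) = (\<Sum>j<length ms. (ms ! j) ^ ?o)"
      by (simp add: sum_list_sum_nth atLeast0LessThan)
    with ms(2)[of ?o] have c: "cong_in ?S n (adams ?o (of_int q * M)) (\<Sum>j<length ms. (ms ! j) ^ ?o)"
      by simp
    have "(\<Sum>j<length ms. (ms ! j) ^ ?o) \<in> int_poly_exprs ?S"
      using R by (intro int_poly_exprs_sum int_poly_exprs_power) auto
    then have "cong_in ?S n
      (of_nat (card {L \<in> fixed_cosets V U. C <#> L = L}) * adams ?o (of_int q * M) ^ (e div ?o))
      (of_nat (card {L \<in> fixed_cosets V U. C <#> L = L}) * (\<Sum>j<length ms. (ms ! j) ^ ?o) ^ (e div ?o))"
      using c by (intro cong_in_mult cong_in_power cong_in_refl int_poly_exprs_of_nat int_poly_exprs_power)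
    then show "cong_in ?S n (adams ?o (of_int q * theta q K M (conj_class G (adjoin U C))))
        (colour_char Q (fixed_cosets V U) (\<lambda>C K. C <#> K) e ((!) ms) {..<length ms} C)"
      unfolding theta_adjoin[OF C] colour_char_def by (simp only: adams_hom)
  qed
qed

text \<open>\<open>n\<close> divides \<open>e\<close> times the number of fixed cosets, and
  \<open>e\<close> divides \<open>r * q ^ (e - 1)\<close>. The same \<open>r\<close> serves all
  \<open>W\<close> and \<open>M\<close>.\<close>

lemma theta_coprime_multiple:
  shows "\<exists>r. coprime r q \<and> (\<forall>W M. M \<in> int_poly_exprs (mp_var ` W) \<longrightarrow>
    cong_in (mp_var ` W :: ('v, rat) mpoly set) n (of_int r * theta q K M D) 0)"
proof -
  interpret B: block_action Q "rcosets U" "\<lambda>C z. C <#> z" "fixed_cosets V U" "\<lambda>C K. C <#> K"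
    "\<lambda>K. {z \<in> rcosets U. z \<subseteq> K}" e
    by (rule block_action_rep)
  have cf: "class_fixed G D K = card (fixed_cosets V U)"
    using class_fixed_conj_class[OF K rep_U(1)] conj_class_rep[OF D] by (simp add: U_def V_def)
  have ci: "class_index G K D = e"
    using class_index_conj_class[OF K rep_U(1)] conj_class_rep[OF D] by (simp add: U_def V_def e_def)
  show ?thesis
  proof (cases "e = 0 \<or> card (fixed_cosets V U) = 0")
    \<comment> \<open>A zero \<open>e\<close> would contradict the existence of a fixed coset, so
      the coefficient of the term vanishes in either case.\<close>
    case True
    have "card (fixed_cosets V U) = 0"
    proof (rule ccontr)
      assume "card (fixed_cosets V U) \<noteq> 0"
      then obtain L where L: "L \<in> fixed_cosets V U" by (metis card.empty all_not_in_conv)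
      then show False
        using True \<open>card (fixed_cosets V U) \<noteq> 0\<close> card_blocks[OF rep_V(2) rep_U(2,3) L] B.card_block[OF L] index_pos[OF rep_U(1)]
        by auto
    qed
    then show ?thesis by (intro exI[of _ 1]) (simp add: theta_def cf)
  next
    case False
    then obtain r where r: "coprime r q" "int e dvd r * q ^ (e - 1)"
      using coprime_factor_power_dvd[of e q] by auto
    have "int n dvd int e * int (card (fixed_cosets V U))"
      using B.card_dvd_block_points by (simp add: n_def flip: of_nat_mult)
    also have "\<dots> dvd (r * q ^ (e - 1)) * int (card (fixed_cosets V U))"
      using r(2) by (rule mult_dvd_mono) simp
    finally obtain k where k: "r * q ^ (e - 1) * int (card (fixed_cosets V U)) = int n * k" by (elim dvdE)
    have "of_int r * theta q K M D = of_nat n * (of_int k * M ^ e)" for M :: "('v, rat) mpoly"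
    proof -
      have "of_int r * theta q K M D = of_int (r * q ^ (e - 1) * int (card (fixed_cosets V U))) * M ^ e"
        by (simp add: theta_def cf ci mult_ac)
      also have "\<dots> = of_int (int n * k) * M ^ e" by (simp only: k)
      finally show ?thesis by (simp add: mult_ac)
    qed
    then show ?thesis
      using r(1) by (intro exI[of _ r]) (auto simp: cong_in_def)
  qed
qed

end

lemma ghost_cong_alt:
  "ghost_cong q W b D \<longleftrightarrow> b D \<in> int_poly_exprs (mp_var ` W) \<and>
    (\<exists>r. coprime r q \<and> cong_in (mp_var ` W) n (of_int r * b D) 0) \<and>
    cong_in (mp_var ` W) n (\<Sum>C\<in>carrier Q.
      adams (card (generate Q {C})) (of_int (q\<^sup>2) * b (conj_class G (adjoin U C)))) 0"
  by (simp add: ghost_cong_def Let_def n_def Q_def U_def)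

lemma theta_int_poly_exprs: "M \<in> int_poly_exprs S \<Longrightarrow> theta q K M E \<in> int_poly_exprs S"
  unfolding theta_def by (intro int_poly_exprs_mult int_poly_exprs_power int_poly_exprs_of_nat int_poly_exprs_of_int)

lemma cong_in_0_mult:
  assumes "cong_in S m a 0" "x \<in> int_poly_exprs S"
  shows "cong_in S m (x * a) 0"
  using cong_in_mult[OF cong_in_refl[of S m x] assms(1) assms(2)] by simp

lemma ghost_cong_theta:
  fixes W :: "'v set"
  assumes K: "K \<in> open_classes G T" and M: "M \<in> int_poly_exprs (mp_var ` W)"
  shows "ghost_cong q W (theta q K M) D"
  unfolding ghost_cong_alt
proof (intro conjI)
  let ?S = "mp_var ` W :: ('v, rat) mpoly set"
  show "theta q K M D \<in> int_poly_exprs ?S" by (rule theta_int_poly_exprs[OF M])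
  show "\<exists>r. coprime r q \<and> cong_in ?S n (of_int r * theta q K M D) 0"
    using theta_coprime_multiple[OF K] M by blast
  obtain m :: "nat \<Rightarrow> ('v, rat) mpoly" and J where J: "finite J" "\<And>j. j \<in> J \<Longrightarrow> m j \<in> int_poly_exprs ?S"
    and c: "\<And>C. C \<in> carrier Q \<Longrightarrow> cong_in ?S n
      (adams (card (generate Q {C})) (of_int q * theta q K M (conj_class G (adjoin U C))))
      (colour_char Q (fixed_cosets (class_rep K) U) (\<lambda>C K. C <#> K) (card (rcosets U) div card (rcosets (class_rep K))) m J C)"
    using theta_colour_char[OF K M] by metis
  let ?c = "\<lambda>C. adams (card (generate Q {C})) (of_int q * theta q K M (conj_class G (adjoin U C)))"
  have "cong_in ?S n (\<Sum>C\<in>carrier Q. ?c C) 0"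
    by (rule cong_in_trans[OF cong_in_sum[OF c] colour_char_sum[OF block_action_rep[OF K] J, folded n_def]])
  \<comment> \<open>A single term is settled with one factor \<open>q\<close>; the second matches
    the normalisation needed for products.\<close>
  then have "cong_in ?S n (of_int q * (\<Sum>C\<in>carrier Q. ?c C)) 0"
    by (rule cong_in_0_mult) auto
  also have "of_int q * (\<Sum>C\<in>carrier Q. ?c C)
      = (\<Sum>C\<in>carrier Q. adams (card (generate Q {C})) (of_int (q\<^sup>2) * theta q K M (conj_class G (adjoin U C))))"
    by (simp add: sum_distrib_left adams_hom power2_eq_square mult.assoc)
  finally show "cong_in ?S n \<dots> 0" .
qed

text \<open>Each factor absorbs one \<open>q\<close>, and the two characters of \<open>Q\<close>
  multiply. For the coprime multiple, divisibility of the first factor suffices, since the second is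
  integral.\<close>

lemma ghost_cong_theta_mult:
  fixes W :: "'v set"
  assumes K: "K \<in> open_classes G T" and M: "M \<in> int_poly_exprs (mp_var ` W)"
    and K': "K' \<in> open_classes G T" and M': "M' \<in> int_poly_exprs (mp_var ` W)"
  shows "ghost_cong q W (\<lambda>E. theta q K M E * theta q K' M' E) D"
  unfolding ghost_cong_alt
proof (intro conjI)
  let ?S = "mp_var ` W :: ('v, rat) mpoly set"
  show "theta q K M D * theta q K' M' D \<in> int_poly_exprs ?S"
    by (intro int_poly_exprs_mult theta_int_poly_exprs M M')
  obtain r where r: "coprime r q" "cong_in ?S n (of_int r * theta q K M D) 0"
    using theta_coprime_multiple[OF K] M by blast
  have "cong_in ?S n (theta q K' M' D * (of_int r * theta q K M D)) 0"
    by (rule cong_in_0_mult[OF r(2) theta_int_poly_exprs[OF M']])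
  then show "\<exists>r. coprime r q \<and> cong_in ?S n (of_int r * (theta q K M D * theta q K' M' D)) 0"
    using r(1) by (intro exI[of _ r]) (simp add: mult_ac)
  obtain m :: "nat \<Rightarrow> ('v, rat) mpoly" and J where J: "finite J" "\<And>j. j \<in> J \<Longrightarrow> m j \<in> int_poly_exprs ?S"
    and c: "\<And>C. C \<in> carrier Q \<Longrightarrow> cong_in ?S n
      (adams (card (generate Q {C})) (of_int q * theta q K M (conj_class G (adjoin U C))))
      (colour_char Q (fixed_cosets (class_rep K) U) (\<lambda>C K. C <#> K) (card (rcosets U) div card (rcosets (class_rep K))) m J C)"
    using theta_colour_char[OF K M] by metis
  obtain m' :: "nat \<Rightarrow> ('v, rat) mpoly" and J' where J': "finite J'" "\<And>j. j \<in> J' \<Longrightarrow> m' j \<in> int_poly_exprs ?S"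
    and c': "\<And>C. C \<in> carrier Q \<Longrightarrow> cong_in ?S n
      (adams (card (generate Q {C})) (of_int q * theta q K' M' (conj_class G (adjoin U C))))
      (colour_char Q (fixed_cosets (class_rep K') U) (\<lambda>C K. C <#> K) (card (rcosets U) div card (rcosets (class_rep K'))) m' J' C)"
    using theta_colour_char[OF K' M'] by metis
  have cc: "colour_char Q X act e f I C \<in> int_poly_exprs ?S"
    if "\<And>j. j \<in> I \<Longrightarrow> f j \<in> int_poly_exprs ?S" for X act e I C and f :: "nat \<Rightarrow> ('v, rat) mpoly"
    unfolding colour_char_def
    using that by (intro int_poly_exprs_mult int_poly_exprs_power int_poly_exprs_sum int_poly_exprs_of_nat) auto
  have "cong_in ?S n (\<Sum>C\<in>carrier Q.
      adams (card (generate Q {C})) (of_int q * theta q K M (conj_class G (adjoin U C))) *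
      adams (card (generate Q {C})) (of_int q * theta q K' M' (conj_class G (adjoin U C)))) 0"
    by (rule cong_in_trans[OF cong_in_sum[OF cong_in_mult[OF c c' cc[OF J(2)] cc[OF J'(2)]]]
        colour_char_mult_sum[OF block_action_rep[OF K] block_action_rep[OF K'] J(1) J'(1) J(2) J'(2), folded n_def]])
  also have "(\<Sum>C\<in>carrier Q.
      adams (card (generate Q {C})) (of_int q * theta q K M (conj_class G (adjoin U C))) *
      adams (card (generate Q {C})) (of_int q * theta q K' M' (conj_class G (adjoin U C))))
    = (\<Sum>C\<in>carrier Q. adams (card (generate Q {C})) (of_int (q\<^sup>2) *
      (theta q K M (conj_class G (adjoin U C)) * theta q K' M' (conj_class G (adjoin U C)))))"
    by (simp add: adams_hom power2_eq_square mult_ac)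
  finally show "cong_in ?S n \<dots> 0" .
qed

text \<open>The product of the two multipliers is again coprime to \<open>q\<close> and works for
  both summands.\<close>

lemma ghost_cong_add:
  fixes W :: "'v set"
  assumes "ghost_cong q W b D" "ghost_cong q W b' D"
  shows "ghost_cong q W (\<lambda>E. b E + b' E) D"
proof -
  let ?S = "mp_var ` W :: ('v, rat) mpoly set"
  obtain r r' where r: "coprime r q" "cong_in ?S n (of_int r * b D) 0"
      "coprime r' q" "cong_in ?S n (of_int r' * b' D) 0"
    using assms unfolding ghost_cong_alt by blast
  have "cong_in ?S n (of_int r' * (of_int r * b D) + of_int r * (of_int r' * b' D)) (0 + 0)"
    by (intro cong_in_add cong_in_0_mult r int_poly_exprs_of_int)
  then have "cong_in ?S n (of_int (r * r') * (b D + b' D)) 0"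
    by (simp add: algebra_simps)
  moreover have "coprime (r * r') q" using r by simp
  moreover have "cong_in ?S n ((\<Sum>C\<in>carrier Q. adams (card (generate Q {C})) (of_int (q\<^sup>2) * b (conj_class G (adjoin U C))))
    + (\<Sum>C\<in>carrier Q. adams (card (generate Q {C})) (of_int (q\<^sup>2) * b' (conj_class G (adjoin U C))))) (0 + 0)"
    using assms unfolding ghost_cong_alt by (intro cong_in_add) auto
  moreover have "b D + b' D \<in> int_poly_exprs ?S"
    using assms unfolding ghost_cong_alt by (intro int_poly_exprs_add) auto
  ultimately show ?thesis
    unfolding ghost_cong_alt by (intro conjI exI[of _ "r * r'"]) (simp_all add: adams_hom distrib_left sum.distrib)
qed

lemma ghost_cong_zero: "ghost_cong q W (\<lambda>E. 0) D"
  unfolding ghost_cong_alt by (intro conjI exI[of _ 1]) (simp_all add: adams_hom)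

lemma ghost_cong_uminus:
  fixes W :: "'v set"
  assumes "ghost_cong q W b D"
  shows "ghost_cong q W (\<lambda>E. - b E) D"
proof -
  let ?S = "mp_var ` W :: ('v, rat) mpoly set"
  obtain r where r: "coprime r q" "cong_in ?S n (of_int r * b D) 0"
    using assms unfolding ghost_cong_alt by blast
  have neg: "cong_in ?S n (- x) 0" if "cong_in ?S n x 0" for x
    using cong_in_0_mult[OF that, of "- 1"] int_poly_exprs_of_int[of "- 1" ?S] by simp
  show ?thesis
    using assms r neg unfolding ghost_cong_alt
    by (auto simp: adams_hom sum_negf)
qed

lemma ghost_cong_sum:
  "(\<And>i. i \<in> I \<Longrightarrow> ghost_cong q W (b i) D) \<Longrightarrow> ghost_cong q W (\<lambda>E. \<Sum>i\<in>I. b i E) D"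
  by (induction I rule: infinite_finite_induct) (auto simp: ghost_cong_zero ghost_cong_add)

text \<open>Only the components at \<open>D\<close> and at the classes of \<open>adjoin U C\<close>
  enter, all of them below \<open>D\<close>.\<close>

lemma ghost_cong_cong:
  assumes "\<And>E. E \<in> down_classes G T D \<Longrightarrow> b E = b' E"
  shows "ghost_cong q W b D \<longleftrightarrow> ghost_cong q W b' D"
  unfolding ghost_cong_alt
  using assms[OF down_classes_self[OF D]] assms[OF adjoin_down] by (simp cong: sum.cong)

lemma ghost_cong_Phi:
  assumes "\<And>C. C \<in> down_classes G T D \<Longrightarrow> a C \<in> int_poly_exprs (mp_var ` W)"
  shows "ghost_cong q W (Phi G T q a) D"
proof -
  have "ghost_cong q W (\<lambda>E. \<Sum>C\<in>down_classes G T D. theta q C (a C) E) D"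
    using assms down_classes_subset by (intro ghost_cong_sum ghost_cong_theta) auto
  then show ?thesis
    using ghost_cong_cong[of "Phi G T q a" "\<lambda>E. \<Sum>C\<in>down_classes G T D. theta q C (a C) E"]
      Phi_eq_superset[OF D, of _ q a] by simp
qed

lemma ghost_cong_Phi_mult:
  assumes "\<And>C. C \<in> down_classes G T D \<Longrightarrow> a C \<in> int_poly_exprs (mp_var ` W)"
    and "\<And>C. C \<in> down_classes G T D \<Longrightarrow> a' C \<in> int_poly_exprs (mp_var ` W)"
  shows "ghost_cong q W (\<lambda>E. Phi G T q a E * Phi G T q a' E) D"
proof -
  have "ghost_cong q W (\<lambda>E. \<Sum>C\<in>down_classes G T D. \<Sum>C'\<in>down_classes G T D.
      theta q C (a C) E * theta q C' (a' C') E) D"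
    using assms down_classes_subset by (intro ghost_cong_sum ghost_cong_theta_mult) auto
  moreover have "Phi G T q a E * Phi G T q a' E = (\<Sum>C\<in>down_classes G T D. \<Sum>C'\<in>down_classes G T D.
      theta q C (a C) E * theta q C' (a' C') E)" if "E \<in> down_classes G T D" for E
    by (simp only: Phi_eq_superset[OF D that] sum_product)
  ultimately show ?thesis
    using ghost_cong_cong[of "\<lambda>E. Phi G T q a E * Phi G T q a' E" "\<lambda>E. \<Sum>C\<in>down_classes G T D.
      \<Sum>C'\<in>down_classes G T D. theta q C (a C) E * theta q C' (a' C') E"] by simp
qed

text \<open>One congruence gives integrality of \<open>r * a D\<close>, the other that of
  \<open>q\<^sup>2 * a D\<close>; as \<open>r\<close> is coprime to \<open>q\<close>, Bezout
  combines them.\<close>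

lemma integral_step:
  fixes W :: "'v set"
  assumes cong: "ghost_cong q W b D"
    and Phi: "\<And>C. C \<in> down_classes G T D \<Longrightarrow> Phi G T q a C = b C"
    and a: "\<And>C. C \<in> down_classes G T D \<Longrightarrow> C \<noteq> D \<Longrightarrow> a C \<in> int_poly_exprs (mp_var ` W)"
  shows "a D \<in> int_poly_exprs (mp_var ` W)"
proof -
  let ?S = "mp_var ` W :: ('v, rat) mpoly set"
  define \<delta> where "\<delta> E = b E + - (\<Sum>C\<in>down_classes G T D - {D}. theta q C (a C) E)" for E
  have "ghost_cong q W \<delta> D"
    unfolding \<delta>_def using a down_classes_subset
    by (intro ghost_cong_add ghost_cong_uminus ghost_cong_sum ghost_cong_theta cong) auto
  then obtain r where r: "coprime r q" "cong_in ?S n (of_int r * \<delta> D) 0"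
    and R: "\<delta> D \<in> int_poly_exprs ?S"
    and s: "cong_in ?S n (\<Sum>C\<in>carrier Q.
      adams (card (generate Q {C})) (of_int (q\<^sup>2) * \<delta> (conj_class G (adjoin U C)))) 0"
    unfolding ghost_cong_alt by blast
  have \<delta>D: "\<delta> D = of_nat n * a D"
    unfolding \<delta>_def Phi[OF down_classes_self[OF D], symmetric] Phi_split[OF D]
    by (simp add: class_fixed_self[OF D] n_def Q_def U_def)
  have "\<delta> (conj_class G (adjoin U C)) = 0" if C: "C \<in> carrier Q" "C \<noteq> U" for C
  proof -
    let ?E = "conj_class G (adjoin U C)"
    note E = adjoin_down[OF C(1)]
    have EO: "?E \<in> open_classes G T" using E down_classes_subset by blast
    have "theta q D (a D) ?E = 0"
      using class_fixed_eq_0[OF D EO adjoin_not_down[OF C]] by (simp add: theta_def)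
    moreover have "b ?E = theta q D (a D) ?E + (\<Sum>C\<in>down_classes G T D - {D}. theta q C (a C) ?E)"
      unfolding Phi[OF E, symmetric] Phi_eq_superset[OF D E]
      using finite_down_classes[OF D] down_classes_self[OF D] by (rule sum.remove)
    ultimately show ?thesis by (simp add: \<delta>_def)
  qed
  then have "(\<Sum>C\<in>carrier Q. adams (card (generate Q {C})) (of_int (q\<^sup>2) * \<delta> (conj_class G (adjoin U C))))
      = (\<Sum>C\<in>carrier Q. if C = U then adams (card (generate Q {U})) (of_int (q\<^sup>2) * \<delta> D) else 0)"
    by (intro sum.cong) (auto simp: adams_hom adjoin_unit)
  also have "\<dots> = adams (card (generate Q {U})) (of_int (q\<^sup>2) * \<delta> D)"
    using unit_in_weyl finite_weyl[OF rep_U(2,3)] by (simp add: Q_def)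
  \<comment> \<open>Only the unit of \<open>Q\<close> survives in the sum; its order is 1, and
    \<open>adams 1\<close> is the identity on integral elements.\<close>
  also have "card (generate Q {U}) = 1"
    using group.generate_one[OF weyl_is_group[OF rep_U(2,3)]] by (simp add: Q_def weyl_one[OF rep_U(2,3)])
  also have "adams 1 (of_int (q\<^sup>2) * \<delta> D) = of_int (q\<^sup>2) * \<delta> D"
    by (rule adams_1) (use R in \<open>intro int_poly_exprs_mult int_poly_exprs_of_int\<close>)
  finally have s': "cong_in ?S n (of_int (q\<^sup>2) * \<delta> D) 0" using s by simp
  \<comment> \<open>As \<open>\<delta> D\<close> is \<open>n\<close> times \<open>a D\<close>,
    divisibility of its multiple by \<open>n\<close> is integrality of that multiple of
    \<open>a D\<close>.\<close>
  have div: "of_int t * a D \<in> int_poly_exprs ?S" if t: "cong_in ?S n (of_int t * \<delta> D) 0" for t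
  proof -
    obtain k where k: "k \<in> int_poly_exprs ?S" "of_int t * \<delta> D = of_nat n * k"
      using t by (auto simp: cong_in_def)
    then have "of_nat n * (of_int t * a D) = of_nat n * k" by (simp add: \<delta>D mult_ac)
    then have "of_int t * a D = k" by (rule mpoly_cancel_of_nat) (use n_pos in simp)
    with k show ?thesis by simp
  qed
  have "coprime r (q\<^sup>2)" using r(1) by simp
  then obtain u v where "u * r + v * q\<^sup>2 = 1" by (metis bezout_int coprime_iff_gcd_eq_1)
  then have "a D = of_int (u * r + v * q\<^sup>2) * a D" by simp
  also have "\<dots> = of_int u * (of_int r * a D) + of_int v * (of_int (q\<^sup>2) * a D)"
    by (simp add: algebra_simps)
  also have "\<dots> \<in> int_poly_exprs ?S"
    by (intro int_poly_exprs_add int_poly_exprs_mult int_poly_exprs_of_int div r s')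
  finally show ?thesis .
qed

end

text \<open>Induction along \<open>ind\<close>. Monotonicity of the variable sets \<open>W\<close>
  moves integrality at lower classes into the ring at \<open>D\<close>.\<close>

lemma Phi_integral:
  assumes W: "\<And>D C. D \<in> open_classes G T \<Longrightarrow> C \<in> down_classes G T D \<Longrightarrow> W C \<subseteq> W D"
    and cong: "\<And>D. D \<in> open_classes G T \<Longrightarrow> ghost_cong q (W D) (Phi G T q a) D"
    and D: "D \<in> open_classes G T"
  shows "a D \<in> int_poly_exprs (mp_var ` W D)"
  using D
proof (induction "ind D" arbitrary: D rule: less_induct)
  case less
  show ?case
  proof (rule integral_step[OF less.prems cong[OF less.prems]])
    fix C assume C: "C \<in> down_classes G T D" "C \<noteq> D"
    then have "a C \<in> int_poly_exprs (mp_var ` W C)"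
      using less.hyps ind_less[OF less.prems] down_classes_subset by blast
    moreover have "mp_var ` W C \<subseteq> mp_var ` W D" using W[OF less.prems C(1)] by blast
    ultimately show "a C \<in> int_poly_exprs (mp_var ` W D)" using int_poly_exprs_mono by blast
  qed simp
qed

end

section \<open>Integrality of the universal operations, and negation by substitution\<close>

section \<open>The polynomials \<open>\<ss>\<close>, \<open>\<pp>\<close> and the inverse\<close>

context profinite_group
begin

lemma vec_x_vecA: "vec_x G T \<in> vecA G T" and vec_y_vecA: "vec_y G T \<in> vecA G T"
  by (auto simp: vec_x_def vec_y_def vecA_def ringA_def)

lemma ghost_add_vecA: "a \<in> vecA G T \<Longrightarrow> b \<in> vecA G T \<Longrightarrow> ghost_add G T a b \<in> vecA G T"
  by (auto simp: ghost_add_def vecA_def intro!: ringA_add)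

lemma ghost_mult_vecA: "a \<in> vecA G T \<Longrightarrow> b \<in> vecA G T \<Longrightarrow> ghost_mult G T a b \<in> vecA G T"
  by (auto simp: ghost_mult_def vecA_def intro!: ringA_mult)

lemma Phi_s_poly:
  assumes "D \<in> open_classes G T"
  shows "Phi G T q (s_poly G T q) D = Phi G T q (vec_x G T) D + Phi G T q (vec_y G T) D"
  using assms unfolding s_poly_def
  by (simp add: Phi_Phi_inv ghost_add_vecA Phi_vecA vec_x_vecA vec_y_vecA) (simp add: ghost_add_def)

lemma Phi_p_poly:
  assumes "D \<in> open_classes G T"
  shows "Phi G T q (p_poly G T q) D = Phi G T q (vec_x G T) D * Phi G T q (vec_y G T) D"
  using assms unfolding p_poly_def
  by (simp add: Phi_Phi_inv ghost_mult_vecA Phi_vecA vec_x_vecA vec_y_vecA) (simp add: ghost_mult_def)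

lemma vec_int_poly_exprs:
  assumes D: "D \<in> open_classes G T" and C: "C \<in> down_classes G T D"
  shows "X ` down_classes G T D \<subseteq> W \<Longrightarrow> vec_x G T C \<in> int_poly_exprs (mp_var ` W)"
    and "Y ` down_classes G T D \<subseteq> W \<Longrightarrow> vec_y G T C \<in> int_poly_exprs (mp_var ` W)"
  using C down_classes_subset[of D] by (auto simp: vec_x_def vec_y_def intro!: int_poly_exprs_base)

definition vars_xy :: "'a set set \<Rightarrow> 'a set set indet set"
  where "vars_xy D = X ` down_classes G T D \<union> Y ` down_classes G T D"

lemma vars_xy_mono:
  "D \<in> open_classes G T \<Longrightarrow> C \<in> down_classes G T D \<Longrightarrow> vars_xy C \<subseteq> vars_xy D"
  using down_classes_mono[of D C] by (auto simp: vars_xy_def)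

lemma s_poly_integral:
  assumes D: "D \<in> open_classes G T"
  shows "s_poly G T q D \<in> int_poly_exprs (mp_var ` vars_xy D)"
proof (rule Phi_integral[OF vars_xy_mono _ D])
  fix E assume E: "E \<in> open_classes G T"
  have "ghost_cong q (vars_xy E) (\<lambda>F. Phi G T q (vec_x G T) F + Phi G T q (vec_y G T) F) E"
    using vec_int_poly_exprs[OF E, of _ "vars_xy E"]
    by (intro ghost_cong_add ghost_cong_Phi E) (auto simp: vars_xy_def)
  then show "ghost_cong q (vars_xy E) (Phi G T q (s_poly G T q)) E"
    by (rule iffD1[OF ghost_cong_cong[OF E], rotated]) (metis Phi_s_poly down_classes_subset subsetD)
qed

lemma p_poly_integral:
  assumes D: "D \<in> open_classes G T"
  shows "p_poly G T q D \<in> int_poly_exprs (mp_var ` vars_xy D)"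
proof (rule Phi_integral[OF vars_xy_mono _ D])
  fix E assume E: "E \<in> open_classes G T"
  have "ghost_cong q (vars_xy E) (\<lambda>F. Phi G T q (vec_x G T) F * Phi G T q (vec_y G T) F) E"
    using vec_int_poly_exprs[OF E, of _ "vars_xy E"]
    by (intro ghost_cong_Phi_mult E) (auto simp: vars_xy_def)
  then show "ghost_cong q (vars_xy E) (Phi G T q (p_poly G T q)) E"
    by (rule iffD1[OF ghost_cong_cong[OF E], rotated]) (metis Phi_p_poly down_classes_subset subsetD)
qed

text \<open>The universal additive inverse for the addition given by \<open>s_poly\<close>,
  expressed in the indeterminates \<open>X\<close>.\<close>

definition neg_poly :: "int \<Rightarrow> 'a set set \<Rightarrow> ('a set set indet, rat) mpoly"
  where "neg_poly q = Phi_inv G T q (\<lambda>D\<in>open_classes G T. - Phi G T q (vec_x G T) D)"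

lemma Phi_neg_poly:
  assumes "D \<in> open_classes G T"
  shows "Phi G T q (neg_poly q) D = - Phi G T q (vec_x G T) D"
proof -
  have "(\<lambda>D\<in>open_classes G T. - Phi G T q (vec_x G T) D) \<in> vecA G T"
    using Phi_vecA[OF vec_x_vecA, of q] by (auto simp: vecA_def intro!: ringA_uminus)
  then show ?thesis unfolding neg_poly_def using assms by (simp add: Phi_Phi_inv)
qed

lemma neg_poly_integral:
  assumes D: "D \<in> open_classes G T"
  shows "neg_poly q D \<in> int_poly_exprs (mp_var ` (X ` down_classes G T D))"
proof (rule Phi_integral[OF _ _ D])
  show "X ` down_classes G T C \<subseteq> X ` down_classes G T E"
    if "E \<in> open_classes G T" "C \<in> down_classes G T E" for C E
    using down_classes_mono[OF that] by blast
  fix E assume E: "E \<in> open_classes G T"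
  have "ghost_cong q (X ` down_classes G T E) (\<lambda>F. - Phi G T q (vec_x G T) F) E"
    using vec_int_poly_exprs(1)[OF E, of _ "X ` down_classes G T E"]
    by (intro ghost_cong_uminus ghost_cong_Phi E) auto
  then show "ghost_cong q (X ` down_classes G T E) (Phi G T q (neg_poly q)) E"
    by (rule iffD1[OF ghost_cong_cong[OF E], rotated]) (metis Phi_neg_poly down_classes_subset subsetD)
qed

lemmas subst_xy_hom = mp_const_hom.mp_subst_hom[where f = "case_indet a b" for a b, folded subst_xy_def]

text \<open>Substitution is a ring homomorphism, and the coefficients of \<open>Phi\<close> are
  integers.\<close>

lemma Phi_subst:
  assumes "D \<in> open_classes G T"
  shows "subst_xy a b (Phi G T q c D) = Phi G T q (\<lambda>C. subst_xy a b (c C)) D"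
  using assms by (simp add: Phi_eq theta_def subst_xy_hom)

lemma Phi_restrict_cong:
  assumes "\<And>C. C \<in> open_classes G T \<Longrightarrow> a C = b C"
  shows "Phi G T q a = Phi G T q b"
  unfolding Phi_def using assms down_classes_subset by (intro restrict_ext sum.cong) (auto simp: subset_iff)

lemma Phi_subst_x:
  "D \<in> open_classes G T \<Longrightarrow> subst_xy a b (Phi G T q (vec_x G T) D) = Phi G T q a D"
  unfolding Phi_subst by (intro fun_cong[OF Phi_restrict_cong]) (simp add: vec_x_def subst_xy_hom)

lemma Phi_subst_y:
  "D \<in> open_classes G T \<Longrightarrow> subst_xy a b (Phi G T q (vec_y G T) D) = Phi G T q b D"
  unfolding Phi_subst by (intro fun_cong[OF Phi_restrict_cong]) (simp add: vec_y_def subst_xy_hom)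

text \<open>After substitution the ghost vector of \<open>s_poly\<close> is the sum of those of
  \<open>a\<close> and \<open>b\<close>, and \<open>Phi\<close> is injective with \<open>Phi\<close>
  of 0 equal to 0.\<close>

lemma subst_s_poly_eq_0_iff:
  fixes a b :: "'a set set \<Rightarrow> ('v, rat) mpoly"
  shows "(\<forall>D\<in>open_classes G T. 0 = subst_xy a b (s_poly G T q D))
    \<longleftrightarrow> (\<forall>D\<in>open_classes G T. Phi G T q b D = - Phi G T q a D)" (is "?L \<longleftrightarrow> ?R")
proof -
  let ?u = "\<lambda>D. subst_xy a b (s_poly G T q D)"
  have u: "Phi G T q ?u D = Phi G T q a D + Phi G T q b D" if D: "D \<in> open_classes G T" for D
    unfolding Phi_subst[OF D, symmetric] Phi_s_poly[OF D]
    by (simp add: subst_xy_hom Phi_subst_x[OF D] Phi_subst_y[OF D])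
  have zero: "Phi G T q (\<lambda>_. 0 :: ('v, rat) mpoly) D = 0" if D: "D \<in> open_classes G T" for D
    by (simp add: Phi_eq[OF D] theta_zero[OF D])
  show ?thesis
  proof
    assume ?L
    then have "Phi G T q ?u = Phi G T q (\<lambda>_. 0)" by (intro Phi_restrict_cong) simp
    then show ?R using u zero by (metis add.commute eq_neg_iff_add_eq_0)
  next
    assume R: ?R
    show ?L
    proof
      fix D assume "D \<in> open_classes G T"
      then have "?u D = (\<lambda>_. 0) D"
        using u zero R by (intro Phi_inject[of q ?u "\<lambda>_. 0"]) simp_all
      then show "0 = ?u D" by simp
    qed
  qed
qed

text \<open>Existence by substituting \<open>a\<close> into \<open>neg_poly\<close>; uniqueness
  because the ghost vector of any solution is minus that of \<open>a\<close>.\<close>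

lemma negative_exists_unique:
  assumes a: "a \<in> vecA G T"
  shows "\<exists>!\<iota>. \<iota> \<in> vecA G T \<and>
    (\<forall>D\<in>open_classes G T. \<iota> D \<in> int_poly_exprs (a ` down_classes G T D) \<and>
      0 = subst_xy a \<iota> (s_poly G T q D))"
proof (rule ex1I)
  \<comment> \<open>The value 0 for the indeterminates \<open>Y\<close> is arbitrary, as
    \<open>neg_poly\<close> is a polynomial in the \<open>X\<close> alone.\<close>
  let ?h = "subst_xy a (\<lambda>_. 0)"
  let ?i = "\<lambda>D\<in>open_classes G T. ?h (neg_poly q D)"
  have int: "?i D \<in> int_poly_exprs (a ` down_classes G T D)" if D: "D \<in> open_classes G T" for D
  proof -
    have "?h (neg_poly q D) \<in> int_poly_exprs (?h ` mp_var ` X ` down_classes G T D)"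
      using mp_const_hom.mp_subst_int_poly_exprs[OF neg_poly_integral[OF D]] by (simp add: subst_xy_def)
    also have "?h ` mp_var ` X ` down_classes G T D = a ` down_classes G T D"
      by (simp add: image_image subst_xy_hom)
    finally show ?thesis using D by simp
  qed
  have "?i \<in> vecA G T"
  proof -
    have "?i D \<in> ringA G T" if D: "D \<in> open_classes G T" for D
      using a down_classes_subset[of D] by (intro int_poly_exprs_ringA[OF int[OF D]]) (auto simp: vecA_def)
    then show ?thesis unfolding vecA_def by (intro PiE_I) auto
  qed
  moreover have "\<forall>D\<in>open_classes G T. 0 = subst_xy a ?i (s_poly G T q D)"
    unfolding subst_s_poly_eq_0_iff
  proof
    fix D assume D: "D \<in> open_classes G T"
    have "Phi G T q ?i D = Phi G T q (\<lambda>C. ?h (neg_poly q C)) D"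
      by (intro fun_cong[OF Phi_restrict_cong]) simp
    also have "\<dots> = - Phi G T q a D"
      unfolding Phi_subst[OF D, symmetric] Phi_neg_poly[OF D] by (simp add: subst_xy_hom Phi_subst_x[OF D])
    finally show "Phi G T q ?i D = - Phi G T q a D" .
  qed
  ultimately show i: "?i \<in> vecA G T \<and> (\<forall>D\<in>open_classes G T.
      ?i D \<in> int_poly_exprs (a ` down_classes G T D) \<and> 0 = subst_xy a ?i (s_poly G T q D))"
    using int by blast
  fix j assume j: "j \<in> vecA G T \<and> (\<forall>D\<in>open_classes G T.
      j D \<in> int_poly_exprs (a ` down_classes G T D) \<and> 0 = subst_xy a j (s_poly G T q D))"
  have "Phi G T q j D = Phi G T q ?i D" if "D \<in> open_classes G T" for D
  proof -
    have "\<forall>D\<in>open_classes G T. Phi G T q j D = - Phi G T q a D"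
      "\<forall>D\<in>open_classes G T. Phi G T q ?i D = - Phi G T q a D"
      using i j unfolding subst_s_poly_eq_0_iff[symmetric] by blast+
    then show ?thesis using that by simp
  qed
  then have "j D = ?i D" if "D \<in> open_classes G T" for D
    using that by (rule Phi_inject)
  then show "j = ?i"
    using i j unfolding vecA_def by (intro PiE_ext[of j _ _ ?i]) auto
qed

end

theorem lemma6p1:
  fixes G :: "('a, 'm) monoid_scheme" and T :: "'a topology" and q :: int
  assumes "profinite_group G T"
  shows "bij_betw (Phi G T q) (vecA G T) (vecA G T)
    \<and> (\<forall>U. open_subgroup G T U \<longrightarrow>
         s_poly G T q (conj_class G U) \<in>
           int_poly_exprs ((\<lambda>C. mp_var (X C)) ` down_classes G T (conj_class G U)
                         \<union> (\<lambda>C. mp_var (Y C)) ` down_classes G T (conj_class G U))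
       \<and> p_poly G T q (conj_class G U) \<in>
           int_poly_exprs ((\<lambda>C. mp_var (X C)) ` down_classes G T (conj_class G U)
                         \<union> (\<lambda>C. mp_var (Y C)) ` down_classes G T (conj_class G U)))
    \<and> (\<forall>a\<in>vecA G T. \<exists>!\<iota>. \<iota> \<in> vecA G T \<and>
         (\<forall>D\<in>open_classes G T.
            \<iota> D \<in> int_poly_exprs (a ` down_classes G T D) \<and>
            0 = subst_xy a \<iota> (s_poly G T q D)))"
proof -
  interpret profinite_group G T by fact
  have vars: "mp_var ` vars_xy D = (\<lambda>C. mp_var (X C)) ` down_classes G T D
      \<union> (\<lambda>C. mp_var (Y C)) ` down_classes G T D" for D
    by (simp add: vars_xy_def image_Un image_image)
  show ?thesis
    using bij_betw_Phi[of q] s_poly_integral[of _ q, unfolded vars] p_poly_integral[of _ q, unfolded vars]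
      conj_class_open negative_exists_unique[of _ q]
    by (intro conjI allI impI ballI) auto
qed

end
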